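(* Consider two Ornstein-Uhlenbeck systems $(A,B,K,C)$ on $X$ and $(\widetilde A,\widetilde B,\widetilde K,\widetilde C)$ on $\widetilde X$ (with the same output space $\mathcal H$), both exponentially stable and driven by the same $\mathbb R^d$-valued square-integrable mean-zero Lévy process $(M_t)_{t\ge 0}$, and let $T\in(0,\infty)$. Let $u,\widetilde u\in L^2_{\operatorname{ad}}(\Omega_T,\mathbb R^m)$, let $Y$ be the output of the first system with control $u$ and initial state $Z_0=0$, and let $\widetilde Y$ be the output of the second system with control $\widetilde u$ and initial state $\widetilde Z_0=0$ (so $Y_0=\widetilde Y_0=0$). Then $$\sup_{t\in[0,T]}\sqrt{\mathbb E\left[\|Y_t-\widetilde Y_t\|^2\right]}\le \sqrt 2\,\big(1\vee\|u\|_{L^2(\Omega_T)}\big)\Big(\operatorname{tr}\big(C\mathscr P^{\operatorname{ou}}C^*-2C\mathscr P^{\operatorname{ou}}_g\widetilde C^*+\widetilde C\widetilde{\mathscr P}^{\operatorname{ou}}\widetilde C^*\big)\Big)^{1/2}+\big(\operatorname{tr}(\widetilde C\widetilde P_1\widetilde C^* )\big)^{1/2}\|u-\widetilde u\|_{L^2(\Omega_T)}.$$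
   Context: $(\Omega,\mathcal F,\mathbb P)$ is a fixed probability space; $X,\widetilde X,\mathcal H$ are (real) separable Hilbert spaces. $(M_t)_{t\ge0}$ is an $\mathbb R^d$-valued square-integrable mean-zero Lévy process with induced filtration $(\mathcal F_t)$. An Ornstein-Uhlenbeck (OU) system $(A,B,K,C)$ on $X$ consists of the generator $A$ of a $C_0$-semigroup $(T_t)_{t\ge0}$ on $X$ and bounded linear maps $B:\mathbb R^m\to X$, $K:\mathbb R^d\to X$, $C:X\to\mathcal H$. It is exponentially stable if $\|T_t\|\le\nu e^{-\omega t}$ for all $t\ge 0$, for some $\omega>0$, $\nu\ge1$. Given a control $u$ and an initial state $\xi\in L^2(\Omega,\mathcal F_0,X)$, the state $Z$ is the mild solution of $\mathrm dZ_t=AZ_t\,\mathrm dt+Bu_t\,\mathrm dt+K\,\mathrm dM_t$, $Z_0=\xi$, and the output is $$Y_t=CZ_t=CT_t\xi+\int_0^tCT_{t-s}K\,\mathrm dM_s+\int_0^tCT_{t-s}Bu_s\,\mathrm ds.$$ The second system has semigroup $(\widetilde T_t)$ generated by $\widetilde A$. $\Omega_T:=\Omega\times(0,T)$, $\|f\|_{L^2(\Omega_T)}^2=\mathbb E\int_0^T\|f(t)\|^2\,\mathrm dt$, and $L^2_{\operatorname{ad}}$ denotes the adapted processes in $L^2$; $a\vee b=\max(a,b)$. Let $B_1:=B$, $B_2:=K\sqrt{\mathbb E(M_1M_1^* )}$, $\widetilde B_1:=\widetilde B$, $\widetilde B_2:=\widetilde K\sqrt{\mathbb E(M_1M_1^*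 )}$. For $i\in\{1,2\}$ set (integrals in the weak sense) $$P_i:=\int_0^\infty T_sB_iB_i^*T_s^*\,\mathrm ds,\quad P_{i,g}:=\int_0^\infty T_sB_i\widetilde B_i^*\widetilde T_s^*\,\mathrm ds,\quad \widetilde P_i:=\int_0^\infty\widetilde T_s\widetilde B_i\widetilde B_i^*\widetilde T_s^*\,\mathrm ds,$$ which solve $AP_i+P_iA^*=-B_iB_i^*$, $AP_{i,g}+P_{i,g}\widetilde A^*=-B_i\widetilde B_i^*$, $\widetilde A\widetilde P_i+\widetilde P_i\widetilde A^*=-\widetilde B_i\widetilde B_i^*$. Put $\mathscr P^{\operatorname{ou}}:=P_1+P_2$, $\mathscr P^{\operatorname{ou}}_g:=P_{1,g}+P_{2,g}$, $\widetilde{\mathscr P}^{\operatorname{ou}}:=\widetilde P_1+\widetilde P_2$. *)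

theory Defs
  imports "HOL-Probability.Probability"
begin

definition adj :: "('a::{real_inner,banach} \<Rightarrow>\<^sub>L 'b::{real_inner,banach}) \<Rightarrow> ('b \<Rightarrow>\<^sub>L 'a)" where
  "adj F = Blinfun (adjoint (blinfun_apply F))"

definition orthonormal_basis :: "'a::real_inner set \<Rightarrow> bool" where
  "orthonormal_basis E \<longleftrightarrow>
     pairwise orthogonal E \<and> (\<forall>e\<in>E. norm e = 1) \<and> closure (span E) = UNIV"

text \<open>For a trace class operator the sum converges unconditionally to one and the same number
  for every orthonormal basis.\<close>

definition op_trace :: "('a::{real_inner,banach} \<Rightarrow>\<^sub>L 'a) \<Rightarrow> real" where
  "op_trace F = (THE r. \<forall>E. orthonormal_basis E \<longrightarrow> ((\<lambda>e. blinfun_apply F e \<bullet> e) has_sum r) E)"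

definition weak_integral ::
  "(real \<Rightarrow> ('a::{real_inner,banach} \<Rightarrow>\<^sub>L 'b::{real_inner,banach})) \<Rightarrow> ('a \<Rightarrow>\<^sub>L 'b)" where
  "weak_integral F = (THE Q. \<forall>x y.
     set_integrable lborel {0..} (\<lambda>s. blinfun_apply (F s) x \<bullet> y) \<and>
     blinfun_apply Q x \<bullet> y = (LINT s:{0..}|lborel. blinfun_apply (F s) x \<bullet> y))"

definition c0_semigroup :: "(real \<Rightarrow> ('a::banach \<Rightarrow>\<^sub>L 'a)) \<Rightarrow> bool" where
  "c0_semigroup T \<longleftrightarrow>
     T 0 = id_blinfun \<and>
     (\<forall>s\<ge>0. \<forall>t\<ge>0. T (s + t) = T s o\<^sub>L T t) \<and>
     (\<forall>x. ((\<lambda>t. blinfun_apply (T t) x) \<longlongrightarrow> x) (at_right 0))"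

text \<open>The (in general unbounded) generator, given by its graph.\<close>

definition generator :: "(real \<Rightarrow> ('a::banach \<Rightarrow>\<^sub>L 'a)) \<Rightarrow> ('a \<times> 'a) set" where
  "generator T = {(x, y). ((\<lambda>h. (blinfun_apply (T h) x - x) /\<^sub>R h) \<longlongrightarrow> y) (at_right 0)}"

definition exponentially_stable :: "(real \<Rightarrow> ('a::banach \<Rightarrow>\<^sub>L 'a)) \<Rightarrow> bool" where
  "exponentially_stable T \<longleftrightarrow>
     (\<exists>\<omega>>0. \<exists>\<nu>\<ge>1. \<forall>t\<ge>0. norm (T t) \<le> \<nu> * exp (- \<omega> * t))"

text \<open>No path regularity is assumed: stochastic continuity already provides a modification with
  right-continuous paths that have left limits.\<close>

locale levy_process = prob_space P for P :: "'w measure" +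
  fixes M :: "real \<Rightarrow> 'w \<Rightarrow> 'v::euclidean_space"
  assumes random_variable: "\<And>t. 0 \<le> t \<Longrightarrow> M t \<in> borel_measurable P"
    and starts_at_0: "AE \<omega> in P. M 0 \<omega> = 0"
    and independent_increments:
      "\<And>(n::nat) r. 0 \<le> r 0 \<Longrightarrow> (\<forall>i<n. r i \<le> r (Suc i)) \<Longrightarrow>
         indep_vars (\<lambda>_. borel) (\<lambda>i \<omega>. M (r (Suc i)) \<omega> - M (r i) \<omega>) {..<n}"
    and stationary_increments:
      "\<And>s t. 0 \<le> s \<Longrightarrow> s \<le> t \<Longrightarrow>
         distr P borel (\<lambda>\<omega>. M t \<omega> - M s \<omega>) = distr P borel (M (t - s))"
    and stochastically_continuous:
      "\<And>t \<epsilon>. 0 \<le> t \<Longrightarrow> 0 < \<epsilon> \<Longrightarrow>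
         ((\<lambda>s. prob {\<omega>\<in>space P. norm (M s \<omega> - M t \<omega>) > \<epsilon>}) \<longlongrightarrow> 0) (at t within {0..})"

locale square_integrable_mean_zero_levy_process = levy_process +
  assumes square_integrable: "\<And>t. 0 \<le> t \<Longrightarrow> integrable P (\<lambda>\<omega>. (norm (M t \<omega>))\<^sup>2)"
    and mean_zero: "\<And>t. 0 \<le> t \<Longrightarrow> expectation (M t) = 0"

definition induced_filtration ::
  "'w measure \<Rightarrow> (real \<Rightarrow> 'w \<Rightarrow> 'v::euclidean_space) \<Rightarrow> real \<Rightarrow> 'w measure" where
  "induced_filtration P M t =
     sigma (space P) (\<Union>s\<in>{0..t}. {M s -` A \<inter> space P | A. A \<in> sets borel})"

definition covariance :: "'w measure \<Rightarrow> (real \<Rightarrow> 'w \<Rightarrow> real^'d) \<Rightarrow> real^'d^'d" where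
  "covariance P M = (\<chi> i j. LINT \<omega>|P. M 1 \<omega> $ i * M 1 \<omega> $ j)"

text \<open>The symmetric positive semidefinite square root is unique, so the choice is irrelevant.\<close>

definition psd_sqrt :: "real^'d^'d \<Rightarrow> real^'d^'d" where
  "psd_sqrt Q = (SOME R. transpose R = R \<and> (\<forall>v. 0 \<le> v \<bullet> (R *v v)) \<and> R ** R = Q)"

text \<open>A list of triples \<open>(a, b, F)\<close> represents the step function that is the sum of the
  functions \<open>F\<close> on \<open>(a, b]\<close>; the intervals may overlap.\<close>

definition step_on :: "real \<Rightarrow> (real \<times> real \<times> 'c) list \<Rightarrow> bool" where
  "step_on t D \<longleftrightarrow> (\<forall>(a, b, F)\<in>set D. 0 \<le> a \<and> a \<le> b \<and> b \<le> t)"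

definition step_fun :: "(real \<times> real \<times> 'c::real_vector) list \<Rightarrow> real \<Rightarrow> 'c" where
  "step_fun D s = (\<Sum>(a, b, F)\<leftarrow>D. indicator {a<..b} s *\<^sub>R F)"

definition step_integral ::
  "(real \<Rightarrow> 'w \<Rightarrow> 'v::euclidean_space) \<Rightarrow> (real \<times> real \<times> ('v \<Rightarrow>\<^sub>L 'a::real_normed_vector)) list
     \<Rightarrow> 'w \<Rightarrow> 'a" where
  "step_integral M D \<omega> = (\<Sum>(a, b, F)\<leftarrow>D. blinfun_apply F (M b \<omega> - M a \<omega>))"

text \<open>\<open>I\<close> is a version of the Ito integral \<open>\<integral>\<^sub>0\<^sup>t \<Phi>(s) dM\<^sub>s\<close> of the deterministic integrand \<open>\<Phi>\<close>, that is,
  the value at \<open>\<Phi>\<close> of the \<open>L\<^sup>2\<close>-continuous extension of the integral of step functions.\<close>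

definition has_stochastic_integral ::
  "'w measure \<Rightarrow> (real \<Rightarrow> 'w \<Rightarrow> 'v::euclidean_space) \<Rightarrow> real
     \<Rightarrow> (real \<Rightarrow> ('v \<Rightarrow>\<^sub>L 'a::{real_inner,banach,second_countable_topology})) \<Rightarrow> ('w \<Rightarrow> 'a) \<Rightarrow> bool"
where
  "has_stochastic_integral P M t \<Phi> I \<longleftrightarrow>
     set_borel_measurable lborel {0..t} \<Phi> \<and> I \<in> borel_measurable P \<and>
     (\<exists>D. (\<forall>n::nat. step_on t (D n)) \<and>
        ((\<lambda>n. \<integral>\<^sup>+s\<in>{0..t}. ennreal ((norm (step_fun (D n) s - \<Phi> s))\<^sup>2) \<partial>lborel) \<longlonglongrightarrow> 0) \<and>
        ((\<lambda>n. \<integral>\<^sup>+\<omega>. ennreal ((norm (step_integral M (D n) \<omega> - I \<omega>))\<^sup>2) \<partial>P) \<longlonglongrightarrow> 0))"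

definition L2_norm :: "'w measure \<Rightarrow> real \<Rightarrow> (real \<Rightarrow> 'w \<Rightarrow> 'a::euclidean_space) \<Rightarrow> real" where
  "L2_norm P \<tau> f = sqrt (LINT \<omega>|P. (LINT t:{0<..<\<tau>}|lborel. (norm (f t \<omega>))\<^sup>2))"

definition L2_ad ::
  "'w measure \<Rightarrow> (real \<Rightarrow> 'w measure) \<Rightarrow> real \<Rightarrow> (real \<Rightarrow> 'w \<Rightarrow> 'a::euclidean_space) set" where
  "L2_ad P \<F> \<tau> = {f.
     (\<lambda>(\<omega>, t). f t \<omega>) \<in> borel_measurable (P \<Otimes>\<^sub>M restrict_space lborel {0<..<\<tau>}) \<and>
     integrable (P \<Otimes>\<^sub>M restrict_space lborel {0<..<\<tau>}) (\<lambda>(\<omega>, t). (norm (f t \<omega>))\<^sup>2) \<and>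
     (\<forall>t\<in>{0<..<\<tau>}. f t \<in> borel_measurable (\<F> t))}"

text \<open>The generator \<open>A\<close> is carried along with its semigroup \<open>T\<close>. Boundedness of \<open>B\<close>, \<open>K\<close>, \<open>C\<close> is
  part of their types.\<close>

definition ou_system ::
  "('x::{real_inner,banach,second_countable_topology} \<times> 'x) set \<Rightarrow> (real \<Rightarrow> ('x \<Rightarrow>\<^sub>L 'x))
     \<Rightarrow> ((real^'m) \<Rightarrow>\<^sub>L 'x) \<Rightarrow> ((real^'d) \<Rightarrow>\<^sub>L 'x)
     \<Rightarrow> ('x \<Rightarrow>\<^sub>L 'h::{real_inner,banach,second_countable_topology}) \<Rightarrow> bool" where
  "ou_system A T B K C \<longleftrightarrow> c0_semigroup T \<and> A = generator T"

text \<open>\<open>Z\<close> is (a version of) the mild solution of \<open>dZ = A Z dt + B u dt + K dM\<close>, \<open>Z\<^sub>0 = \<xi>\<close>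
  on \<open>[0, \<tau>]\<close>, with \<open>T\<close> the semigroup generated by \<open>A\<close>.\<close>

definition mild_solution ::
  "'w measure \<Rightarrow> (real \<Rightarrow> 'w \<Rightarrow> real^'d) \<Rightarrow> real
     \<Rightarrow> (real \<Rightarrow> ('x::{real_inner,banach,second_countable_topology} \<Rightarrow>\<^sub>L 'x))
     \<Rightarrow> ((real^'m) \<Rightarrow>\<^sub>L 'x) \<Rightarrow> ((real^'d) \<Rightarrow>\<^sub>L 'x)
     \<Rightarrow> (real \<Rightarrow> 'w \<Rightarrow> real^'m) \<Rightarrow> ('w \<Rightarrow> 'x) \<Rightarrow> (real \<Rightarrow> 'w \<Rightarrow> 'x) \<Rightarrow> bool" where
  "mild_solution P M \<tau> T B K u \<xi> Z \<longleftrightarrow>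
     (\<forall>t\<in>{0..\<tau>}. Z t \<in> borel_measurable P \<and>
       (\<exists>I. has_stochastic_integral P M t (\<lambda>s. T (t - s) o\<^sub>L K) I \<and>
         (AE \<omega> in P. Z t \<omega> =
            blinfun_apply (T t) (\<xi> \<omega>) + I \<omega>
            + (LINT s:{0<..<t}|lborel. blinfun_apply (T (t - s)) (blinfun_apply B (u s \<omega>))))))"

definition ou_output ::
  "'w measure \<Rightarrow> (real \<Rightarrow> 'w \<Rightarrow> real^'d) \<Rightarrow> real
     \<Rightarrow> (real \<Rightarrow> ('x::{real_inner,banach,second_countable_topology} \<Rightarrow>\<^sub>L 'x))
     \<Rightarrow> ((real^'m) \<Rightarrow>\<^sub>L 'x) \<Rightarrow> ((real^'d) \<Rightarrow>\<^sub>L 'x) \<Rightarrow> ('x \<Rightarrow>\<^sub>L 'h::real_normed_vector)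
     \<Rightarrow> (real \<Rightarrow> 'w \<Rightarrow> real^'m) \<Rightarrow> ('w \<Rightarrow> 'x) \<Rightarrow> (real \<Rightarrow> 'w \<Rightarrow> 'h) \<Rightarrow> bool" where
  "ou_output P M \<tau> T B K C u \<xi> Y \<longleftrightarrow>
     (\<exists>Z. mild_solution P M \<tau> T B K u \<xi> Z \<and>
          (\<forall>t\<in>{0..\<tau>}. \<forall>\<omega>\<in>space P. Y t \<omega> = blinfun_apply C (Z t \<omega>)))"

text \<open>\<open>gramian T B T' B'\<close> is the weak integral of \<open>T\<^sub>s B B'\<^sup>* T'\<^sub>s\<^sup>*\<close>: the Gramians \<open>P\<^sub>i\<close> arise with
  both pairs equal, the cross Gramians \<open>P\<^sub>i\<^sub>,\<^sub>g\<close> with the second pair from the second system.\<close>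

definition gramian ::
  "(real \<Rightarrow> ('x::{real_inner,banach} \<Rightarrow>\<^sub>L 'x)) \<Rightarrow> ('v::euclidean_space \<Rightarrow>\<^sub>L 'x)
     \<Rightarrow> (real \<Rightarrow> ('y::{real_inner,banach} \<Rightarrow>\<^sub>L 'y)) \<Rightarrow> ('v \<Rightarrow>\<^sub>L 'y) \<Rightarrow> ('y \<Rightarrow>\<^sub>L 'x)" where
  "gramian T B T' B' = weak_integral (\<lambda>s. T s o\<^sub>L B o\<^sub>L adj B' o\<^sub>L adj (T' s))"

text \<open>\<open>B\<^sub>2 = K (E(M\<^sub>1 M\<^sub>1\<^sup>*))\<^sup>1\<^sup>/\<^sup>2\<close>.\<close>

definition noise_operator ::
  "'w measure \<Rightarrow> (real \<Rightarrow> 'w \<Rightarrow> real^'d) \<Rightarrow> ((real^'d) \<Rightarrow>\<^sub>L 'x::real_normed_vector)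
     \<Rightarrow> ((real^'d) \<Rightarrow>\<^sub>L 'x)" where
  "noise_operator P M K = K o\<^sub>L Blinfun (\<lambda>v. psd_sqrt (covariance P M) *v v)"

definition ou_gramian ::
  "'w measure \<Rightarrow> (real \<Rightarrow> 'w \<Rightarrow> real^'d)
     \<Rightarrow> (real \<Rightarrow> ('x::{real_inner,banach} \<Rightarrow>\<^sub>L 'x)) \<Rightarrow> ((real^'m) \<Rightarrow>\<^sub>L 'x) \<Rightarrow> ((real^'d) \<Rightarrow>\<^sub>L 'x)
     \<Rightarrow> (real \<Rightarrow> ('y::{real_inner,banach} \<Rightarrow>\<^sub>L 'y)) \<Rightarrow> ((real^'m) \<Rightarrow>\<^sub>L 'y) \<Rightarrow> ((real^'d) \<Rightarrow>\<^sub>L 'y)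
     \<Rightarrow> ('y \<Rightarrow>\<^sub>L 'x)" where
  "ou_gramian P M T B K T' B' K' =
     gramian T B T' B' + gramian T (noise_operator P M K) T' (noise_operator P M K')"

end

theory Submission
  imports Defs
begin

text \<open>Write \<open>I\<close>, \<open>I'\<close> for the stochastic convolutions of the two systems and
  \<open>G s = C T\<^sub>s B - C' T'\<^sub>s B'\<close>, \<open>G' s = C' T'\<^sub>s B'\<close>. Adding and subtracting the response of the second
  system to the control \<open>u\<close> gives, almost surely,

  \<open>Y\<^sub>t - Y'\<^sub>t = (C I\<^sub>t - C' I'\<^sub>t) + \<integral>\<^sub>0\<^sup>t G (t - s) u\<^sub>s ds + \<integral>\<^sub>0\<^sup>t G' (t - s) (u\<^sub>s - u'\<^sub>s) ds\<close>.

  The three terms are estimated in \<open>L\<^sup>2(\<Omega>)\<close>. Let \<open>a\<^sub>1\<close> and \<open>a\<^sub>3\<close> be the energies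
  \<open>\<integral>\<^sub>0\<^sup>\<infinity> \<parallel>G s\<parallel>\<^sup>2 ds\<close> and \<open>\<integral>\<^sub>0\<^sup>\<infinity> \<parallel>G' s\<parallel>\<^sup>2 ds\<close> in the Hilbert--Schmidt norm, and \<open>a\<^sub>2\<close> the energy of
  \<open>C T\<^sub>s K\<^sub>2 - C' T'\<^sub>s K'\<^sub>2\<close>, where \<open>K\<^sub>2\<close>, \<open>K'\<^sub>2\<close> are \<open>K\<close>, \<open>K'\<close> composed with the square root of the
  covariance matrix of the noise. The Cauchy--Schwarz inequality along each path bounds the control terms by
  \<open>a\<^sub>1\<^sup>1\<^sup>/\<^sup>2 \<parallel>u\<parallel>\<close> and \<open>a\<^sub>3\<^sup>1\<^sup>/\<^sup>2 \<parallel>u - u'\<parallel>\<close> (\<open>control_response_bound\<close>), and the Ito isometry bounds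
  the noise term by \<open>a\<^sub>2\<^sup>1\<^sup>/\<^sup>2\<close> (\<open>ito_inequality\<close>). With \<open>m = max 1 \<parallel>u\<parallel>\<close> the bounds for the noise and
  for the first control term add up to at most \<open>m (a\<^sub>1\<^sup>1\<^sup>/\<^sup>2 + a\<^sub>2\<^sup>1\<^sup>/\<^sup>2) \<le> 2\<^sup>1\<^sup>/\<^sup>2 m (a\<^sub>1 + a\<^sub>2)\<^sup>1\<^sup>/\<^sup>2\<close>, and these bounds do not depend on \<open>t\<close>.

  The energies are the traces in the theorem: the weak form of the Gramians turns the quadratic form of
  \<open>C P C\<^sup>* - 2 C P\<^sub>g C'\<^sup>* + C' P' C'\<^sup>*\<close> at \<open>e\<close> into an integral of the squares of the coefficients along \<open>e\<close>
  of the error impulse responses (\<open>error_gramian_inner\<close>), and Parseval's identity sums this over any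
  orthonormal basis (\<open>op_trace_error\<close>, \<open>op_trace_output_gramian\<close>).\<close>


section \<open>Adjoints and orthonormal bases in Hilbert spaces\<close>

text \<open>The representing vector is the minimiser of \<open>J x = \<parallel>x\<parallel>\<^sup>2 / 2 - \<phi> x\<close>: a minimising sequence is Cauchy
  by the parallelogram identity, and at the minimiser the derivative of \<open>J\<close> in each direction vanishes.\<close>

lemma riesz_representation:
  fixes \<phi> :: "'a::{real_inner,banach} \<Rightarrow> real"
  assumes "bounded_linear \<phi>"
  shows "\<exists>z. \<forall>x. \<phi> x = z \<bullet> x"
proof -
  interpret \<phi>: bounded_linear \<phi> by fact
  define J where "J x = (norm x)\<^sup>2 / 2 - \<phi> x" for x
  obtain c where c: "\<And>x. \<bar>\<phi> x\<bar> \<le> norm x * c"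
    using \<phi>.bounded by auto
  have J_lower: "- c\<^sup>2 / 2 \<le> J x" for x
  proof -
    have "0 \<le> (norm x - c)\<^sup>2" by simp
    then show ?thesis using c[of x] by (simp add: J_def power2_diff field_simps)
  qed
  define m where "m = (INF x. J x)"
  have bdd: "bdd_below (range J)" using J_lower by (intro bdd_belowI) auto
  have m_le: "m \<le> J x" for x unfolding m_def by (intro cINF_lower bdd) simp
  have "\<exists>x. J x < m + 1 / Suc n" for n
    using cINF_less_iff[of UNIV J "m + 1 / Suc n"] bdd by (simp add: m_def)
  then obtain f where f: "\<And>n. J (f n) < m + 1 / Suc n" by metis
  have parallelogram: "(norm (x - y))\<^sup>2 = 4 * (J x + J y - 2 * J ((1/2) *\<^sub>R (x + y)))" for x y
    unfolding J_def by (simp add: \<phi>.scaleR \<phi>.add power2_norm_eq_inner algebra_simps inner_commute)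
  have dist_f: "(dist (f i) (f j))\<^sup>2 \<le> 8 / Suc n" if "n \<le> i" "n \<le> j" for i j n
  proof -
    have "J (f i) \<le> m + 1 / Suc n" "J (f j) \<le> m + 1 / Suc n"
      using f[of i] f[of j] that frac_le[of 1 1 "real (Suc n)" "real (Suc i)"]
        frac_le[of 1 1 "real (Suc n)" "real (Suc j)"] by auto
    moreover have "m \<le> J ((1/2) *\<^sub>R (f i + f j))" by (rule m_le)
    ultimately show ?thesis unfolding dist_norm parallelogram by simp
  qed
  have "Cauchy f"
  proof (rule metric_CauchyI)
    fix e :: real assume "0 < e"
    then obtain n :: nat where "8 / e\<^sup>2 < n" using reals_Archimedean2 by blast
    then have "8 / Suc n < e\<^sup>2" using \<open>0 < e\<close> by (simp add: field_simps add_strict_increasing)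
    then have "dist (f i) (f j) < e" if "i \<ge> n" "j \<ge> n" for i j
      using dist_f[of n i j] that \<open>0 < e\<close>
      by (intro power_less_imp_less_base[of _ 2 e]) auto
    then show "\<exists>M. \<forall>m\<ge>M. \<forall>n\<ge>M. dist (f m) (f n) < e" by blast
  qed
  then obtain z where z: "f \<longlonglongrightarrow> z" by (auto simp: Cauchy_convergent_iff convergent_def)
  have "(\<lambda>n. J (f n)) \<longlonglongrightarrow> J z"
    unfolding J_def by (intro tendsto_intros z \<phi>.tendsto) auto
  moreover have "(\<lambda>n. m + 1 / Suc n) \<longlonglongrightarrow> m + 0"
    by (intro tendsto_intros LIMSEQ_inverse_real_of_nat[unfolded inverse_eq_divide])
  ultimately have "J z \<le> m"
    using f by (intro LIMSEQ_le[of "\<lambda>n. J (f n)" _ "\<lambda>n. m + 1 / Suc n"]) (auto intro: less_imp_le)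
  have "\<phi> x = z \<bullet> x" for x
  proof (cases "x = 0")
    case False
    define d where "d = z \<bullet> x - \<phi> x"
    \<comment> \<open>the step to the minimum of the parabola \<open>s \<mapsto> J (z + s x)\<close>\<close>
    define s where "s = - d / (norm x)\<^sup>2"
    have "J z \<le> J (z + s *\<^sub>R x)" using \<open>J z \<le> m\<close> m_le order_trans by blast
    also have "J (z + s *\<^sub>R x) = J z + s * d + s\<^sup>2 * (norm x)\<^sup>2 / 2"
      unfolding J_def d_def power2_norm_eq_inner
      by (simp add: \<phi>.scaleR \<phi>.add algebra_simps inner_commute power2_eq_square)
    also have "\<dots> = J z - d\<^sup>2 / (2 * (norm x)\<^sup>2)"
      using False by (simp add: s_def field_simps power2_eq_square)
    finally have "d\<^sup>2 / (2 * (norm x)\<^sup>2) \<le> 0" by simp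
    then have "d = 0" using False by (simp add: divide_le_0_iff)
    then show ?thesis by (simp add: d_def)
  qed simp
  then show ?thesis by blast
qed

text \<open>Without finite dimension it is the representation theorem that makes \<open>adjoint\<close> choose an actual
  adjoint. Its norm bound follows by testing the defining identity with the adjoint vector itself.\<close>

lemma adj_inner:
  fixes F :: "'a::{real_inner,banach} \<Rightarrow>\<^sub>L 'b::{real_inner,banach}"
  shows "adj F y \<bullet> x = y \<bullet> F x"
proof -
  have "\<exists>z. \<forall>x. F x \<bullet> y = x \<bullet> z" for y
    using riesz_representation[of "\<lambda>x. F x \<bullet> y", OF bounded_linear_compose[OF bounded_linear_inner_left blinfun.bounded_linear_right]]
    by (simp add: inner_commute)
  then have "\<exists>g. \<forall>x y. F x \<bullet> y = x \<bullet> g y" by metis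
  then have g: "F x \<bullet> y = x \<bullet> adjoint F y" for x y
    unfolding adjoint_def by (rule someI2_ex) blast
  have "bounded_linear (adjoint F)"
  proof (rule bounded_linear_intro)
    fix y show "norm (adjoint F y) \<le> norm y * norm F"
    proof (cases "adjoint F y = 0")
      case False
      have "norm (adjoint F y) * norm (adjoint F y) = F (adjoint F y) \<bullet> y"
        by (simp add: g flip: power2_eq_square power2_norm_eq_inner)
      also have "\<dots> \<le> norm (F (adjoint F y)) * norm y" by (rule norm_cauchy_schwarz)
      also have "\<dots> \<le> norm F * norm (adjoint F y) * norm y"
        by (intro mult_right_mono norm_blinfun) auto
      finally show ?thesis using False by (simp add: mult_ac)
    qed simp
  qed (simp_all add: vector_eq_ldot[symmetric] inner_right_distrib flip: g)
  then show ?thesis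
    by (simp add: adj_def bounded_linear_Blinfun_apply inner_commute[of _ x] flip: g)
       (simp add: inner_commute)
qed

text \<open>Distinct elements have distance \<open>2\<^sup>1\<^sup>/\<^sup>2 > 1\<close>, so that the balls of radius \<open>1/2\<close> around them are
  disjoint open sets. Countability is what allows the exchange of trace sums with integrals later on.\<close>

lemma countable_orthonormal:
  fixes E :: "'a::{real_inner,second_countable_topology} set"
  assumes "pairwise orthogonal E" "\<forall>e\<in>E. norm e = 1"
  shows "countable E"
proof -
  have far: "dist x y > 1" if "x \<in> E" "y \<in> E" "x \<noteq> y" for x y
  proof -
    have "(dist x y)\<^sup>2 = 2"
      using assms that by (auto simp: dist_norm power2_norm_eq_inner norm_eq_1 pairwise_def
          orthogonal_def algebra_simps inner_commute)
    then show ?thesis using power_le_imp_le_base[of "dist x y" 1 1]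
      by (metis dist_not_less_zero linorder_not_less not_numeral_le_zero numeral_le_one_iff
         one_power2 power_mono semiring_norm(69) zero_le_dist)
  qed
  have disj: "ball x (1/2) \<inter> ball y (1/2) = {}" if "x \<in> E" "y \<in> E" "x \<noteq> y" for x y
  proof -
    have False if "dist x z < 1/2" "dist y z < 1/2" for z
      using that dist_triangle2[of x y z] far[OF \<open>x \<in> E\<close> \<open>y \<in> E\<close> \<open>x \<noteq> y\<close>] by simp
    then show ?thesis by (auto simp: disjoint_iff)
  qed
  have "countable ((\<lambda>x. ball x (1/2)) ` E)"
    by (rule countable_disjoint_open_subsets)
      (use disj in \<open>auto simp: pairwise_image pairwise_def disjnt_def simp del: Int_iff\<close>)
  moreover have "inj_on (\<lambda>x. ball x (1/2)) E"
  proof (intro inj_onI)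
    fix x y assume "x \<in> E" "y \<in> E" "ball x (1/2) = ball y (1/2)"
    moreover have "x \<in> ball x (1/2)" by simp
    ultimately show "x = y" using disj by blast
  qed
  ultimately show ?thesis by (rule countable_image_inj_on)
qed

text \<open>Existence of a basis is needed for the uniqueness of the number chosen in \<open>op_trace\<close>. The basis
  arises from the Gram--Schmidt process along a countable dense set.\<close>

lemma orthonormal_basis_exists: "\<exists>E::'a::{real_inner,second_countable_topology} set. orthonormal_basis E"
proof -
  obtain D :: "'a set" where D: "countable D" "\<And>X. open X \<Longrightarrow> X \<noteq> {} \<Longrightarrow> \<exists>d\<in>D. d \<in> X"
    using countable_dense_setE by blast
  have "D \<noteq> {}" using D(2)[of UNIV] by auto
  define d where "d = from_nat_into D"
  have d: "range d = D" using \<open>D \<noteq> {}\<close> D(1) by (simp add: d_def range_from_nat_into)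
  \<comment> \<open>the residual of \<open>x\<close> after projection onto the span of \<open>E\<close>\<close>
  define r where "r E x = x - (\<Sum>e\<in>E. (x \<bullet> e) *\<^sub>R e)" for E and x :: 'a
  define S where "S = rec_nat {} (\<lambda>n E. if r E (d n) = 0 then E else insert (sgn (r E (d n))) E)"
  have S_Suc: "S (Suc n) = (if r (S n) (d n) = 0 then S n else insert (sgn (r (S n) (d n))) (S n))"
    and S_0: "S 0 = {}" for n
    by (simp_all add: S_def)
  have S_ortho: "finite (S n) \<and> pairwise orthogonal (S n) \<and> (\<forall>e\<in>S n. norm e = 1)" for n
  proof (induction n)
    case (Suc n)
    have "orthogonal (r (S n) x) e" if "e \<in> S n" for e x
    proof -
      have "(\<Sum>f\<in>S n. (x \<bullet> f) * (f \<bullet> e)) = (\<Sum>f\<in>S n. if f = e then x \<bullet> e else 0)"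
        using Suc that by (intro sum.cong) (auto simp: pairwise_def orthogonal_def norm_eq_1)
      also have "\<dots> = x \<bullet> e" using Suc that by simp
      finally show ?thesis by (simp add: r_def orthogonal_def inner_diff_left inner_sum_left)
    qed
    then show ?case using Suc
      by (auto simp: S_Suc pairwise_insert norm_sgn orthogonal_commute sgn_div_norm orthogonal_clauses)
  qed (simp add: S_0)
  have S_mono: "S m \<subseteq> S n" if "m \<le> n" for m n
    by (rule lift_Suc_mono_le[OF _ that]) (auto simp: S_Suc)
  have in_span: "d n \<in> span (S (Suc n))" for n
  proof -
    have "d n = r (S n) (d n) + (\<Sum>e\<in>S n. (d n \<bullet> e) *\<^sub>R e)" by (simp add: r_def)
    moreover have "(\<Sum>e\<in>S n. (d n \<bullet> e) *\<^sub>R e) \<in> span (S (Suc n))"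
      using S_mono[of n "Suc n"] by (intro span_sum span_scale span_base) auto
    moreover have "r (S n) (d n) \<in> span (S (Suc n))"
    proof (cases "r (S n) (d n) = 0")
      case True then show ?thesis by (simp add: span_zero)
    next
      case False
      have "r (S n) (d n) = norm (r (S n) (d n)) *\<^sub>R sgn (r (S n) (d n))"
        using False by (simp add: sgn_div_norm)
      also have "\<dots> \<in> span (S (Suc n))" using False by (intro span_scale span_base) (simp add: S_Suc)
      finally show ?thesis .
    qed
    ultimately show ?thesis by (metis span_add)
  qed
  define E where "E = (\<Union>n. S n)"
  have "D \<subseteq> span E"
  proof -
    have "d n \<in> span E" for n
      using in_span[of n] span_mono[of "S (Suc n)" E] by (auto simp: E_def)
    then show ?thesis using d by blast
  qed
  moreover have "closure D = UNIV"
  proof -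
    have "open (- closure D)" by (simp add: open_Compl)
    then show ?thesis using D(2)[of "- closure D"] closure_subset[of D] by blast
  qed
  ultimately have "closure (span E) = UNIV" using closure_mono by blast
  moreover have "pairwise orthogonal E"
  proof (unfold pairwise_def, intro ballI impI)
    fix x y assume "x \<in> E" "y \<in> E" "x \<noteq> y"
    then obtain m n where "x \<in> S m" "y \<in> S n" by (auto simp: E_def)
    then have "x \<in> S (max m n)" "y \<in> S (max m n)" using S_mono by (meson max.cobounded1 max.cobounded2 subsetD)+
    then show "orthogonal x y" using S_ortho \<open>x \<noteq> y\<close> by (metis pairwiseD)
  qed
  moreover have "\<forall>e\<in>E. norm e = 1" using S_ortho by (auto simp: E_def)
  ultimately show ?thesis unfolding orthonormal_basis_def by blast
qed

lemma norm_diff_square: "(norm (x - y))\<^sup>2 = (norm x)\<^sup>2 - 2 * (x \<bullet> y) + y \<bullet> y" for x :: "'a::real_inner"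
  by (simp add: power2_norm_eq_inner inner_diff inner_commute)

text \<open>A finite linear combination approximates \<open>x\<close> best when its coefficients are the inner products with
  the basis vectors. Hence density of the span pushes the finite sums up to \<open>\<parallel>x\<parallel>\<^sup>2\<close>.\<close>

lemma parseval:
  fixes x :: "'a::real_inner"
  assumes E: "orthonormal_basis E"
  shows "((\<lambda>e. (x \<bullet> e)\<^sup>2) has_sum (norm x)\<^sup>2) E"
proof -
  have residual: "(norm (x - (\<Sum>e\<in>F. c e *\<^sub>R e)))\<^sup>2
      = (norm x)\<^sup>2 - (\<Sum>e\<in>F. (x \<bullet> e)\<^sup>2) + (\<Sum>e\<in>F. (x \<bullet> e - c e)\<^sup>2)"
    if F: "finite F" "F \<subseteq> E" for F c
  proof -
    have "(\<Sum>e\<in>F. \<Sum>f\<in>F. c e * (c f * (f \<bullet> e))) = (\<Sum>e\<in>F. \<Sum>f\<in>F. if f = e then (c e)\<^sup>2 else 0)"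
      using E F by (intro sum.cong)
        (auto simp: orthonormal_basis_def pairwise_def orthogonal_def norm_eq_1 power2_eq_square subset_iff)
    also have "\<dots> = (\<Sum>e\<in>F. (c e)\<^sup>2)" using F by simp
    finally have y: "(\<Sum>e\<in>F. c e *\<^sub>R e) \<bullet> (\<Sum>e\<in>F. c e *\<^sub>R e) = (\<Sum>e\<in>F. (c e)\<^sup>2)"
      by (simp add: inner_sum_left inner_sum_right sum_distrib_left)
    have xy: "x \<bullet> (\<Sum>e\<in>F. c e *\<^sub>R e) = (\<Sum>e\<in>F. c e * (x \<bullet> e))"
      by (simp add: inner_sum_right)
    have "(norm (x - (\<Sum>e\<in>F. c e *\<^sub>R e)))\<^sup>2
        = (norm x)\<^sup>2 - 2 * (\<Sum>e\<in>F. c e * (x \<bullet> e)) + (\<Sum>e\<in>F. (c e)\<^sup>2)"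
      unfolding xy[symmetric] y[symmetric] by (rule norm_diff_square)
    also have "\<dots> = (norm x)\<^sup>2 - (\<Sum>e\<in>F. (x \<bullet> e)\<^sup>2) + (\<Sum>e\<in>F. (x \<bullet> e - c e)\<^sup>2)"
      by (simp add: power2_diff sum.distrib sum_subtractf sum_distrib_left algebra_simps)
    finally show ?thesis .
  qed
  have upper: "(\<Sum>e\<in>F. (x \<bullet> e)\<^sup>2) \<le> (norm x)\<^sup>2" if "finite F" "F \<subseteq> E" for F
    using residual[OF that, of "\<lambda>e. x \<bullet> e"] zero_le_power2[of "norm (x - (\<Sum>e\<in>F. (x \<bullet> e) *\<^sub>R e))"]
    by simp
  have "(SUP F\<in>{F. finite F \<and> F \<subseteq> E}. (\<Sum>e\<in>F. (x \<bullet> e)\<^sup>2)) = (norm x)\<^sup>2"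
  proof (rule cSup_eq_non_empty)
    fix b assume b: "\<And>s. s \<in> (\<lambda>F. \<Sum>e\<in>F. (x \<bullet> e)\<^sup>2) ` {F. finite F \<and> F \<subseteq> E} \<Longrightarrow> s \<le> b"
    show "(norm x)\<^sup>2 \<le> b"
    proof (rule field_le_epsilon)
      fix \<epsilon> :: real assume "0 < \<epsilon>"
      then have "x \<in> closure (span E)" using E by (simp add: orthonormal_basis_def)
      then obtain y where y: "y \<in> span E" "dist y x < sqrt \<epsilon>"
        using \<open>0 < \<epsilon>\<close> by (meson closure_approachable real_sqrt_gt_zero)
      then obtain F c where F: "finite F" "F \<subseteq> E" "y = (\<Sum>e\<in>F. c e *\<^sub>R e)"
        by (auto simp: span_explicit)
      have "(norm (x - y))\<^sup>2 \<le> \<epsilon>"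
        using y(2) \<open>0 < \<epsilon>\<close> by (metis dist_commute dist_norm less_eq_real_def norm_ge_zero power_mono real_sqrt_pow2)
      moreover have "0 \<le> (\<Sum>e\<in>F. (x \<bullet> e - c e)\<^sup>2)" by (simp add: sum_nonneg)
      moreover have "(\<Sum>e\<in>F. (x \<bullet> e)\<^sup>2) \<le> b" using F by (intro b) auto
      ultimately show "(norm x)\<^sup>2 \<le> b + \<epsilon>"
        using residual[OF F(1,2), of c] F(3) by simp
    qed
  qed (use upper in auto)
  moreover have "bdd_above (sum (\<lambda>e. (x \<bullet> e)\<^sup>2) ` {F. F \<subseteq> E \<and> finite F})"
    using upper by (intro bdd_aboveI[of _ "(norm x)\<^sup>2"]) auto
  ultimately show ?thesis
    using nonneg_bdd_above_has_sum[of E "\<lambda>e. (x \<bullet> e)\<^sup>2"] by (simp add: conj_commute)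
qed

lemma has_sum_iff_nn_integral_count_space:
  fixes f :: "'a \<Rightarrow> real"
  assumes "\<And>x. x \<in> A \<Longrightarrow> 0 \<le> f x" "0 \<le> r"
  shows "(f has_sum r) A \<longleftrightarrow> (\<integral>\<^sup>+x. ennreal (f x) \<partial>count_space A) = ennreal r"
proof
  assume s: "(f has_sum r) A"
  then have "Infinite_Set_Sum.abs_summable_on f A"
    by (metis abs_summable_equivalent has_sum_imp_summable summable_on_iff_abs_summable_on_real)
  then have "(\<integral>\<^sup>+x. ennreal (f x) \<partial>count_space A) = ennreal (infsetsum f A)"
    using assms by (intro nn_integral_conv_infsetsum) auto
  also have "infsetsum f A = r"
    using s infsetsum_infsum[OF \<open>Infinite_Set_Sum.abs_summable_on f A\<close>] infsumI by metis
  finally show "(\<integral>\<^sup>+x. ennreal (f x) \<partial>count_space A) = ennreal r" .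
next
  assume n: "(\<integral>\<^sup>+x. ennreal (f x) \<partial>count_space A) = ennreal r"
  moreover have "(\<integral>\<^sup>+x. ennreal (norm (f x)) \<partial>count_space A) = (\<integral>\<^sup>+x. ennreal (f x) \<partial>count_space A)"
    using assms by (intro nn_integral_cong) simp
  ultimately have a: "Infinite_Set_Sum.abs_summable_on f A"
    by (simp add: Infinite_Set_Sum.abs_summable_on_def integrable_iff_bounded)
  have "infsum f A = infsetsum f A" using infsetsum_infsum[OF a] by simp
  also have "\<dots> = r"
    using nn_integral_conv_infsetsum[OF a] n assms by (simp add: infsetsum_nonneg)
  finally show "(f has_sum r) A"
    using a by (metis abs_summable_equivalent abs_summable_summable has_sum_infsum)
qed

text \<open>Parseval's identity under the integral sign, by Tonelli for the countable basis.\<close>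

lemma has_sum_integral_coefficients:
  fixes g :: "'b \<Rightarrow> 'a::{real_inner,second_countable_topology}"
  assumes E: "orthonormal_basis E" and [measurable]: "g \<in> borel_measurable N"
    and int: "integrable N (\<lambda>s. (norm (g s))\<^sup>2)"
  shows "((\<lambda>e. LINT s|N. (g s \<bullet> e)\<^sup>2) has_sum (LINT s|N. (norm (g s))\<^sup>2)) E"
proof -
  have "countable E" using E countable_orthonormal by (auto simp: orthonormal_basis_def)
  have int_e: "integrable N (\<lambda>s. (g s \<bullet> e)\<^sup>2)" if "e \<in> E" for e
  proof (rule Bochner_Integration.integrable_bound[OF int])
    have "\<bar>g s \<bullet> e\<bar> \<le> norm (g s)" for s
      using that E Cauchy_Schwarz_ineq2[of "g s" e] by (auto simp: orthonormal_basis_def)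
    then show "AE s in N. norm ((g s \<bullet> e)\<^sup>2) \<le> norm ((norm (g s))\<^sup>2)"
      by (auto simp flip: abs_le_square_iff)
  qed simp
  have "(\<integral>\<^sup>+e. ennreal (LINT s|N. (g s \<bullet> e)\<^sup>2) \<partial>count_space E)
      = (\<integral>\<^sup>+e. \<integral>\<^sup>+s. ennreal ((g s \<bullet> e)\<^sup>2) \<partial>N \<partial>count_space E)"
    by (intro nn_integral_cong) (simp add: nn_integral_eq_integral int_e)
  also have "\<dots> = (\<integral>\<^sup>+s. \<integral>\<^sup>+e. ennreal ((g s \<bullet> e)\<^sup>2) \<partial>count_space E \<partial>N)"
    by (rule nn_integral_count_space_nn_integral[symmetric]) (use \<open>countable E\<close> in auto)
  also have "\<dots> = (\<integral>\<^sup>+s. ennreal ((norm (g s))\<^sup>2) \<partial>N)"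
    by (intro nn_integral_cong iffD1[OF has_sum_iff_nn_integral_count_space] parseval[OF E]) auto
  also have "\<dots> = ennreal (LINT s|N. (norm (g s))\<^sup>2)" using int by (simp add: nn_integral_eq_integral)
  finally show ?thesis by (simp add: has_sum_iff_nn_integral_count_space)
qed

lemma op_trace_eqI:
  fixes F :: "'a::{real_inner,banach,second_countable_topology} \<Rightarrow>\<^sub>L 'a"
  assumes "\<And>E. orthonormal_basis E \<Longrightarrow> ((\<lambda>e. F e \<bullet> e) has_sum r) E"
  shows "op_trace F = r"
  unfolding op_trace_def
  using orthonormal_basis_exists[where 'a='a] assms has_sum_unique by (intro the_equality) blast+


section \<open>Gramians and traces as energies of impulse responses\<close>

lemma exponentially_stable_bound:
  assumes "exponentially_stable T"
  obtains \<omega> \<nu> where "0 < \<omega>" "1 \<le> \<nu>" "\<And>t x. 0 \<le> t \<Longrightarrow> norm (T t x) \<le> \<nu> * exp (- \<omega> * t) * norm x"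
proof -
  obtain \<omega> \<nu> where *: "0 < \<omega>" "1 \<le> \<nu>" "\<And>t. 0 \<le> t \<Longrightarrow> norm (T t) \<le> \<nu> * exp (- \<omega> * t)"
    using assms by (auto simp: exponentially_stable_def)
  have "norm (T t x) \<le> \<nu> * exp (- \<omega> * t) * norm x" if "0 \<le> t" for t x
    by (rule order_trans[OF norm_blinfun mult_right_mono[OF *(3)[OF that]]]) simp
  with * that show ?thesis by blast
qed

text \<open>Right continuity at 0 carries over to all times, from both sides, because the operators of an
  exponentially stable semigroup are uniformly bounded.\<close>

lemma continuous_on_orbit:
  assumes T: "c0_semigroup T" "exponentially_stable T"
  shows "continuous_on {0..} (\<lambda>t. T t x)"
proof -
  obtain \<omega> \<nu> where \<nu>: "0 < \<omega>" "1 \<le> \<nu>" "\<And>t x. 0 \<le> t \<Longrightarrow> norm (T t x) \<le> \<nu> * exp (- \<omega> * t) * norm x"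
    using exponentially_stable_bound[OF T(2)] by blast
  have bound: "norm (T t x) \<le> \<nu> * norm x" if "0 \<le> t" for t x
  proof -
    have "\<nu> * exp (- \<omega> * t) \<le> \<nu> * 1" using \<nu>(1,2) that by (intro mult_left_mono) auto
    then have "\<nu> * exp (- \<omega> * t) * norm x \<le> \<nu> * norm x" by (intro mult_right_mono) auto
    then show ?thesis using \<nu>(3)[OF that, of x] by linarith
  qed
  have "uniformly_continuous_on {0..} (\<lambda>t. T t x)"
    unfolding uniformly_continuous_on_def
  proof (intro allI impI)
    fix e :: real assume "0 < e"
    then have "0 < e / \<nu>" using \<nu> by simp
    moreover have "((\<lambda>t. T t x) \<longlongrightarrow> x) (at_right 0)" using T(1) by (simp add: c0_semigroup_def)
    ultimately have "\<forall>\<^sub>F h in at_right 0. dist (T h x) x < e / \<nu>" by (simp add: tendstoD)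
    then obtain d where d: "0 < d" "\<And>h. 0 < h \<Longrightarrow> h < d \<Longrightarrow> dist (T h x) x < e / \<nu>"
      by (auto simp: eventually_at_right_field)
    have close: "dist (T t x) (T s x) < e" if "0 \<le> s" "s < t" "t - s < d" for s t
    proof -
      have "T t = T s o\<^sub>L T (t - s)"
        using T(1) that unfolding c0_semigroup_def
        by (metis add_diff_cancel_left' add_diff_eq diff_ge_0_iff_ge less_eq_real_def)
      then have "T t x - T s x = T s (T (t - s) x - x)" by (simp add: blinfun.diff_right)
      also have "norm \<dots> \<le> \<nu> * norm (T (t - s) x - x)" by (rule bound) fact
      also have "\<dots> < \<nu> * (e / \<nu>)"
        using d(2)[of "t - s"] that \<nu>(2) by (intro mult_strict_left_mono) (auto simp: dist_norm)
      finally show ?thesis using \<nu>(2) by (simp add: dist_norm)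
    qed
    have "dist (T t x) (T s x) < e" if "s \<in> {0..}" "t \<in> {0..}" "dist t s < d" for s t
      using close[of s t] close[of t s] that \<open>0 < e\<close>
      by (cases s t rule: linorder_cases) (auto simp: dist_real_def dist_commute)
    then show "\<exists>d>0. \<forall>s\<in>{0..}. \<forall>t\<in>{0..}. dist t s < d \<longrightarrow> dist (T t x) (T s x) < e"
      using d(1) by blast
  qed
  then show ?thesis by (rule uniformly_continuous_imp_continuous)
qed


text \<open>Continuity stands in for measurability: it is preserved by all operations below and also makes products
  of two such curves measurable.\<close>

definition L2_curve :: "(real \<Rightarrow> 'a::real_normed_vector) \<Rightarrow> bool" where
  "L2_curve g \<longleftrightarrow> continuous_on {0..} g \<and> set_integrable lborel {0..} (\<lambda>s. (norm (g s))\<^sup>2)"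

lemma continuous_on_set_borel_measurable:
  "continuous_on {0..} g \<Longrightarrow> set_borel_measurable lborel {0..} g" for g :: "real \<Rightarrow> 'a::real_normed_vector"
  by (simp add: borel_measurable_continuous_on_indicator set_borel_measurable_def)

lemma L2_curve_measurable:
  "L2_curve g \<Longrightarrow> set_borel_measurable lborel {0..} g"
  by (simp add: L2_curve_def borel_measurable_continuous_on_indicator set_borel_measurable_def)

lemma set_integrable_bound_real:
  fixes f g :: "real \<Rightarrow> 'a::{banach,second_countable_topology}"
  assumes "set_integrable lborel A h" "set_borel_measurable lborel A f" "\<And>s. s \<in> A \<Longrightarrow> norm (f s) \<le> (h s :: real)"
  shows "set_integrable lborel A f"
  unfolding set_integrable_def
  by (rule Bochner_Integration.integrable_bound[OF assms(1)[unfolded set_integrable_def]])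
    (use assms(2,3) in \<open>auto simp: set_borel_measurable_def indicator_def intro!: AE_I2 order_trans[OF _ abs_ge_self]\<close>)

lemma L2_curve_product_integrable:
  fixes f :: "real \<Rightarrow> 'a::{real_inner,second_countable_topology}"
    and g :: "real \<Rightarrow> 'b::{banach,second_countable_topology,real_normed_vector}"
  assumes f: "L2_curve f" and g: "L2_curve g"
  shows "set_integrable lborel {0..} (\<lambda>s. norm (f s) * norm (g s))"
    "set_integrable lborel {0..} (\<lambda>s. (f s \<bullet> x) *\<^sub>R g s)"
proof -
  have cont: "continuous_on {0..} f" "continuous_on {0..} g" using f g by (auto simp: L2_curve_def)
  have int: "set_integrable lborel {0..} (\<lambda>s. (norm (f s))\<^sup>2 + (norm (g s))\<^sup>2)"
    using f g by (intro set_integral_add) (auto simp: L2_curve_def)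
  show fg: "set_integrable lborel {0..} (\<lambda>s. norm (f s) * norm (g s))"
  proof (rule set_integrable_bound_real[OF int])
    show "norm (norm (f s) * norm (g s)) \<le> (norm (f s))\<^sup>2 + (norm (g s))\<^sup>2" for s
      using sum_squares_bound[of "norm (f s)" "norm (g s)"]
        mult_nonneg_nonneg[OF norm_ge_zero norm_ge_zero, of "f s" "g s"]
      unfolding real_norm_def abs_mult abs_norm_cancel by linarith
  qed (intro continuous_on_set_borel_measurable continuous_intros cont)
  have "set_integrable lborel {0..} (\<lambda>s. norm x * (norm (f s) * norm (g s)))"
    using fg by simp
  then show "set_integrable lborel {0..} (\<lambda>s. (f s \<bullet> x) *\<^sub>R g s)"
  proof (rule set_integrable_bound_real)
    show "norm ((f s \<bullet> x) *\<^sub>R g s) \<le> norm x * (norm (f s) * norm (g s))" for s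
      using mult_right_mono[OF Cauchy_Schwarz_ineq2[of "f s" x], of "norm (g s)"] by (simp add: mult_ac)
  qed (intro continuous_on_set_borel_measurable continuous_intros cont)
qed

lemma L2_curve_blinfun:
  assumes "L2_curve f" shows "L2_curve (\<lambda>s. blinfun_apply C (f s))"
  unfolding L2_curve_def
proof
  have f: "continuous_on {0..} f" and i: "set_integrable lborel {0..} (\<lambda>s. (norm C)\<^sup>2 * (norm (f s))\<^sup>2)"
    using assms by (auto simp: L2_curve_def)
  show *: "continuous_on {0..} (\<lambda>s. blinfun_apply C (f s))"
    by (intro continuous_intros f)
  show "set_integrable lborel {0..} (\<lambda>s. (norm (blinfun_apply C (f s)))\<^sup>2)"
  proof (rule set_integrable_bound_real[OF i])
    show "norm ((norm (blinfun_apply C (f s)))\<^sup>2) \<le> (norm C)\<^sup>2 * (norm (f s))\<^sup>2" for s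
      using power_mono[OF norm_blinfun[of C "f s"], of 2] by (simp add: power_mult_distrib)
  qed (intro continuous_on_set_borel_measurable continuous_intros *)
qed

lemma norm_diff_power2_le: "(norm (x - y))\<^sup>2 \<le> 2 * (norm x)\<^sup>2 + 2 * (norm y)\<^sup>2"
  for x :: "'a::real_normed_vector"
proof -
  have "(norm (x - y))\<^sup>2 \<le> (norm x + norm y)\<^sup>2" by (intro power_mono norm_triangle_ineq4) simp
  also have "\<dots> \<le> 2 * (norm x)\<^sup>2 + 2 * (norm y)\<^sup>2"
    using sum_squares_bound[of "norm x" "norm y"] by (simp add: power2_sum)
  finally show ?thesis .
qed

lemma L2_curve_diff:
  assumes f: "L2_curve f" and g: "L2_curve g" shows "L2_curve (\<lambda>s. f s - g s)"
  unfolding L2_curve_def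
proof
  have cont: "continuous_on {0..} f" "continuous_on {0..} g" using f g by (auto simp: L2_curve_def)
  show *: "continuous_on {0..} (\<lambda>s. f s - g s)" by (intro continuous_intros cont)
  have i: "set_integrable lborel {0..} (\<lambda>s. 2 * (norm (f s))\<^sup>2 + 2 * (norm (g s))\<^sup>2)"
    using f g by (intro set_integral_add) (auto simp: L2_curve_def)
  show "set_integrable lborel {0..} (\<lambda>s. (norm (f s - g s))\<^sup>2)"
    by (rule set_integrable_bound_real[OF i])
      (intro continuous_on_set_borel_measurable continuous_intros cont, simp add: norm_diff_power2_le)
qed

lemma set_integrable_exp_decay:
  assumes "0 < a" shows "set_integrable lborel {0..} (\<lambda>s::real. exp (- a * s))"
proof -
  have "(\<integral>\<^sup>+s. ennreal (exp (- a * s)) * indicator {0..} s \<partial>lborel) = ennreal (0 - (- exp (- a * 0) / a))"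
  proof (rule nn_integral_FTC_atLeast)
    show "((\<lambda>s. - exp (- a * s) / a) has_real_derivative exp (- a * s)) (at s)" for s
      using assms by (auto intro!: derivative_eq_intros)
    show "((\<lambda>s. - exp (- a * s) / a) \<longlongrightarrow> 0) at_top"
      using assms by real_asymp
  qed auto
  moreover have "(\<integral>\<^sup>+s. ennreal (indicator {0..} s *\<^sub>R exp (- a * s)) \<partial>lborel)
      = (\<integral>\<^sup>+s. ennreal (exp (- a * s)) * indicator {0..} s \<partial>lborel)"
    by (intro nn_integral_cong) (simp add: indicator_def)
  ultimately show ?thesis
    unfolding set_integrable_def by (intro integrableI_nonneg) auto
qed

lemma L2_curve_orbit:
  assumes T: "c0_semigroup T" "exponentially_stable T"
  shows "L2_curve (\<lambda>t. T t x)"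
  unfolding L2_curve_def
proof
  show cont: "continuous_on {0..} (\<lambda>t. T t x)" by (rule continuous_on_orbit[OF T])
  obtain \<omega> \<nu> where \<nu>: "0 < \<omega>" "1 \<le> \<nu>" "\<And>t x. 0 \<le> t \<Longrightarrow> norm (T t x) \<le> \<nu> * exp (- \<omega> * t) * norm x"
    using exponentially_stable_bound[OF T(2)] by blast
  have i: "set_integrable lborel {0..} (\<lambda>s. (\<nu> * norm x)\<^sup>2 * exp (- (2 * \<omega>) * s))"
    using set_integrable_exp_decay[of "2 * \<omega>"] \<nu>(1) by simp
  show "set_integrable lborel {0..} (\<lambda>t. (norm (T t x))\<^sup>2)"
  proof (rule set_integrable_bound_real[OF i])
    fix s :: real assume "s \<in> {0..}"
    then have "(norm (T s x))\<^sup>2 \<le> (\<nu> * exp (- \<omega> * s) * norm x)\<^sup>2" by (intro power_mono \<nu>) auto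
    also have "\<dots> = (\<nu> * norm x)\<^sup>2 * exp (- (2 * \<omega>) * s)"
      by (simp add: power_mult_distrib flip: exp_double)
    finally show "norm ((norm (T s x))\<^sup>2) \<le> (\<nu> * norm x)\<^sup>2 * exp (- (2 * \<omega>) * s)" by simp
  qed (intro continuous_on_set_borel_measurable continuous_intros cont)
qed

text \<open>The operator required by \<open>weak_integral\<close> is the pointwise Bochner integral, which the integrable
  bound \<open>k\<close> makes a bounded operator. The weak identity determines it uniquely.\<close>

lemma weak_integral_inner:
  fixes F :: "real \<Rightarrow> 'a::{real_inner,banach} \<Rightarrow>\<^sub>L 'b::{real_inner,banach,second_countable_topology}"
  assumes F: "\<And>x. set_integrable lborel {0..} (\<lambda>s. F s x)"
    and k: "set_integrable lborel {0..} k" "\<And>s x. 0 \<le> s \<Longrightarrow> norm (F s x) \<le> k s * norm x"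
  shows "weak_integral F x \<bullet> y = (LINT s:{0..}|lborel. F s x \<bullet> y)"
proof -
  define Q where "Q = Blinfun (\<lambda>x. LINT s:{0..}|lborel. F s x)"
  have "bounded_linear (\<lambda>x. LINT s:{0..}|lborel. F s x)"
  proof (rule bounded_linear_intro)
    fix x
    have "norm (LINT s:{0..}|lborel. F s x) \<le> (LINT s:{0..}|lborel. norm (F s x))"
      by (rule set_integral_norm_bound[OF F])
    also have "\<dots> \<le> (LINT s:{0..}|lborel. k s * norm x)"
      using k by (intro set_integral_mono set_integrable_norm F) auto
    finally show "norm (LINT s:{0..}|lborel. F s x) \<le> norm x * (LINT s:{0..}|lborel. k s)"
      by (simp add: mult.commute)
  qed (simp_all add: blinfun.add_right blinfun.scaleR_right F)
  then have Q: "Q x = (LINT s:{0..}|lborel. F s x)" for x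
    by (simp add: Q_def bounded_linear_Blinfun_apply)
  have int: "set_integrable lborel {0..} (\<lambda>s. F s x \<bullet> y)" for x y
    using integrable_inner_left[OF F[unfolded set_integrable_def]]
    by (simp add: set_integrable_def)
  have inner: "Q x \<bullet> y = (LINT s:{0..}|lborel. F s x \<bullet> y)" for x y
    using integral_inner_left[OF F[unfolded set_integrable_def]]
    by (simp add: Q set_lebesgue_integral_def)
  have "weak_integral F = Q"
    unfolding weak_integral_def
  proof (rule the_equality)
    fix Q' assume "\<forall>x y. set_integrable lborel {0..} (\<lambda>s. F s x \<bullet> y) \<and> blinfun_apply Q' x \<bullet> y = (LINT s:{0..}|lborel. F s x \<bullet> y)"
    then show "Q' = Q"
      by (intro blinfun_eqI vector_eq_rdot[THEN iffD1]) (simp add: inner)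
  qed (simp add: int inner)
  then show ?thesis by (simp add: inner)
qed

lemma set_integrable_sum:
  fixes f :: "'i \<Rightarrow> 'a \<Rightarrow> 'b::{banach,second_countable_topology}"
  assumes "\<And>i. i \<in> I \<Longrightarrow> set_integrable N A (f i)"
  shows "set_integrable N A (\<lambda>s. \<Sum>i\<in>I. f i s)"
  using assms unfolding set_integrable_def scaleR_sum_right by (intro Bochner_Integration.integrable_sum)

lemma set_integral_sum:
  fixes f :: "'i \<Rightarrow> 'a \<Rightarrow> 'b::{banach,second_countable_topology}"
  assumes "\<And>i. i \<in> I \<Longrightarrow> set_integrable N A (f i)"
  shows "(LINT s:A|N. \<Sum>i\<in>I. f i s) = (\<Sum>i\<in>I. LINT s:A|N. f i s)"
  using assms unfolding set_integrable_def set_lebesgue_integral_def scaleR_sum_right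
  by (intro Bochner_Integration.integral_sum)

text \<open>Since \<open>B\<close> and \<open>B'\<close> start from a finite-dimensional space, the integrand of a Gramian is a finite sum of
  rank-one operators built from the curves \<open>s \<mapsto> T\<^sub>s B b\<close> and \<open>s \<mapsto> T'\<^sub>s B' b\<close>. These are continuous
  and square integrable, which is all that is needed for the Bochner integrals to exist.\<close>

lemma gramian_inner:
  fixes B :: "'v::euclidean_space \<Rightarrow>\<^sub>L 'x::{real_inner,banach,second_countable_topology}"
    and B' :: "'v \<Rightarrow>\<^sub>L 'y::{real_inner,banach,second_countable_topology}"
  assumes T: "c0_semigroup T" "exponentially_stable T"
    and T': "c0_semigroup T'" "exponentially_stable T'"
  shows "gramian T B T' B' x \<bullet> y
    = (\<Sum>b\<in>Basis. LINT s:{0..}|lborel. (T' s (B' b) \<bullet> x) * (T s (B b) \<bullet> y))"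
proof -
  note [intro] = L2_curve_orbit[OF T] L2_curve_orbit[OF T']
  let ?F = "\<lambda>s. T s o\<^sub>L B o\<^sub>L adj B' o\<^sub>L adj (T' s)"
  have F: "?F s x = (\<Sum>b\<in>Basis. (T' s (B' b) \<bullet> x) *\<^sub>R T s (B b))" for s x
  proof -
    let ?z = "adj B' (adj (T' s) x)"
    have "?F s x = T s (B (\<Sum>b\<in>Basis. (?z \<bullet> b) *\<^sub>R b))" by (simp add: euclidean_representation)
    also have "\<dots> = (\<Sum>b\<in>Basis. (?z \<bullet> b) *\<^sub>R T s (B b))"
      by (simp only: blinfun.sum_right blinfun.scaleR_right)
    finally show ?thesis by (simp add: adj_inner inner_commute[of x])
  qed
  have "gramian T B T' B' x \<bullet> y = (LINT s:{0..}|lborel. ?F s x \<bullet> y)"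
    unfolding gramian_def
  proof (rule weak_integral_inner)
    show "set_integrable lborel {0..} (\<lambda>s. ?F s x)" for x
      unfolding F by (intro set_integrable_sum L2_curve_product_integrable) auto
    show "set_integrable lborel {0..} (\<lambda>s. \<Sum>b\<in>Basis. norm (T' s (B' b)) * norm (T s (B b)))"
      by (intro set_integrable_sum L2_curve_product_integrable) auto
    show "norm (?F s x) \<le> (\<Sum>b\<in>Basis. norm (T' s (B' b)) * norm (T s (B b))) * norm x" for s x
      unfolding F sum_distrib_right
    proof (rule sum_norm_le)
      fix b
      show "norm ((T' s (B' b) \<bullet> x) *\<^sub>R T s (B b)) \<le> norm (T' s (B' b)) * norm (T s (B b)) * norm x"
        using mult_right_mono[OF Cauchy_Schwarz_ineq2[of "T' s (B' b)" x], of "norm (T s (B b))"]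
        by (simp add: mult_ac)
    qed
  qed
  also have "\<dots> = (LINT s:{0..}|lborel. \<Sum>b\<in>Basis. (T' s (B' b) \<bullet> x) * (T s (B b) \<bullet> y))"
    unfolding F by (simp add: inner_sum_left)
  also have "\<dots> = (\<Sum>b\<in>Basis. LINT s:{0..}|lborel. (T' s (B' b) \<bullet> x) * (T s (B b) \<bullet> y))"
  proof (rule set_integral_sum)
    fix b
    show "set_integrable lborel {0..} (\<lambda>s. (T' s (B' b) \<bullet> x) * (T s (B b) \<bullet> y))"
      using integrable_inner_left[where c=y, OF L2_curve_product_integrable(2)[OF L2_curve_orbit[OF T']
          L2_curve_orbit[OF T], unfolded set_integrable_def]]
      by (simp add: set_integrable_def mult.assoc)
  qed
  finally show ?thesis .
qed

text \<open>The square of the \<open>H\<^sup>2\<close> norm: the energy of the responses \<open>s \<mapsto> D s b\<close> to unit impulses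
  at time 0 in the directions of a basis. For linear \<open>D s\<close> it is the integral of the squared
  Hilbert--Schmidt norm.\<close>

definition impulse_energy :: "(real \<Rightarrow> 'v::euclidean_space \<Rightarrow> 'h::real_normed_vector) \<Rightarrow> real" where
  "impulse_energy D = (\<Sum>b\<in>Basis. LINT s:{0..}|lborel. (norm (D s b))\<^sup>2)"

lemma has_sum_finite_sum:
  fixes f :: "'i \<Rightarrow> 'a \<Rightarrow> 'b::topological_comm_monoid_add"
  assumes "\<And>i. i \<in> I \<Longrightarrow> (f i has_sum r i) A"
  shows "((\<lambda>x. \<Sum>i\<in>I. f i x) has_sum (\<Sum>i\<in>I. r i)) A"
  using assms by (induction I rule: infinite_finite_induct) (auto intro: has_sum_add)

lemma has_sum_impulse_energy:
  fixes D :: "real \<Rightarrow> 'v::euclidean_space \<Rightarrow> 'h::{real_inner,second_countable_topology}"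
  assumes "orthonormal_basis E" and D: "\<And>b. L2_curve (\<lambda>s. D s b)"
  shows "((\<lambda>e. \<Sum>b\<in>Basis. LINT s:{0..}|lborel. (D s b \<bullet> e)\<^sup>2) has_sum impulse_energy D) E"
  unfolding impulse_energy_def
proof (rule has_sum_finite_sum)
  fix b
  let ?g = "\<lambda>s. indicator {0..} s *\<^sub>R D s b"
  have sq: "(?g s \<bullet> e)\<^sup>2 = indicator {0..} s *\<^sub>R (D s b \<bullet> e)\<^sup>2"
    "(norm (?g s))\<^sup>2 = indicator {0..} s *\<^sub>R (norm (D s b))\<^sup>2" for s e
    by (simp_all add: indicator_def)
  have "((\<lambda>e. LINT s|lborel. (?g s \<bullet> e)\<^sup>2) has_sum (LINT s|lborel. (norm (?g s))\<^sup>2)) E"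
    using D[of b] L2_curve_measurable[OF D[of b]]
    by (intro has_sum_integral_coefficients assms(1))
      (simp_all only: sq L2_curve_def set_borel_measurable_def set_integrable_def)
  then show "((\<lambda>e. LINT s:{0..}|lborel. (D s b \<bullet> e)\<^sup>2) has_sum (LINT s:{0..}|lborel. (norm (D s b))\<^sup>2)) E"
    unfolding sq set_lebesgue_integral_def .
qed

text \<open>Completing the square: in the weak form of the three Gramians at \<open>C\<^sup>* e\<close> and \<open>C'\<^sup>* e\<close> the integrands are
  sums over the basis of \<open>f\<^sup>2\<close>, \<open>f g\<close> and \<open>g\<^sup>2\<close>, with \<open>f\<close> and \<open>g\<close> the coefficients along \<open>e\<close> of the two impulse responses.\<close>

lemma error_gramian_inner:
  fixes B :: "'v::euclidean_space \<Rightarrow>\<^sub>L 'x::{real_inner,banach,second_countable_topology}"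
    and B' :: "'v \<Rightarrow>\<^sub>L 'y::{real_inner,banach,second_countable_topology}"
    and C :: "'x \<Rightarrow>\<^sub>L 'h::{real_inner,banach,second_countable_topology}"
  assumes T: "c0_semigroup T" "exponentially_stable T"
    and T': "c0_semigroup T'" "exponentially_stable T'"
  shows "C (gramian T B T B (adj C e)) \<bullet> e - 2 * (C (gramian T B T' B' (adj C' e)) \<bullet> e)
      + C' (gramian T' B' T' B' (adj C' e)) \<bullet> e
    = (\<Sum>b\<in>Basis. LINT s:{0..}|lborel. ((C (T s (B b)) - C' (T' s (B' b))) \<bullet> e)\<^sup>2)"
proof -
  have flip: "C z \<bullet> e = z \<bullet> adj C e" "C' z' \<bullet> e = z' \<bullet> adj C' e" for z z' e
    using adj_inner[of C e z] adj_inner[of C' e z'] by (simp_all add: inner_commute)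
  define f where "f b s = T s (B b) \<bullet> adj C e" for b s
  define g where "g b s = T' s (B' b) \<bullet> adj C' e" for b s
  have int: "set_integrable lborel {0..} (\<lambda>s. f b s * f b s)"
    "set_integrable lborel {0..} (\<lambda>s. g b s * f b s)"
    "set_integrable lborel {0..} (\<lambda>s. g b s * g b s)" for b
  proof -
    have "L2_curve (\<lambda>s. (T s (B b)) \<bullet> adj C e)" "L2_curve (\<lambda>s. (T' s (B' b)) \<bullet> adj C' e)"
      using L2_curve_blinfun[OF L2_curve_orbit[OF T], of "blinfun_inner_left (adj C e)"]
        L2_curve_blinfun[OF L2_curve_orbit[OF T'], of "blinfun_inner_left (adj C' e)"]
      by (simp_all add: inner_commute)
    note L2_curve_product_integrable(2)[where x=1, OF this(1) this(1)] L2_curve_product_integrable(2)[where x=1, OF this(2) this(1)]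
       L2_curve_product_integrable(2)[where x=1, OF this(2) this(2)]
    then show "set_integrable lborel {0..} (\<lambda>s. f b s * f b s)"
    "set_integrable lborel {0..} (\<lambda>s. g b s * f b s)"
    "set_integrable lborel {0..} (\<lambda>s. g b s * g b s)"
      by (simp_all add: f_def g_def)
  qed
  have "(LINT s:{0..}|lborel. ((C (T s (B b)) - C' (T' s (B' b))) \<bullet> e)\<^sup>2)
      = (LINT s:{0..}|lborel. f b s * f b s) - 2 * (LINT s:{0..}|lborel. g b s * f b s)
        + (LINT s:{0..}|lborel. g b s * g b s)" for b
  proof -
    have "((C (T s (B b)) - C' (T' s (B' b))) \<bullet> e)\<^sup>2 = f b s * f b s - 2 * (g b s * f b s) + g b s * g b s" for s
      by (simp add: inner_diff_left flip f_def g_def power2_eq_square algebra_simps)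
    then show ?thesis
      using int[of b] by (simp add: set_integral_add set_integral_diff)
  qed
  then show ?thesis
    by (simp add: flip gramian_inner T T' sum.distrib sum_subtractf sum_distrib_left flip: f_def g_def)
qed

lemma op_trace_error:
  fixes B :: "'v::euclidean_space \<Rightarrow>\<^sub>L 'x::{real_inner,banach,second_countable_topology}"
    and B' :: "'v \<Rightarrow>\<^sub>L 'y::{real_inner,banach,second_countable_topology}"
    and C :: "'x \<Rightarrow>\<^sub>L 'h::{real_inner,banach,second_countable_topology}"
    and K :: "'w::euclidean_space \<Rightarrow>\<^sub>L 'x"
  assumes T: "c0_semigroup T" "exponentially_stable T"
    and T': "c0_semigroup T'" "exponentially_stable T'"
  shows "op_trace ((C o\<^sub>L (gramian T B T B + gramian T K T K) o\<^sub>L adj C)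
      - 2 *\<^sub>R (C o\<^sub>L (gramian T B T' B' + gramian T K T' K') o\<^sub>L adj C')
      + (C' o\<^sub>L (gramian T' B' T' B' + gramian T' K' T' K') o\<^sub>L adj C'))
    = impulse_energy (\<lambda>s v. C (T s (B v)) - C' (T' s (B' v)))
      + impulse_energy (\<lambda>s v. C (T s (K v)) - C' (T' s (K' v)))"
proof (rule op_trace_eqI)
  fix E :: "'h set" assume E: "orthonormal_basis E"
  have curve: "L2_curve (\<lambda>s. C (T s x) - C' (T' s y))" for x y
    by (intro L2_curve_diff L2_curve_blinfun L2_curve_orbit T T')
  note has_sum_add[OF has_sum_impulse_energy[OF E, of "\<lambda>s v. C (T s (B v)) - C' (T' s (B' v))", OF curve]
      has_sum_impulse_energy[OF E, of "\<lambda>s v. C (T s (K v)) - C' (T' s (K' v))", OF curve]]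
  moreover have "((C o\<^sub>L (gramian T B T B + gramian T K T K) o\<^sub>L adj C)
      - 2 *\<^sub>R (C o\<^sub>L (gramian T B T' B' + gramian T K T' K') o\<^sub>L adj C')
      + (C' o\<^sub>L (gramian T' B' T' B' + gramian T' K' T' K') o\<^sub>L adj C')) e \<bullet> e
    = (\<Sum>b\<in>Basis. LINT s:{0..}|lborel. ((C (T s (B b)) - C' (T' s (B' b))) \<bullet> e)\<^sup>2)
      + (\<Sum>b\<in>Basis. LINT s:{0..}|lborel. ((C (T s (K b)) - C' (T' s (K' b))) \<bullet> e)\<^sup>2)" for e
    unfolding error_gramian_inner[OF T T', symmetric]
    by (simp add: blinfun.add_left blinfun.diff_left blinfun.scaleR_left blinfun.add_right
        inner_add_left inner_diff_left algebra_simps)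
  ultimately show "((\<lambda>e. ((C o\<^sub>L (gramian T B T B + gramian T K T K) o\<^sub>L adj C)
      - 2 *\<^sub>R (C o\<^sub>L (gramian T B T' B' + gramian T K T' K') o\<^sub>L adj C')
      + (C' o\<^sub>L (gramian T' B' T' B' + gramian T' K' T' K') o\<^sub>L adj C')) e \<bullet> e)
     has_sum impulse_energy (\<lambda>s v. C (T s (B v)) - C' (T' s (B' v)))
      + impulse_energy (\<lambda>s v. C (T s (K v)) - C' (T' s (K' v)))) E"
    by simp
qed

text \<open>The case of the preceding identities in which the output operator of the second system is 0.\<close>

lemma op_trace_output_gramian:
  fixes B :: "'v::euclidean_space \<Rightarrow>\<^sub>L 'x::{real_inner,banach,second_countable_topology}"
    and C :: "'x \<Rightarrow>\<^sub>L 'h::{real_inner,banach,second_countable_topology}"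
  assumes T: "c0_semigroup T" "exponentially_stable T"
  shows "op_trace (C o\<^sub>L gramian T B T B o\<^sub>L adj C) = impulse_energy (\<lambda>s v. C (T s (B v)))"
proof (rule op_trace_eqI)
  fix E :: "'h set" assume E: "orthonormal_basis E"
  have "C (gramian T B T B (adj C e)) \<bullet> e = (\<Sum>b\<in>Basis. LINT s:{0..}|lborel. (C (T s (B b)) \<bullet> e)\<^sup>2)" for e
    using error_gramian_inner[OF T T, of C B e B 0] adj_inner[of "0 :: 'x \<Rightarrow>\<^sub>L 'h" e "adj 0 e"]
    by simp
  moreover have "L2_curve (\<lambda>s. C (T s x))" for x
    by (intro L2_curve_blinfun L2_curve_orbit T)
  ultimately show "((\<lambda>e. (C o\<^sub>L gramian T B T B o\<^sub>L adj C) e \<bullet> e) has_sum impulse_energy (\<lambda>s v. C (T s (B v)))) E"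
    using has_sum_impulse_energy[OF E, of "\<lambda>s v. C (T s (B v))"] by simp
qed


section \<open>Square roots of positive semidefinite matrices\<close>

text \<open>First-order condition for the minimum at \<open>t = 0\<close>.\<close>

lemma quadratic_nonneg_imp_linear_coeff_0:
  fixes a b :: real
  assumes "\<And>t. 0 \<le> t * a + t\<^sup>2 * b"
  shows "a = 0"
proof (rule ccontr)
  assume "a \<noteq> 0"
  define k where "k = 1 + \<bar>b\<bar>"
  have k: "0 < k" "b \<le> k - 1" by (auto simp: k_def)
  have "0 \<le> (- a / k) * a + (- a / k)\<^sup>2 * b" by (rule assms)
  also have "\<dots> \<le> (- a / k) * a + (- a / k)\<^sup>2 * (k - 1)"
    using k by (intro add_left_mono mult_left_mono) auto
  also have "\<dots> = - (a / k)\<^sup>2" using k by (simp add: field_simps power2_eq_square)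
  finally show False using \<open>a \<noteq> 0\<close> k by simp
qed

text \<open>Take an orthonormal set of eigenvectors of maximal size. If it did not span, a maximiser of the quadratic
  form on the unit sphere of its orthogonal complement would be a further eigenvector, since that complement is
  invariant under a symmetric matrix.\<close>

lemma symmetric_matrix_eigenbasis:
  fixes Q :: "real^'d^'d"
  assumes Q: "transpose Q = Q"
  obtains S l where "finite S" "pairwise orthogonal S" "\<And>e. e \<in> S \<Longrightarrow> norm e = 1"
    "\<And>e. e \<in> S \<Longrightarrow> Q *v e = l e *\<^sub>R e" "span S = UNIV"
proof -
  have sym: "x \<bullet> (Q *v y) = (Q *v x) \<bullet> y" for x y
    by (metis Q dot_lmul_matrix transpose_matrix_vector)
  define X where "X = {S. pairwise orthogonal S \<and> (\<forall>e\<in>S. norm e = 1 \<and> (\<exists>c. Q *v e = c *\<^sub>R e))}"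
  have card: "finite S \<and> card S \<le> DIM(real^'d)" if "S \<in> X" for S
  proof -
    have "0 \<notin> S" using that by (auto simp: X_def)
    then show ?thesis
      using that by (intro independent_bound pairwise_orthogonal_independent) (auto simp: X_def)
  qed
  have "{} \<in> X" by (simp add: X_def)
  then obtain S where S: "S \<in> X" "\<And>S'. S' \<in> X \<Longrightarrow> card S' \<le> card S"
    using Lattices_Big.ex_has_greatest_nat[of "\<lambda>S. S \<in> X" "{}" card "Suc (DIM(real^'d))"] card
    by (metis le_imp_less_Suc)
  have fin: "finite S" using card S(1) by blast
  have "span S = UNIV"
  proof (rule ccontr)
    assume "span S \<noteq> UNIV"
    then have "dim S < DIM(real^'d)" using dim_eq_full[of S] dim_subset_UNIV[of S] by linarith
    then obtain x0 where x0: "x0 \<noteq> 0" "\<And>e. e \<in> S \<Longrightarrow> e \<bullet> x0 = 0"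
      by (rule orthogonal_to_subspace_exists) (auto simp: orthogonal_def inner_commute span_base)
    define W where "W = {x. \<forall>e\<in>S. e \<bullet> x = 0}"
    have W: "subspace W" unfolding W_def subspace_def by (auto simp: inner_right_distrib)
    have "W = (\<Inter>e\<in>S. {x. e \<bullet> x = 0})" by (auto simp: W_def)
    then have "closed W" by (simp add: closed_INT closed_hyperplane)
    then have "compact (W \<inter> sphere 0 1)" by (simp add: closed_Int_compact)
    moreover have "x0 /\<^sub>R norm x0 \<in> W \<inter> sphere 0 1" using x0 by (simp add: W_def)
    moreover have "continuous_on (W \<inter> sphere 0 1) (\<lambda>x. x \<bullet> (Q *v x))"
      by (intro continuous_intros linear_continuous_on matrix_vector_mul_bounded_linear)
    ultimately have "\<exists>z\<in>W \<inter> sphere 0 1. \<forall>y\<in>W \<inter> sphere 0 1. y \<bullet> (Q *v y) \<le> z \<bullet> (Q *v z)"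
      by (intro continuous_attains_sup) blast+
    then obtain z where z: "z \<in> W" "norm z = 1"
      "\<And>y. y \<in> W \<Longrightarrow> norm y = 1 \<Longrightarrow> y \<bullet> (Q *v y) \<le> z \<bullet> (Q *v z)"
      by (auto simp: Ball_def)
    define c where "c = z \<bullet> (Q *v z)"
    have max: "y \<bullet> (Q *v y) \<le> c * (y \<bullet> y)" if "y \<in> W" for y
    proof (cases "y = 0")
      case False
      have "(y /\<^sub>R norm y) \<bullet> (Q *v (y /\<^sub>R norm y)) \<le> c"
        unfolding c_def using W that False by (intro z(3)) (auto simp: subspace_scale)
      then have "y \<bullet> (Q *v y) \<le> c * (norm y)\<^sup>2"
        using False by (simp add: matrix_vector_mult_scaleR field_simps power2_eq_square)
      then show ?thesis by (simp add: power2_norm_eq_inner)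
    qed simp
    \<comment> \<open>the first-order condition at the maximiser \<open>z\<close> of the Rayleigh quotient, within \<open>W\<close>\<close>
    have crit: "y \<bullet> (c *\<^sub>R z - Q *v z) = 0" if "y \<in> W" for y
    proof -
      have "0 \<le> t * (2 * (y \<bullet> (c *\<^sub>R z - Q *v z))) + t\<^sup>2 * (c * (y \<bullet> y) - y \<bullet> (Q *v y))" for t
      proof -
        have "z + t *\<^sub>R y \<in> W" using W z(1) that by (simp add: subspace_add subspace_scale)
        then have le: "(z + t *\<^sub>R y) \<bullet> (Q *v (z + t *\<^sub>R y)) \<le> c * ((z + t *\<^sub>R y) \<bullet> (z + t *\<^sub>R y))" by (rule max)
        have e1: "(z + t *\<^sub>R y) \<bullet> (Q *v (z + t *\<^sub>R y))
            = z \<bullet> (Q *v z) + t * (z \<bullet> (Q *v y)) + t * (y \<bullet> (Q *v z)) + t\<^sup>2 * (y \<bullet> (Q *v y))"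
          by (simp add: matrix_vector_right_distrib matrix_vector_mult_scaleR inner_add_left
              inner_add_right power2_eq_square distrib_left)
        have e2: "(z + t *\<^sub>R y) \<bullet> (z + t *\<^sub>R y) = z \<bullet> z + 2 * t * (y \<bullet> z) + t\<^sup>2 * (y \<bullet> y)"
          by (simp add: inner_add_left inner_add_right inner_commute[of z y] power2_eq_square distrib_left)
        have e3: "z \<bullet> (Q *v y) = y \<bullet> (Q *v z)" using sym[of z y] by (simp add: inner_commute)
        have "c * (z \<bullet> z) = z \<bullet> (Q *v z)" using z(2) by (simp add: c_def norm_eq_1)
        then show ?thesis
          using le unfolding e1 e2 e3 by (simp add: inner_diff_right algebra_simps)
      qed
      from quadratic_nonneg_imp_linear_coeff_0[OF this] show ?thesis by simp
    qed
    have "e \<bullet> (Q *v z) = 0" if "e \<in> S" for e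
    proof -
      obtain k where "Q *v e = k *\<^sub>R e" using S(1) \<open>e \<in> S\<close> by (auto simp: X_def)
      then show ?thesis using z(1) \<open>e \<in> S\<close> using sym[of e z] by (simp add: W_def)
    qed
    then have "Q *v z \<in> W" by (simp add: W_def)
    then have "c *\<^sub>R z - Q *v z \<in> W" using W z(1) by (simp add: subspace_diff subspace_scale)
    from crit[OF this] have "Q *v z = c *\<^sub>R z" by simp
    then have "insert z S \<in> X"
      using S(1) z(1,2) by (auto simp: X_def pairwise_insert W_def orthogonal_def inner_commute[of z])
    moreover have "z \<notin> S" using z(1,2) by (auto simp: W_def norm_eq_1)
    ultimately show False using S(2)[of "insert z S"] fin by simp
  qed
  moreover have "\<forall>e\<in>S. \<exists>c. Q *v e = c *\<^sub>R e" using S(1) by (auto simp: X_def)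
  then obtain l where "\<forall>e\<in>S. Q *v e = l e *\<^sub>R e" by (rule bchoice[THEN exE])
  ultimately show ?thesis using that[of S l] S(1) fin by (auto simp: X_def)
qed

text \<open>Taking square roots of the eigenvalues in an orthonormal eigenbasis shows that the choice in the
  definition of \<open>psd_sqrt\<close> is between existing objects.\<close>

lemma psd_sqrt:
  fixes Q :: "real^'d^'d"
  assumes Q: "transpose Q = Q" and psd: "\<And>v. 0 \<le> v \<bullet> (Q *v v)"
  shows "transpose (psd_sqrt Q) = psd_sqrt Q" "psd_sqrt Q ** psd_sqrt Q = Q"
proof -
  obtain S l where S: "finite S" "pairwise orthogonal S" "\<And>e. e \<in> S \<Longrightarrow> norm e = 1"
    "\<And>e. e \<in> S \<Longrightarrow> Q *v e = l e *\<^sub>R e" "span S = UNIV"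
    using symmetric_matrix_eigenbasis[OF Q] by metis
  have l: "0 \<le> l e" if "e \<in> S" for e
    using psd[of e] S(3,4)[OF that] by (simp add: norm_eq_1)
  define r where "r v = (\<Sum>e\<in>S. (sqrt (l e) * (e \<bullet> v)) *\<^sub>R e)" for v
  have "linear r"
    unfolding r_def by (rule linearI)
      (simp_all add: inner_right_distrib algebra_simps sum.distrib scaleR_sum_right)
  define R where "R = matrix r"
  have R: "R *v v = r v" for v using fun_cong[OF matrix_vector_mul(2)[OF \<open>linear r\<close>]] by (simp add: R_def)
  have inner_r: "w \<bullet> r v = (\<Sum>e\<in>S. sqrt (l e) * (e \<bullet> v) * (e \<bullet> w))" for v w
    by (simp add: r_def inner_sum_right inner_commute)
  have r_eigen: "r f = sqrt (l f) *\<^sub>R f" if "f \<in> S" for f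
  proof -
    have "r f = (\<Sum>e\<in>S. if e = f then sqrt (l f) *\<^sub>R f else 0)"
      unfolding r_def using S(2,3) that
      by (intro sum.cong) (auto simp: pairwise_def orthogonal_def norm_eq_1)
    then show ?thesis using S(1) that by simp
  qed
  have "transpose R = R"
    unfolding matrix_eq
  proof
    fix v
    have "(transpose R *v v) \<bullet> w = (R *v v) \<bullet> w" for w
      by (simp add: transpose_matrix_vector dot_lmul_matrix R inner_r inner_commute[of "r v"] mult_ac)
    then show "transpose R *v v = R *v v" by (metis vector_eq_rdot)
  qed
  moreover have "0 \<le> v \<bullet> (R *v v)" for v
    unfolding R inner_r by (intro sum_nonneg) (simp add: l mult.assoc)
  moreover have "R ** R = Q"
    unfolding matrix_eq
  proof
    fix v
    have "R *v (R *v v) = Q *v v"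
    proof (rule linear_eq_on_span[of "\<lambda>v. R *v (R *v v)" "\<lambda>v. Q *v v" S])
      fix f assume "f \<in> S"
      then show "R *v (R *v f) = Q *v f"
        by (simp add: R[of f] r_eigen matrix_vector_mult_scaleR l S(4))
    qed (use S(5) in \<open>auto intro!: linearI simp: matrix_vector_right_distrib matrix_vector_mult_scaleR\<close>)
    then show "R ** R *v v = Q *v v" by (simp add: matrix_vector_mul_assoc)
  qed
  ultimately have "\<exists>R. transpose R = R \<and> (\<forall>v. 0 \<le> v \<bullet> (R *v v)) \<and> R ** R = Q" by blast
  from someI_ex[OF this, folded psd_sqrt_def]
  show "transpose (psd_sqrt Q) = psd_sqrt Q" "psd_sqrt Q ** psd_sqrt Q = Q" by auto
qed

section \<open>Second moments of the increments of a Levy process\<close>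

text \<open>Cauchy's functional equation for a function that is monotone because it is nonnegative: comparing
  \<open>n t\<close> with its integer part shows that \<open>n \<bar>h t - t h 1\<bar>\<close> is at most \<open>h 1\<close> for every \<open>n\<close>.\<close>

lemma additive_nonneg_imp_linear:
  fixes h :: "real \<Rightarrow> real"
  assumes add: "\<And>s t. 0 \<le> s \<Longrightarrow> 0 \<le> t \<Longrightarrow> h (s + t) = h s + h t"
    and nonneg: "\<And>t. 0 \<le> t \<Longrightarrow> 0 \<le> h t" and "0 \<le> t"
  shows "h t = t * h 1"
proof -
  have mono: "h s \<le> h t" if "0 \<le> s" "s \<le> t" for s t
  proof -
    have "h (s + (t - s)) = h s + h (t - s)" using that by (intro add) auto
    with nonneg[of "t - s"] that show ?thesis by simp
  qed
  have multiple: "h (real n * t) = real n * h t" if "0 \<le> t" for n t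
  proof (induction n)
    case 0 show ?case using add[of 0 0] by simp
  next
    case (Suc n)
    have "h (real (Suc n) * t) = h (real n * t + t)" by (simp add: algebra_simps)
    also have "\<dots> = h (real n * t) + h t" using that by (intro add) auto
    finally show ?case using Suc by (simp add: algebra_simps)
  qed
  have close: "\<bar>h t - t * h 1\<bar> * real n \<le> h 1" for n
  proof -
    define m where "m = nat \<lfloor>real n * t\<rfloor>"
    have m: "real m \<le> real n * t" "real n * t \<le> real (Suc m)"
      using \<open>0 \<le> t\<close> by (auto simp: m_def) linarith
    have "real m * h 1 \<le> real n * h t" "real n * h t \<le> real (Suc m) * h 1"
      using mono[of "real m * 1" "real n * t"] mono[of "real n * t" "real (Suc m) * 1"] m \<open>0 \<le> t\<close>
      unfolding multiple[OF zero_le_one] multiple[OF \<open>0 \<le> t\<close>] by simp_all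
    moreover have "real m * h 1 \<le> real n * t * h 1" "real n * t * h 1 \<le> real (Suc m) * h 1"
      using m nonneg[of 1] by (auto intro!: mult_right_mono)
    moreover have "real (Suc m) * h 1 = real m * h 1 + h 1" by (simp add: algebra_simps)
    ultimately have "\<bar>real n * h t - real n * t * h 1\<bar> \<le> h 1" by linarith
    moreover have "real n * h t - real n * t * h 1 = real n * (h t - t * h 1)" by (simp add: algebra_simps)
    ultimately show ?thesis by (simp add: abs_mult mult.commute)
  qed
  show ?thesis
  proof (rule ccontr)
    assume "h t \<noteq> t * h 1"
    then obtain n :: nat where "h 1 < real n * \<bar>h t - t * h 1\<bar>"
      using reals_Archimedean3[of "\<bar>h t - t * h 1\<bar>"] by auto
    then show False using close[of n] by (simp add: mult.commute)
  qed
qed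

context square_integrable_mean_zero_levy_process
begin

lemma random_variable_inner [measurable]: "0 \<le> t \<Longrightarrow> (\<lambda>\<omega>. v \<bullet> M t \<omega>) \<in> borel_measurable P"
  using random_variable by simp

lemma integrable_inner_mult:
  assumes t: "0 \<le> s" "0 \<le> t"
  shows "integrable P (\<lambda>\<omega>. (v \<bullet> M s \<omega>) * (w \<bullet> M t \<omega>))"
proof (rule Bochner_Integration.integrable_bound)
  show "integrable P (\<lambda>\<omega>. norm v * norm w * ((norm (M s \<omega>))\<^sup>2 + (norm (M t \<omega>))\<^sup>2))"
    using t by (intro integrable_mult_right Bochner_Integration.integrable_add square_integrable)
  show "(\<lambda>\<omega>. (v \<bullet> M s \<omega>) * (w \<bullet> M t \<omega>)) \<in> borel_measurable P" using t by measurable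
  show "AE \<omega> in P. norm ((v \<bullet> M s \<omega>) * (w \<bullet> M t \<omega>))
      \<le> norm (norm v * norm w * ((norm (M s \<omega>))\<^sup>2 + (norm (M t \<omega>))\<^sup>2))"
  proof (rule AE_I2)
    fix \<omega>
    let ?x = "norm (M s \<omega>)" and ?y = "norm (M t \<omega>)"
    have "\<bar>v \<bullet> M s \<omega>\<bar> * \<bar>w \<bullet> M t \<omega>\<bar> \<le> (norm v * ?x) * (norm w * ?y)"
      by (intro mult_mono Cauchy_Schwarz_ineq2) auto
    also have "\<dots> = norm v * norm w * (?x * ?y)" by (simp add: mult_ac)
    also have "\<dots> \<le> norm v * norm w * (?x\<^sup>2 + ?y\<^sup>2)"
    proof (rule mult_left_mono)
      show "?x * ?y \<le> ?x\<^sup>2 + ?y\<^sup>2"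
        using sum_squares_bound[of ?x ?y] mult_nonneg_nonneg[OF norm_ge_zero norm_ge_zero, of "M s \<omega>" "M t \<omega>"]
        by linarith
    qed simp
    finally show "norm ((v \<bullet> M s \<omega>) * (w \<bullet> M t \<omega>)) \<le> norm (norm v * norm w * (?x\<^sup>2 + ?y\<^sup>2))"
      by (simp add: abs_mult)
  qed
qed

lemma integrable_inner: "0 \<le> t \<Longrightarrow> integrable P (\<lambda>\<omega>. v \<bullet> M t \<omega>)"
  using square_integrable_imp_integrable[OF random_variable_inner, of t v] integrable_inner_mult[of t t v v]
  by (simp add: power2_eq_square)

lemma expectation_inner:
  assumes "0 \<le> t" shows "expectation (\<lambda>\<omega>. v \<bullet> M t \<omega>) = 0"
proof -
  have "integrable P (\<lambda>\<omega>. M t \<omega> \<bullet> b)" for b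
    using integrable_inner[OF assms, of b] by (subst inner_commute)
  then have "integrable P (\<lambda>\<omega>. \<Sum>b\<in>Basis. (M t \<omega> \<bullet> b) *\<^sub>R b)"
    by (intro Bochner_Integration.integrable_sum integrable_scaleR_left)
  then have "integrable P (M t)" by (simp add: euclidean_representation)
  then show ?thesis using integral_inner_right[of v P "M t"] mean_zero[OF assms] by simp
qed

text \<open>The increments over \<open>(0, s]\<close> and \<open>(s, t]\<close> are independent and have mean zero, and the process
  starts at 0 almost surely.\<close>

lemma expectation_past_increment:
  assumes st: "0 \<le> s" "s \<le> t"
  shows "expectation (\<lambda>\<omega>. (v \<bullet> M s \<omega>) * (w \<bullet> (M t \<omega> - M s \<omega>))) = 0"
proof -
  \<comment> \<open>the partition \<open>0 \<le> s \<le> t\<close>, with the two increments tested against \<open>v\<close> and \<open>w\<close>\<close>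
  define r where "r i = (if i = 0 then 0 else if i = 1 then s else t)" for i :: nat
  define X where "X i \<omega> = (if i = 0 then v else w) \<bullet> (M (r (Suc i)) \<omega> - M (r i) \<omega>)" for i \<omega>
  have X: "X 0 = (\<lambda>\<omega>. v \<bullet> M s \<omega> - v \<bullet> M 0 \<omega>)" "X (Suc 0) = (\<lambda>\<omega>. w \<bullet> M t \<omega> - w \<bullet> M s \<omega>)"
    by (simp_all add: X_def r_def inner_diff_right fun_eq_iff)
  have "indep_vars (\<lambda>_. borel) (\<lambda>i \<omega>. M (r (Suc i)) \<omega> - M (r i) \<omega>) {..<2}"
    using st by (intro independent_increments) (auto simp: r_def less_2_cases_iff)
  from indep_vars_compose2[OF this, of "\<lambda>i x. (if i = 0 then v else w) \<bullet> x" "\<lambda>_. borel"]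
  have "indep_vars (\<lambda>_. borel) X {..<2}" by (simp add: X_def[abs_def])
  moreover have "integrable P (X i)" if "i \<in> {..<2}" for i
    using that st by (auto simp: less_2_cases_iff X intro!: Bochner_Integration.integrable_diff integrable_inner)
  ultimately have "expectation (\<lambda>\<omega>. \<Prod>i\<in>{..<2}. X i \<omega>) = (\<Prod>i\<in>{..<2}. expectation (X i))"
    by (intro indep_vars_lebesgue_integral) auto
  also have "\<dots> = 0"
    using st by (simp add: numeral_2_eq_2 X(2) integrable_inner expectation_inner)
  finally have "expectation (\<lambda>\<omega>. X 0 \<omega> * X (Suc 0) \<omega>) = 0" by (simp add: numeral_2_eq_2)
  moreover have "expectation (\<lambda>\<omega>. (v \<bullet> M s \<omega>) * (w \<bullet> (M t \<omega> - M s \<omega>))) = expectation (\<lambda>\<omega>. X 0 \<omega> * X (Suc 0) \<omega>)"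
    unfolding X using starts_at_0 st by (intro integral_cong_AE) (auto simp: inner_diff_right)
  ultimately show ?thesis by simp
qed

text \<open>The variance of \<open>v \<bullet> M\<^sub>t\<close> is additive in \<open>t\<close> by the orthogonality and stationarity of the increments,
  hence linear; polarisation extends this to covariances.\<close>

lemma expectation_inner_mult_same:
  assumes "0 \<le> t"
  shows "expectation (\<lambda>\<omega>. (v \<bullet> M t \<omega>) * (w \<bullet> M t \<omega>)) = t * expectation (\<lambda>\<omega>. (v \<bullet> M 1 \<omega>) * (w \<bullet> M 1 \<omega>))"
proof -
  define h where "h v t = expectation (\<lambda>\<omega>. (v \<bullet> M t \<omega>) * (v \<bullet> M t \<omega>))" for v t
  have add: "h v (s + t) = h v s + h v t" if st: "0 \<le> s" "0 \<le> t" for v s t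
  proof -
    let ?D = "\<lambda>\<omega>. v \<bullet> (M (s + t) \<omega> - M s \<omega>)"
    have nn: "0 \<le> s + t" using st by simp
    have "(\<lambda>\<omega>. (v \<bullet> M s \<omega>) * ?D \<omega>)
        = (\<lambda>\<omega>. (v \<bullet> M s \<omega>) * (v \<bullet> M (s + t) \<omega>) - (v \<bullet> M s \<omega>) * (v \<bullet> M s \<omega>))"
      by (simp add: fun_eq_iff inner_diff_right right_diff_distrib)
    then have int1: "integrable P (\<lambda>\<omega>. (v \<bullet> M s \<omega>) * ?D \<omega>)"
      using Bochner_Integration.integrable_diff[OF integrable_inner_mult[OF st(1) nn] integrable_inner_mult[OF st(1) st(1)]]
      by simp
    have "(\<lambda>\<omega>. ?D \<omega> * ?D \<omega>) = (\<lambda>\<omega>. (v \<bullet> M (s + t) \<omega>) * (v \<bullet> M (s + t) \<omega>)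
        - (v \<bullet> M s \<omega>) * (v \<bullet> M (s + t) \<omega>) - (v \<bullet> M s \<omega>) * ?D \<omega>)"
      by (simp add: fun_eq_iff inner_diff_right algebra_simps)
    then have int2: "integrable P (\<lambda>\<omega>. ?D \<omega> * ?D \<omega>)"
      using Bochner_Integration.integrable_diff[OF Bochner_Integration.integrable_diff[OF
          integrable_inner_mult[OF nn nn] integrable_inner_mult[OF st(1) nn]] int1]
      by simp
    have "h v (s + t) = expectation (\<lambda>\<omega>. (v \<bullet> M s \<omega>) * (v \<bullet> M s \<omega>) + 2 * ((v \<bullet> M s \<omega>) * ?D \<omega>) + ?D \<omega> * ?D \<omega>)"
      unfolding h_def by (intro Bochner_Integration.integral_cong) (auto simp: inner_diff_right algebra_simps)
    also have "\<dots> = h v s + 2 * expectation (\<lambda>\<omega>. (v \<bullet> M s \<omega>) * ?D \<omega>) + expectation (\<lambda>\<omega>. ?D \<omega> * ?D \<omega>)"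
      using int1 int2 integrable_inner_mult[OF st(1) st(1)] by (simp add: h_def)
    also have "expectation (\<lambda>\<omega>. (v \<bullet> M s \<omega>) * ?D \<omega>) = 0"
      using st by (intro expectation_past_increment) auto
    also have "expectation (\<lambda>\<omega>. ?D \<omega> * ?D \<omega>) = (LINT x|distr P borel (\<lambda>\<omega>. M (s + t) \<omega> - M s \<omega>). (v \<bullet> x) * (v \<bullet> x))"
      using st random_variable by (subst integral_distr) auto
    also have "distr P borel (\<lambda>\<omega>. M (s + t) \<omega> - M s \<omega>) = distr P borel (M t)"
      using stationary_increments[of s "s + t"] st by simp
    also have "(LINT x|distr P borel (M t). (v \<bullet> x) * (v \<bullet> x)) = h v t"
      unfolding h_def using st random_variable by (subst integral_distr) auto
    finally show ?thesis by simp
  qed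
  have linear: "h v t = t * h v 1" for v
  proof (rule additive_nonneg_imp_linear[of "h v"])
    show "0 \<le> h v t" for t unfolding h_def by (intro Bochner_Integration.integral_nonneg) simp
  qed (use add \<open>0 \<le> t\<close> in auto)
  have polar: "expectation (\<lambda>\<omega>. (v \<bullet> M s \<omega>) * (w \<bullet> M s \<omega>)) = (h (v + w) s - h (v - w) s) / 4" if "0 \<le> s" for s
  proof -
    note int = integrable_inner_mult[OF that that]
    have "h (v + w) s - h (v - w) s = expectation (\<lambda>\<omega>. 4 * ((v \<bullet> M s \<omega>) * (w \<bullet> M s \<omega>)))"
      unfolding h_def Bochner_Integration.integral_diff[OF int int, symmetric]
      by (intro Bochner_Integration.integral_cong) (auto simp: inner_add_left inner_diff_left algebra_simps)
    then show ?thesis by simp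
  qed
  show ?thesis
    unfolding polar[OF \<open>0 \<le> t\<close>] polar[OF zero_le_one] linear[of "v + w"] linear[of "v - w"]
    by (simp add: field_simps)
qed

lemma expectation_inner_mult:
  assumes "0 \<le> s" "0 \<le> t"
  shows "expectation (\<lambda>\<omega>. (v \<bullet> M s \<omega>) * (w \<bullet> M t \<omega>))
    = min s t * expectation (\<lambda>\<omega>. (v \<bullet> M 1 \<omega>) * (w \<bullet> M 1 \<omega>))"
proof -
  have *: "expectation (\<lambda>\<omega>. (v \<bullet> M s \<omega>) * (w \<bullet> M t \<omega>)) = s * expectation (\<lambda>\<omega>. (v \<bullet> M 1 \<omega>) * (w \<bullet> M 1 \<omega>))"
    if "0 \<le> s" "s \<le> t" for v w s t
  proof -
    have "integrable P (\<lambda>\<omega>. (v \<bullet> M s \<omega>) * (w \<bullet> M s \<omega>))" "integrable P (\<lambda>\<omega>. (v \<bullet> M s \<omega>) * (w \<bullet> M t \<omega>))"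
      using that by (auto intro!: integrable_inner_mult)
    then have "expectation (\<lambda>\<omega>. (v \<bullet> M s \<omega>) * (w \<bullet> M t \<omega>)) - expectation (\<lambda>\<omega>. (v \<bullet> M s \<omega>) * (w \<bullet> M s \<omega>))
        = expectation (\<lambda>\<omega>. (v \<bullet> M s \<omega>) * (w \<bullet> (M t \<omega> - M s \<omega>)))"
      by (simp add: inner_diff_right right_diff_distrib)
    then show ?thesis
      using expectation_past_increment[OF that] expectation_inner_mult_same[OF that(1)] by simp
  qed
  show ?thesis
  proof (cases "s \<le> t")
    case True then show ?thesis using *[OF assms(1)] by (simp add: min_def)
  next
    case False then show ?thesis using *[OF assms(2), of s w v] by (simp add: min_def mult.commute)
  qed
qed

text \<open>The form of the covariance that the isometry needs: overlapping intervals are correlated by the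
  length of their intersection, so that step functions with overlapping intervals require no refinement.\<close>

lemma expectation_increments:
  assumes ab: "0 \<le> a" "a \<le> b" and cd: "0 \<le> c" "c \<le> d"
  shows "integrable P (\<lambda>\<omega>. (v \<bullet> (M b \<omega> - M a \<omega>)) * (w \<bullet> (M d \<omega> - M c \<omega>)))"
    and "expectation (\<lambda>\<omega>. (v \<bullet> (M b \<omega> - M a \<omega>)) * (w \<bullet> (M d \<omega> - M c \<omega>)))
      = measure lborel ({a<..b} \<inter> {c<..d}) * expectation (\<lambda>\<omega>. (v \<bullet> M 1 \<omega>) * (w \<bullet> M 1 \<omega>))"
proof -
  have nn: "0 \<le> b" "0 \<le> d" using assms by auto
  note int = integrable_inner_mult[OF nn(1) nn(2), of v w] integrable_inner_mult[OF nn(1) cd(1), of v w]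
    integrable_inner_mult[OF ab(1) nn(2), of v w] integrable_inner_mult[OF ab(1) cd(1), of v w]
  have expand: "(v \<bullet> (M b \<omega> - M a \<omega>)) * (w \<bullet> (M d \<omega> - M c \<omega>))
      = ((v \<bullet> M b \<omega>) * (w \<bullet> M d \<omega>) - (v \<bullet> M b \<omega>) * (w \<bullet> M c \<omega>))
        - ((v \<bullet> M a \<omega>) * (w \<bullet> M d \<omega>) - (v \<bullet> M a \<omega>) * (w \<bullet> M c \<omega>))" for \<omega>
    by (simp add: inner_diff_right algebra_simps)
  show "integrable P (\<lambda>\<omega>. (v \<bullet> (M b \<omega> - M a \<omega>)) * (w \<bullet> (M d \<omega> - M c \<omega>)))"
    unfolding expand by (intro Bochner_Integration.integrable_diff int)
  have "{a<..b} \<inter> {c<..d} = {max a c<..min b d}" by auto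
  then have "measure lborel ({a<..b} \<inter> {c<..d}) = max 0 (min b d - max a c)"
    by (cases "max a c \<le> min b d") auto
  also have "\<dots> = min b d - min b c - (min a d - min a c)"
    using ab cd by linarith
  finally have "measure lborel ({a<..b} \<inter> {c<..d}) = min b d - min b c - (min a d - min a c)" .
  moreover have "expectation (\<lambda>\<omega>. (v \<bullet> (M b \<omega> - M a \<omega>)) * (w \<bullet> (M d \<omega> - M c \<omega>)))
      = (min b d - min b c - (min a d - min a c)) * expectation (\<lambda>\<omega>. (v \<bullet> M 1 \<omega>) * (w \<bullet> M 1 \<omega>))"
    unfolding expand
      Bochner_Integration.integral_diff[OF Bochner_Integration.integrable_diff[OF int(1,2)]
        Bochner_Integration.integrable_diff[OF int(3,4)]]
      Bochner_Integration.integral_diff[OF int(1,2)] Bochner_Integration.integral_diff[OF int(3,4)]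
      expectation_inner_mult[OF nn] expectation_inner_mult[OF nn(1) cd(1)]
      expectation_inner_mult[OF ab(1) nn(2)] expectation_inner_mult[OF ab(1) cd(1)]
    by (simp only: left_diff_distrib)
  ultimately show "expectation (\<lambda>\<omega>. (v \<bullet> (M b \<omega> - M a \<omega>)) * (w \<bullet> (M d \<omega> - M c \<omega>)))
      = measure lborel ({a<..b} \<inter> {c<..d}) * expectation (\<lambda>\<omega>. (v \<bullet> M 1 \<omega>) * (w \<bullet> M 1 \<omega>))" by simp
qed

end


section \<open>The Ito inequality\<close>

lemma covariance_inner:
  fixes M :: "real \<Rightarrow> 'w \<Rightarrow> real^'d"
  assumes "square_integrable_mean_zero_levy_process P M"
  shows "v \<bullet> (covariance P M *v w) = (LINT \<omega>|P. (v \<bullet> M 1 \<omega>) * (w \<bullet> M 1 \<omega>))"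
proof -
  interpret square_integrable_mean_zero_levy_process P M by fact
  have int: "integrable P (\<lambda>\<omega>. M 1 \<omega> $ i * M 1 \<omega> $ j)" for i j
    using integrable_inner_mult[of 1 1 "axis i 1" "axis j 1"] by (simp add: inner_axis')
  have "(LINT \<omega>|P. (v \<bullet> M 1 \<omega>) * (w \<bullet> M 1 \<omega>))
      = (LINT \<omega>|P. (\<Sum>i\<in>UNIV. \<Sum>j\<in>UNIV. v $ i * w $ j * (M 1 \<omega> $ i * M 1 \<omega> $ j)))"
    by (simp add: inner_vec_def sum_product mult_ac)
  also have "\<dots> = (\<Sum>i\<in>UNIV. \<Sum>j\<in>UNIV. v $ i * w $ j * (LINT \<omega>|P. M 1 \<omega> $ i * M 1 \<omega> $ j))"
    using int by (simp add: Bochner_Integration.integral_sum)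
  also have "\<dots> = v \<bullet> (covariance P M *v w)"
    by (simp add: inner_vec_def matrix_vector_mult_def covariance_def sum_distrib_left mult_ac)
  finally show ?thesis by simp
qed

lemma noise_root_inner:
  fixes M :: "real \<Rightarrow> 'w \<Rightarrow> real^'d"
  assumes "square_integrable_mean_zero_levy_process P M"
  defines "R \<equiv> psd_sqrt (covariance P M)"
  shows "(R *v v) \<bullet> w = v \<bullet> (R *v w)"
    and "(R *v v) \<bullet> (R *v w) = (LINT \<omega>|P. (v \<bullet> M 1 \<omega>) * (w \<bullet> M 1 \<omega>))"
proof -
  let ?Q = "covariance P M"
  have "transpose ?Q = ?Q"
    by (simp add: covariance_def transpose_def vec_eq_iff mult.commute)
  moreover have "0 \<le> v \<bullet> (?Q *v v)" for v
    unfolding covariance_inner[OF assms(1)] by (intro Bochner_Integration.integral_nonneg) simp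
  ultimately have R: "transpose R = R" "R ** R = ?Q" unfolding R_def by (rule psd_sqrt)+
  show *: "(R *v v) \<bullet> w = v \<bullet> (R *v w)" for v w
    by (metis R(1) dot_lmul_matrix transpose_matrix_vector)
  show "(R *v v) \<bullet> (R *v w) = (LINT \<omega>|P. (v \<bullet> M 1 \<omega>) * (w \<bullet> M 1 \<omega>))"
    using assms(1) by (simp add: * matrix_vector_mul_assoc R(2) covariance_inner)
qed

lemma blinfun_apply_basis_expansion:
  fixes F :: "'v::euclidean_space \<Rightarrow>\<^sub>L 'a::real_normed_vector"
  shows "F x = (\<Sum>b\<in>Basis. (b \<bullet> x) *\<^sub>R F b)"
proof -
  have "F x = F (\<Sum>b\<in>Basis. (x \<bullet> b) *\<^sub>R b)" by (simp add: euclidean_representation)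
  also have "\<dots> = (\<Sum>b\<in>Basis. (x \<bullet> b) *\<^sub>R F b)" by (simp only: blinfun.sum_right blinfun.scaleR_right)
  finally show ?thesis by (simp add: inner_commute)
qed

lemma inner_sum_sum: "(\<Sum>i\<in>A. f i) \<bullet> (\<Sum>j\<in>B. g j) = (\<Sum>i\<in>A. \<Sum>j\<in>B. f i \<bullet> g j)"
  unfolding inner_sum_left by (simp only: inner_sum_right)

text \<open>The trace of \<open>G R R F\<^sup>*\<close>, computed in two ways. It matches the covariance matrix \<open>R R\<close>, which appears
  in expectations, with the Hilbert--Schmidt inner product of \<open>F R\<close> and \<open>G R\<close>, which appears in energies.\<close>

lemma sum_Basis_inner_symmetric:
  fixes F G :: "'v::euclidean_space \<Rightarrow>\<^sub>L 'a::real_inner"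
  assumes R: "\<And>v w. R v \<bullet> w = v \<bullet> R w"
  shows "(\<Sum>k\<in>Basis. F (R k) \<bullet> G (R k)) = (\<Sum>b\<in>Basis. \<Sum>c\<in>Basis. (R b \<bullet> R c) * (F b \<bullet> G c))"
proof -
  have "(\<Sum>k\<in>Basis. F (R k) \<bullet> G (R k))
      = (\<Sum>k\<in>Basis. \<Sum>b\<in>Basis. \<Sum>c\<in>Basis. (R b \<bullet> k) * (R c \<bullet> k) * (F b \<bullet> G c))"
    unfolding blinfun_apply_basis_expansion[of F "R _"] blinfun_apply_basis_expansion[of G "R _"]
    by (simp only: inner_sum_sum) (simp add: R mult_ac)
  also have "\<dots> = (\<Sum>b\<in>Basis. \<Sum>c\<in>Basis. \<Sum>k\<in>Basis. (R b \<bullet> k) * (R c \<bullet> k) * (F b \<bullet> G c))"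
    by (subst sum.swap, rule sum.cong[OF refl], rule sum.swap)
  also have "\<dots> = (\<Sum>b\<in>Basis. \<Sum>c\<in>Basis. (R b \<bullet> R c) * (F b \<bullet> G c))"
    by (simp add: euclidean_inner[of "R _" "R _"] flip: sum_distrib_right)
  finally show ?thesis .
qed

lemma step_integral_nth:
  "step_integral M D \<omega> = (\<Sum>i<length D. (snd (snd (D ! i))) (M (fst (snd (D ! i))) \<omega> - M (fst (D ! i)) \<omega>))"
  by (simp add: step_integral_def sum_list_sum_nth case_prod_beta atLeast0LessThan)

lemma step_fun_nth:
  "step_fun D s = (\<Sum>i<length D. indicator {fst (D ! i)<..fst (snd (D ! i))} s *\<^sub>R snd (snd (D ! i)))"
  by (simp add: step_fun_def sum_list_sum_nth case_prod_beta atLeast0LessThan)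

text \<open>Both sides expand into the same double sum over pairs of steps, weighted by the length of the
  intersection of their intervals.\<close>

lemma step_isometry:
  fixes M :: "real \<Rightarrow> 'w \<Rightarrow> 'v::euclidean_space"
    and D :: "(real \<times> real \<times> ('v \<Rightarrow>\<^sub>L 'a::{real_inner,second_countable_topology})) list"
  assumes "square_integrable_mean_zero_levy_process P M"
    and R: "\<And>v w. R v \<bullet> w = v \<bullet> R w"
    and cov: "\<And>v w. R v \<bullet> R w = (LINT \<omega>|P. (v \<bullet> M 1 \<omega>) * (w \<bullet> M 1 \<omega>))"
    and D: "step_on t D"
  shows "(\<integral>\<^sup>+\<omega>. ennreal ((norm (step_integral M D \<omega>))\<^sup>2) \<partial>P)
    = (\<integral>\<^sup>+s. ennreal (\<Sum>k\<in>Basis. (norm (step_fun D s (R k)))\<^sup>2) \<partial>lborel)"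
proof -
  interpret square_integrable_mean_zero_levy_process P M by fact
  define n a b F where "n = length D" and "a i = fst (D ! i)" and "b i = fst (snd (D ! i))"
    and "F i = snd (snd (D ! i))" for i
  have ab: "0 \<le> a i" "a i \<le> b i" if "i < n" for i
    using D nth_mem[of i D] that by (auto simp: step_on_def n_def a_def b_def case_prod_beta)
  define \<Delta> where "\<Delta> i \<omega> = M (b i) \<omega> - M (a i) \<omega>" for i \<omega>
  define l where "l i j = measure lborel ({a i<..b i} \<inter> {a j<..b j})" for i j
  define V where "V = (\<Sum>i<n. \<Sum>j<n. l i j * (\<Sum>k\<in>Basis. F i (R k) \<bullet> F j (R k)))"
  have fin: "emeasure lborel ({a i<..b i} \<inter> {a j<..b j}) < \<infinity>" for i j
    by (intro emeasure_bounded_finite bounded_Int) simp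

  have "has_bochner_integral P (\<lambda>\<omega>. (norm (step_integral M D \<omega>))\<^sup>2) V"
  proof -
    have "(norm (step_integral M D \<omega>))\<^sup>2
        = (\<Sum>i<n. \<Sum>j<n. \<Sum>v\<in>Basis. \<Sum>w\<in>Basis. (v \<bullet> \<Delta> i \<omega>) * (w \<bullet> \<Delta> j \<omega>) * (F i v \<bullet> F j w))" for \<omega>
    proof -
      have "(norm (step_integral M D \<omega>))\<^sup>2 = (\<Sum>i<n. \<Sum>j<n. F i (\<Delta> i \<omega>) \<bullet> F j (\<Delta> j \<omega>))"
        by (simp only: step_integral_nth power2_norm_eq_inner inner_sum_sum
            n_def a_def b_def F_def \<Delta>_def)
      also have "\<dots> = (\<Sum>i<n. \<Sum>j<n. \<Sum>v\<in>Basis. \<Sum>w\<in>Basis. (v \<bullet> \<Delta> i \<omega>) * (w \<bullet> \<Delta> j \<omega>) * (F i v \<bullet> F j w))"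
      proof (intro sum.cong refl)
        fix i j
        show "F i (\<Delta> i \<omega>) \<bullet> F j (\<Delta> j \<omega>)
          = (\<Sum>v\<in>Basis. \<Sum>w\<in>Basis. (v \<bullet> \<Delta> i \<omega>) * (w \<bullet> \<Delta> j \<omega>) * (F i v \<bullet> F j w))"
          by (subst blinfun_apply_basis_expansion[of "F i"], subst blinfun_apply_basis_expansion[of "F j"])
            (simp add: inner_sum_sum mult_ac)
      qed
      finally show ?thesis .
    qed
    moreover have "has_bochner_integral P (\<lambda>\<omega>. (v \<bullet> \<Delta> i \<omega>) * (w \<bullet> \<Delta> j \<omega>) * (F i v \<bullet> F j w))
        (l i j * (R v \<bullet> R w) * (F i v \<bullet> F j w))" if "i < n" "j < n" for i j v w
      using expectation_increments[OF ab[OF that(1)] ab[OF that(2)], of v w]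
      unfolding \<Delta>_def l_def cov by (intro has_bochner_integral_mult_left) (simp add: has_bochner_integral_iff)
    ultimately have "has_bochner_integral P (\<lambda>\<omega>. (norm (step_integral M D \<omega>))\<^sup>2)
        (\<Sum>i<n. \<Sum>j<n. \<Sum>v\<in>Basis. \<Sum>w\<in>Basis. l i j * (R v \<bullet> R w) * (F i v \<bullet> F j w))"
      by (simp only:) (intro has_bochner_integral_sum, auto)
    also have "(\<Sum>i<n. \<Sum>j<n. \<Sum>v\<in>Basis. \<Sum>w\<in>Basis. l i j * (R v \<bullet> R w) * (F i v \<bullet> F j w)) = V"
      unfolding V_def sum_Basis_inner_symmetric[OF R] by (simp add: sum_distrib_left mult.assoc)
    finally show ?thesis .
  qed
  then have left: "(\<integral>\<^sup>+\<omega>. ennreal ((norm (step_integral M D \<omega>))\<^sup>2) \<partial>P) = ennreal V"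
    by (simp add: has_bochner_integral_iff nn_integral_eq_integral)

  have "has_bochner_integral lborel (\<lambda>s. \<Sum>k\<in>Basis. (norm (step_fun D s (R k)))\<^sup>2) V"
  proof -
    have "(\<Sum>k\<in>Basis. (norm (step_fun D s (R k)))\<^sup>2)
        = (\<Sum>i<n. \<Sum>j<n. indicator ({a i<..b i} \<inter> {a j<..b j}) s * (\<Sum>k\<in>Basis. F i (R k) \<bullet> F j (R k)))" for s
    proof -
      have "step_fun D s v = (\<Sum>i<n. indicator {a i<..b i} s *\<^sub>R F i v)" for v
        by (simp add: step_fun_nth n_def a_def b_def F_def blinfun.sum_left blinfun.scaleR_left)
      note expand = this
      have "(norm (step_fun D s v))\<^sup>2
          = (\<Sum>i<n. \<Sum>j<n. indicator ({a i<..b i} \<inter> {a j<..b j}) s * (F i v \<bullet> F j v))" for v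
        unfolding expand
        by (simp only: power2_norm_eq_inner inner_sum_sum indicator_inter_arith inner_scaleR_left
            inner_scaleR_right mult_ac)
      then show ?thesis
        unfolding sum_distrib_left by (simp only:) (subst sum.swap, rule sum.cong[OF refl], rule sum.swap)
    qed
    moreover have "has_bochner_integral lborel
        (\<lambda>s. indicator ({a i<..b i} \<inter> {a j<..b j}) s * (\<Sum>k\<in>Basis. F i (R k) \<bullet> F j (R k)))
        (l i j * (\<Sum>k\<in>Basis. F i (R k) \<bullet> F j (R k)))" for i j
      unfolding l_def
      by (intro has_bochner_integral_mult_left has_bochner_integral_real_indicator fin) auto
    ultimately show ?thesis
      unfolding V_def by (simp only:) (intro has_bochner_integral_sum, auto)
  qed
  then have "(\<integral>\<^sup>+s. ennreal (\<Sum>k\<in>Basis. (norm (step_fun D s (R k)))\<^sup>2) \<partial>lborel) = ennreal V"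
    by (simp add: has_bochner_integral_iff nn_integral_eq_integral sum_nonneg)
  with left show ?thesis by simp
qed

text \<open>The weights make this inequality sharp enough to pass to a limit: if \<open>\<parallel>x - y\<parallel>\<close> tends to 0 for fixed
  \<open>c\<close>, and then \<open>c\<close> tends to 0, the constant in front of \<open>\<parallel>y\<parallel>\<^sup>2\<close> becomes 1.\<close>

lemma norm_square_perturbation:
  fixes x y :: "'a::real_normed_vector"
  assumes "0 < c"
  shows "(norm x)\<^sup>2 \<le> (1 + c) * (norm y)\<^sup>2 + (1 + 1 / c) * (norm (x - y))\<^sup>2"
proof -
  let ?y = "norm y" and ?d = "norm (x - y)"
  have "(norm x)\<^sup>2 \<le> (?y + ?d)\<^sup>2"
    using norm_triangle_ineq[of y "x - y"] by (intro power_mono) auto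
  also have "\<dots> \<le> (1 + c) * ?y\<^sup>2 + (1 + 1 / c) * ?d\<^sup>2"
  proof -
    have "0 \<le> (c * ?y - ?d)\<^sup>2 / c" using assms by simp
    also have "\<dots> = (1 + c) * ?y\<^sup>2 + (1 + 1 / c) * ?d\<^sup>2 - (?y + ?d)\<^sup>2"
      using assms by (simp add: field_simps power2_eq_square)
    finally show ?thesis by simp
  qed
  finally show ?thesis .
qed

text \<open>Two successive uses of \<open>norm_square_perturbation\<close>, integrated: one between the limit and its
  approximations \<open>z n\<close>, one between these and the limiting bound \<open>y\<close>.\<close>

lemma ennreal_le_by_perturbation:
  fixes x y :: ennreal
  assumes 1: "\<And>c n. 0 < c \<Longrightarrow> x \<le> ennreal (1 + c) * z n + ennreal (1 + 1 / c) * \<epsilon> n"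
    and 2: "\<And>c n. 0 < c \<Longrightarrow> z n \<le> ennreal (1 + c) * y + ennreal (1 + 1 / c) * \<delta> n"
    and \<epsilon>: "\<epsilon> \<longlonglongrightarrow> 0" and \<delta>: "\<delta> \<longlonglongrightarrow> 0"
  shows "x \<le> y"
proof -
  have *: "x \<le> ennreal (1 + c) * (ennreal (1 + c) * y)" if "0 < c" for c
  proof (rule LIMSEQ_le_const)
    have "(\<lambda>n. ennreal (1 + c) * (ennreal (1 + c) * y + ennreal (1 + 1 / c) * \<delta> n) + ennreal (1 + 1 / c) * \<epsilon> n)
        \<longlonglongrightarrow> ennreal (1 + c) * (ennreal (1 + c) * y + ennreal (1 + 1 / c) * 0) + ennreal (1 + 1 / c) * 0"
      by (intro tendsto_add ennreal_tendsto_cmult tendsto_const \<epsilon> \<delta>) auto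
    then show "(\<lambda>n. ennreal (1 + c) * (ennreal (1 + c) * y + ennreal (1 + 1 / c) * \<delta> n) + ennreal (1 + 1 / c) * \<epsilon> n)
        \<longlonglongrightarrow> ennreal (1 + c) * (ennreal (1 + c) * y)" by simp
    have "x \<le> ennreal (1 + c) * (ennreal (1 + c) * y + ennreal (1 + 1 / c) * \<delta> n) + ennreal (1 + 1 / c) * \<epsilon> n" for n
      using order_trans[OF 1[OF that, of n] add_right_mono[OF mult_left_mono[OF 2[OF that, of n]]]] by simp
    then show "\<exists>N. \<forall>n\<ge>N. x \<le> ennreal (1 + c) * (ennreal (1 + c) * y + ennreal (1 + 1 / c) * \<delta> n) + ennreal (1 + 1 / c) * \<epsilon> n"
      by blast
  qed
  show ?thesis
  proof (cases y)
    case (real r)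
    have "(\<lambda>n. ennreal ((1 + inverse (real (Suc n))) * ((1 + inverse (real (Suc n))) * r)))
        \<longlonglongrightarrow> ennreal ((1 + 0) * ((1 + 0) * r))"
      by (intro tendsto_ennrealI tendsto_intros LIMSEQ_inverse_real_of_nat)
    moreover have "x \<le> ennreal ((1 + inverse (real (Suc n))) * ((1 + inverse (real (Suc n))) * r))" for n
      using *[of "inverse (real (Suc n))"] real by (simp add: ennreal_mult)
    ultimately have "x \<le> ennreal ((1 + 0) * ((1 + 0) * r))" by (intro LIMSEQ_le_const) auto
    then show ?thesis using real by simp
  qed simp
qed

lemma norm_blinfun_apply_le_basis:
  fixes G :: "'v::euclidean_space \<Rightarrow>\<^sub>L 'a::real_normed_vector"
  shows "(norm (G x))\<^sup>2 \<le> (\<Sum>b\<in>Basis. (norm (G b))\<^sup>2) * (norm x)\<^sup>2"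
proof -
  have "norm (G x) \<le> (\<Sum>b\<in>Basis. norm (b \<bullet> x) * norm (G b))"
    by (subst blinfun_apply_basis_expansion) (auto intro!: order_trans[OF norm_sum] sum_mono)
  then have "(norm (G x))\<^sup>2 \<le> (\<Sum>b\<in>Basis. norm (b \<bullet> x) * norm (G b))\<^sup>2"
    by (intro power_mono) auto
  also have "\<dots> \<le> (\<Sum>b\<in>Basis. (norm (b \<bullet> x))\<^sup>2) * (\<Sum>b\<in>Basis. (norm (G b))\<^sup>2)" by (rule Cauchy_Schwarz_ineq_sum)
  also have "(\<Sum>b\<in>Basis. (norm (b \<bullet> x))\<^sup>2) = (norm x)\<^sup>2"
    unfolding power2_norm_eq_inner[of x] euclidean_inner[of x x]
    by (simp add: power2_eq_square inner_commute)
  finally show ?thesis by (simp add: mult.commute)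
qed

lemma sum_Basis_norm_image_le:
  fixes G :: "'v::euclidean_space \<Rightarrow>\<^sub>L 'a::real_normed_vector"
  shows "(\<Sum>k\<in>Basis. (norm (G (R k)))\<^sup>2) \<le> (\<Sum>k\<in>Basis. (norm (R k))\<^sup>2) * (\<Sum>b\<in>Basis. (norm (G b))\<^sup>2)"
  using norm_blinfun_apply_le_basis[of G] by (simp add: sum_distrib_right sum_mono mult.commute)

lemma norm_blinfun_diff_power2_le:
  "(norm (blinfun_apply C x - blinfun_apply C' y))\<^sup>2 \<le> 2 * (norm C)\<^sup>2 * (norm x)\<^sup>2 + 2 * (norm C')\<^sup>2 * (norm y)\<^sup>2"
proof -
  have "(norm (C x))\<^sup>2 \<le> (norm C)\<^sup>2 * (norm x)\<^sup>2" "(norm (C' y))\<^sup>2 \<le> (norm C')\<^sup>2 * (norm y)\<^sup>2"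
    using power_mono[OF norm_blinfun, of _ _ 2] by (simp_all add: power_mult_distrib)
  then show ?thesis using norm_diff_power2_le[of "C x" "C' y"] by linarith
qed


lemma borel_measurable_blinfun_apply [measurable (raw)]:
  "g \<in> borel_measurable N \<Longrightarrow> (\<lambda>x. blinfun_apply F (g x)) \<in> borel_measurable N"
  by (rule measurable_compose[where N=borel]) (auto intro!: borel_measurable_continuous_onI continuous_intros)

lemma borel_measurable_step_fun:
  fixes D :: "(real \<times> real \<times> ('v::real_normed_vector \<Rightarrow>\<^sub>L 'a::{real_normed_vector,second_countable_topology})) list"
  shows "(\<lambda>s. blinfun_apply (step_fun D s) v) \<in> borel_measurable borel"
  unfolding step_fun_nth blinfun.sum_left blinfun.scaleR_left by measurable

lemma step_fun_outside:
  assumes "step_on t D" "s \<notin> {0..t}" shows "step_fun D s = 0"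
proof -
  have "indicator {a<..b} s *\<^sub>R F = 0" if "(a, b, F) \<in> set D" for a b F
    using assms that by (fastforce simp: step_on_def indicator_def)
  then have "map (\<lambda>(a, b, F). indicator {a<..b} s *\<^sub>R F) D = map (\<lambda>_. 0) D" by auto
  then show ?thesis unfolding step_fun_def by (metis sum_list_0)
qed

lemma borel_measurable_step_integral:
  fixes M :: "real \<Rightarrow> 'w \<Rightarrow> 'v::euclidean_space"
    and D :: "(real \<times> real \<times> ('v \<Rightarrow>\<^sub>L 'a::{real_normed_vector,second_countable_topology})) list"
  assumes "square_integrable_mean_zero_levy_process P M" "step_on t D"
  shows "step_integral M D \<in> borel_measurable P"
proof -
  interpret square_integrable_mean_zero_levy_process P M by fact
  have "0 \<le> fst (D ! i) \<and> 0 \<le> fst (snd (D ! i))" if "i < length D" for i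
    using assms(2) nth_mem[OF that] by (auto simp: step_on_def case_prod_beta)
  then have "(\<lambda>\<omega>. \<Sum>i<length D. (snd (snd (D ! i))) (M (fst (snd (D ! i))) \<omega> - M (fst (D ! i)) \<omega>)) \<in> borel_measurable P"
    using random_variable
    by (intro borel_measurable_sum borel_measurable_blinfun_apply borel_measurable_diff) auto
  then show ?thesis by (simp add: step_integral_nth[abs_def])
qed

text \<open>Approximation of an integrand only at basis vectors, and extended by 0 outside of \<open>{0..t}\<close>. The functions
  involved then take values in a separable space, so that they are measurable together with their sums and
  differences, which is not clear for functions with values in an operator space.\<close>

lemma stochastic_integral_approximation:
  fixes M :: "real \<Rightarrow> 'w \<Rightarrow> 'v::euclidean_space"
    and \<Phi> :: "real \<Rightarrow> 'v \<Rightarrow>\<^sub>L 'a::{real_inner,banach,second_countable_topology}"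
  assumes "has_stochastic_integral P M t \<Phi> I"
  obtains D where "\<And>n. step_on t (D n)"
    "\<And>b. b \<in> Basis \<Longrightarrow> (\<lambda>n. \<integral>\<^sup>+s. ennreal ((norm (blinfun_apply (step_fun (D n) s) b - indicator {0..t} s *\<^sub>R \<Phi> s b))\<^sup>2) \<partial>lborel) \<longlonglongrightarrow> 0"
    "(\<lambda>n. \<integral>\<^sup>+\<omega>. ennreal ((norm (step_integral M (D n) \<omega> - I \<omega>))\<^sup>2) \<partial>P) \<longlonglongrightarrow> 0"
proof -
  obtain D where D: "\<And>n. step_on t (D n)"
    "(\<lambda>n. \<integral>\<^sup>+s\<in>{0..t}. ennreal ((norm (step_fun (D n) s - \<Phi> s))\<^sup>2) \<partial>lborel) \<longlonglongrightarrow> 0"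
    "(\<lambda>n. \<integral>\<^sup>+\<omega>. ennreal ((norm (step_integral M (D n) \<omega> - I \<omega>))\<^sup>2) \<partial>P) \<longlonglongrightarrow> 0"
    using assms unfolding has_stochastic_integral_def by blast
  have "(\<lambda>n. \<integral>\<^sup>+s. ennreal ((norm (blinfun_apply (step_fun (D n) s) b - indicator {0..t} s *\<^sub>R \<Phi> s b))\<^sup>2) \<partial>lborel) \<longlonglongrightarrow> 0"
    if b: "b \<in> Basis" for b
  proof (rule tendsto_sandwich[OF _ _ tendsto_const D(2)])
    have "ennreal ((norm (blinfun_apply (step_fun (D n) s) b - indicator {0..t} s *\<^sub>R \<Phi> s b))\<^sup>2)
        \<le> ennreal ((norm (step_fun (D n) s - \<Phi> s))\<^sup>2) * indicator {0..t} s" for n s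
    proof (cases "s \<in> {0..t}")
      case True
      have "norm ((step_fun (D n) s - \<Phi> s) b) \<le> norm (step_fun (D n) s - \<Phi> s)"
        using norm_blinfun[of "step_fun (D n) s - \<Phi> s" b] b by simp
      then show ?thesis using True by (simp add: blinfun.diff_left power_mono)
    next
      case False
      then show ?thesis using step_fun_outside[OF D(1) False] by simp
    qed
    then show "\<forall>\<^sub>F n in sequentially. (\<integral>\<^sup>+s. ennreal ((norm (blinfun_apply (step_fun (D n) s) b - indicator {0..t} s *\<^sub>R \<Phi> s b))\<^sup>2) \<partial>lborel)
        \<le> (\<integral>\<^sup>+s\<in>{0..t}. ennreal ((norm (step_fun (D n) s - \<Phi> s))\<^sup>2) \<partial>lborel)"
      by (intro always_eventually allI nn_integral_mono)
  qed simp
  with D that show ?thesis by blast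
qed

lemma stochastic_integrand_measurable:
  assumes "has_stochastic_integral P M t \<Phi> I"
  shows "(\<lambda>s. indicator {0..t} s *\<^sub>R blinfun_apply (\<Phi> s) v) \<in> borel_measurable borel"
proof -
  have "(\<lambda>s. indicator {0..t} s *\<^sub>R \<Phi> s) \<in> borel_measurable lborel"
    using assms by (simp add: has_stochastic_integral_def set_borel_measurable_def)
  then have "(\<lambda>s. blinfun_apply (indicator {0..t} s *\<^sub>R \<Phi> s) v) \<in> borel_measurable lborel"
    by (rule measurable_compose[where N=borel]) (auto intro!: borel_measurable_continuous_onI continuous_intros)
  then show ?thesis by (simp add: blinfun.scaleR_left)
qed

lemma ennreal_affine_sum:
  assumes "0 \<le> a" "0 \<le> b" "0 \<le> k" "0 \<le> w" "\<And>i. i \<in> I \<Longrightarrow> 0 \<le> q i"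
  shows "ennreal (a * w + b * (k * (\<Sum>i\<in>I. q i)))
    = ennreal a * ennreal w + ennreal b * (ennreal k * (\<Sum>i\<in>I. ennreal (q i)))"
  using assms by (simp add: ennreal_mult sum_nonneg)

text \<open>The step functions approximating both integrands combine to step functions approximating
  \<open>C \<Phi> - C' \<Phi>'\<close>. The isometry holds for these, and \<open>norm_square_perturbation\<close> carries it to the limit
  as an inequality.\<close>

lemma ito_inequality:
  fixes M :: "real \<Rightarrow> 'w \<Rightarrow> 'v::euclidean_space"
    and \<Phi> :: "real \<Rightarrow> 'v \<Rightarrow>\<^sub>L 'x::{real_inner,banach,second_countable_topology}"
    and \<Phi>' :: "real \<Rightarrow> 'v \<Rightarrow>\<^sub>L 'y::{real_inner,banach,second_countable_topology}"
    and C :: "'x \<Rightarrow>\<^sub>L 'h::{real_inner,banach,second_countable_topology}" and C' :: "'y \<Rightarrow>\<^sub>L 'h"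
  assumes M: "square_integrable_mean_zero_levy_process P M"
    and R: "\<And>v w. R v \<bullet> w = v \<bullet> R w"
    and cov: "\<And>v w. R v \<bullet> R w = (LINT \<omega>|P. (v \<bullet> M 1 \<omega>) * (w \<bullet> M 1 \<omega>))"
    and I: "has_stochastic_integral P M t \<Phi> I" and I': "has_stochastic_integral P M t \<Phi>' I'"
  shows "(\<integral>\<^sup>+\<omega>. ennreal ((norm (C (I \<omega>) - C' (I' \<omega>)))\<^sup>2) \<partial>P)
    \<le> (\<integral>\<^sup>+s. ennreal (indicator {0..t} s * (\<Sum>k\<in>Basis. (norm (C (\<Phi> s (R k)) - C' (\<Phi>' s (R k))))\<^sup>2)) \<partial>lborel)"
proof -
  obtain D where D: "\<And>n. step_on t (D n)"
    "\<And>b. b \<in> Basis \<Longrightarrow> (\<lambda>n. \<integral>\<^sup>+s. ennreal ((norm (blinfun_apply (step_fun (D n) s) b - indicator {0..t} s *\<^sub>R \<Phi> s b))\<^sup>2) \<partial>lborel) \<longlonglongrightarrow> 0"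
    "(\<lambda>n. \<integral>\<^sup>+\<omega>. ennreal ((norm (step_integral M (D n) \<omega> - I \<omega>))\<^sup>2) \<partial>P) \<longlonglongrightarrow> 0"
    using stochastic_integral_approximation[OF I] by blast
  obtain D' where D': "\<And>n. step_on t (D' n)"
    "\<And>b. b \<in> Basis \<Longrightarrow> (\<lambda>n. \<integral>\<^sup>+s. ennreal ((norm (blinfun_apply (step_fun (D' n) s) b - indicator {0..t} s *\<^sub>R \<Phi>' s b))\<^sup>2) \<partial>lborel) \<longlonglongrightarrow> 0"
    "(\<lambda>n. \<integral>\<^sup>+\<omega>. ennreal ((norm (step_integral M (D' n) \<omega> - I' \<omega>))\<^sup>2) \<partial>P) \<longlonglongrightarrow> 0"
    using stochastic_integral_approximation[OF I'] by blast
  have [measurable]: "I \<in> borel_measurable P" "I' \<in> borel_measurable P"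
    using I I' by (auto simp: has_stochastic_integral_def)
  note [measurable] = borel_measurable_step_integral[OF M D(1)] borel_measurable_step_integral[OF M D'(1)]
    borel_measurable_step_fun stochastic_integrand_measurable[OF I] stochastic_integrand_measurable[OF I']
  define \<Phi>0 where "\<Phi>0 s = indicator {0..t} s *\<^sub>R \<Phi> s" for s
  define \<Phi>0' where "\<Phi>0' s = indicator {0..t} s *\<^sub>R \<Phi>' s" for s
  have \<Phi>0: "\<Phi>0 s v = indicator {0..t} s *\<^sub>R \<Phi> s v" "\<Phi>0' s v = indicator {0..t} s *\<^sub>R \<Phi>' s v" for s v
    by (simp_all add: \<Phi>0_def \<Phi>0'_def blinfun.scaleR_left)
  have [measurable]: "(\<lambda>s. \<Phi>0 s v) \<in> borel_measurable borel" "(\<lambda>s. \<Phi>0' s v) \<in> borel_measurable borel" for v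
    unfolding \<Phi>0 by measurable

  \<comment> \<open>the juxtaposition of both lists represents the difference of the two step functions, since
    the intervals of a list may overlap\<close>
  define DD where "DD n = map (\<lambda>(a, b, F). (a, b, C o\<^sub>L F)) (D n) @ map (\<lambda>(a, b, F). (a, b, - (C' o\<^sub>L F))) (D' n)" for n
  have DD: "step_on t (DD n)" for n
    using D(1)[of n] D'(1)[of n] by (auto simp: DD_def step_on_def)
  have sum_list_neg: "(\<Sum>x\<leftarrow>xs. - f x) = - (\<Sum>x\<leftarrow>xs. f x)" for f :: "'e \<Rightarrow> 'h" and xs
    by (induction xs) auto
  have blinfun_sum_list: "blinfun_apply L (\<Sum>x\<leftarrow>xs. f x) = (\<Sum>x\<leftarrow>xs. L (f x))"
    for L :: "'f::real_normed_vector \<Rightarrow>\<^sub>L 'g::real_normed_vector" and f :: "'e \<Rightarrow> 'f" and xs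
    by (induction xs) (auto simp: blinfun.add_right)
  have SI: "step_integral M (DD n) \<omega> = C (step_integral M (D n) \<omega>) - C' (step_integral M (D' n) \<omega>)" for n \<omega>
    by (simp add: DD_def step_integral_def blinfun_sum_list case_prod_beta comp_def
        blinfun.minus_left sum_list_neg)
  have blinfun_sum_list_left: "blinfun_apply (\<Sum>x\<leftarrow>xs. f x) v = (\<Sum>x\<leftarrow>xs. f x v)"
    for f :: "'e \<Rightarrow> 'f::real_normed_vector \<Rightarrow>\<^sub>L 'g::real_normed_vector" and xs v
    by (induction xs) (auto simp: blinfun.add_left)
  have SF: "step_fun (DD n) s v = C (step_fun (D n) s v) - C' (step_fun (D' n) s v)" for n s v
    by (simp add: DD_def step_fun_def blinfun_sum_list blinfun_sum_list_left case_prod_beta comp_def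
        blinfun.minus_left blinfun.add_left blinfun.scaleR_left blinfun.scaleR_right sum_list_neg)

  define \<epsilon> where "\<epsilon> n = ennreal (2 * (norm C)\<^sup>2) * (\<integral>\<^sup>+\<omega>. ennreal ((norm (step_integral M (D n) \<omega> - I \<omega>))\<^sup>2) \<partial>P)
    + ennreal (2 * (norm C')\<^sup>2) * (\<integral>\<^sup>+\<omega>. ennreal ((norm (step_integral M (D' n) \<omega> - I' \<omega>))\<^sup>2) \<partial>P)" for n
  define \<kappa> where "\<kappa> = (\<Sum>k\<in>Basis. (norm (R k))\<^sup>2)"
  have "0 \<le> \<kappa>" by (simp add: \<kappa>_def sum_nonneg)
  define \<delta> where "\<delta> n = ennreal \<kappa> * (\<Sum>b\<in>Basis.
      ennreal (2 * (norm C)\<^sup>2) * (\<integral>\<^sup>+s. ennreal ((norm (blinfun_apply (step_fun (D n) s) b - \<Phi>0 s b))\<^sup>2) \<partial>lborel)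
    + ennreal (2 * (norm C')\<^sup>2) * (\<integral>\<^sup>+s. ennreal ((norm (blinfun_apply (step_fun (D' n) s) b - \<Phi>0' s b))\<^sup>2) \<partial>lborel))" for n
  let ?W = "\<lambda>s. \<Sum>k\<in>Basis. (norm (C (\<Phi>0 s (R k)) - C' (\<Phi>0' s (R k))))\<^sup>2"
  have "(\<integral>\<^sup>+\<omega>. ennreal ((norm (C (I \<omega>) - C' (I' \<omega>)))\<^sup>2) \<partial>P) \<le> (\<integral>\<^sup>+s. ennreal (?W s) \<partial>lborel)"
  proof (rule ennreal_le_by_perturbation)
    have "\<epsilon> \<longlonglongrightarrow> ennreal (2 * (norm C)\<^sup>2) * 0 + ennreal (2 * (norm C')\<^sup>2) * 0"
      unfolding \<epsilon>_def by (intro tendsto_add ennreal_tendsto_cmult D D') auto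
    then show "\<epsilon> \<longlonglongrightarrow> 0" by simp
    have "\<delta> \<longlonglongrightarrow> ennreal \<kappa> * (\<Sum>b\<in>(Basis::'v set). ennreal (2 * (norm C)\<^sup>2) * 0 + ennreal (2 * (norm C')\<^sup>2) * 0)"
      unfolding \<delta>_def \<Phi>0 by (intro tendsto_add tendsto_sum ennreal_tendsto_cmult D D') auto
    then show "\<delta> \<longlonglongrightarrow> 0" by simp
  next
    fix c :: real and n assume c: "0 < c"
    let ?S = "step_integral M (D n)" and ?S' = "step_integral M (D' n)"
    have "(norm (C (I \<omega>) - C' (I' \<omega>)))\<^sup>2 \<le> (1 + c) * (norm (step_integral M (DD n) \<omega>))\<^sup>2
      + (1 + 1 / c) * (2 * (norm C)\<^sup>2 * (norm (?S \<omega> - I \<omega>))\<^sup>2 + 2 * (norm C')\<^sup>2 * (norm (?S' \<omega> - I' \<omega>))\<^sup>2)" for \<omega>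
    proof -
      have "C (I \<omega>) - C' (I' \<omega>) - step_integral M (DD n) \<omega> = - (C (?S \<omega> - I \<omega>) - C' (?S' \<omega> - I' \<omega>))"
        by (simp add: SI blinfun.diff_right)
      then have "(norm (C (I \<omega>) - C' (I' \<omega>) - step_integral M (DD n) \<omega>))\<^sup>2
          \<le> 2 * (norm C)\<^sup>2 * (norm (?S \<omega> - I \<omega>))\<^sup>2 + 2 * (norm C')\<^sup>2 * (norm (?S' \<omega> - I' \<omega>))\<^sup>2"
        using norm_blinfun_diff_power2_le by (simp only: norm_minus_cancel)
      then show ?thesis
        using c by (intro order_trans[OF norm_square_perturbation[OF c] add_left_mono] mult_left_mono) auto
    qed
    then have "(\<integral>\<^sup>+\<omega>. ennreal ((norm (C (I \<omega>) - C' (I' \<omega>)))\<^sup>2) \<partial>P)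
      \<le> (\<integral>\<^sup>+\<omega>. ennreal (1 + c) * ennreal ((norm (step_integral M (DD n) \<omega>))\<^sup>2) + ennreal (1 + 1 / c) *
          (ennreal (2 * (norm C)\<^sup>2) * ennreal ((norm (?S \<omega> - I \<omega>))\<^sup>2)
          + ennreal (2 * (norm C')\<^sup>2) * ennreal ((norm (?S' \<omega> - I' \<omega>))\<^sup>2)) \<partial>P)"
      using c by (intro nn_integral_mono) (simp flip: ennreal_mult ennreal_plus)
    also have "\<dots> = ennreal (1 + c) * (\<integral>\<^sup>+\<omega>. ennreal ((norm (step_integral M (DD n) \<omega>))\<^sup>2) \<partial>P) + ennreal (1 + 1 / c) * \<epsilon> n"
      unfolding SI \<epsilon>_def by (simp add: nn_integral_add nn_integral_cmult)
    finally show "(\<integral>\<^sup>+\<omega>. ennreal ((norm (C (I \<omega>) - C' (I' \<omega>)))\<^sup>2) \<partial>P)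
      \<le> ennreal (1 + c) * (\<integral>\<^sup>+\<omega>. ennreal ((norm (step_integral M (DD n) \<omega>))\<^sup>2) \<partial>P) + ennreal (1 + 1 / c) * \<epsilon> n" .
  next
    fix c :: real and n assume c: "0 < c"
    let ?f = "\<lambda>s. step_fun (D n) s" and ?f' = "\<lambda>s. step_fun (D' n) s"
    have "(\<Sum>k\<in>Basis. (norm (step_fun (DD n) s (R k)))\<^sup>2) \<le> (1 + c) * ?W s + (1 + 1 / c) * (\<kappa> * (\<Sum>b\<in>Basis.
        2 * (norm C)\<^sup>2 * (norm (?f s b - \<Phi>0 s b))\<^sup>2 + 2 * (norm C')\<^sup>2 * (norm (?f' s b - \<Phi>0' s b))\<^sup>2))" for s
    proof -
      define G where "G = (C o\<^sub>L (?f s - \<Phi>0 s)) - (C' o\<^sub>L (?f' s - \<Phi>0' s))"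
      have G: "G v = C (?f s v - \<Phi>0 s v) - C' (?f' s v - \<Phi>0' s v)" for v
        by (simp add: G_def blinfun.diff_left)
      have "(\<Sum>k\<in>Basis. (norm (step_fun (DD n) s (R k)))\<^sup>2)
          \<le> (\<Sum>k\<in>Basis. (1 + c) * (norm (C (\<Phi>0 s (R k)) - C' (\<Phi>0' s (R k))))\<^sup>2 + (1 + 1 / c) * (norm (G (R k)))\<^sup>2)"
      proof (rule sum_mono)
        fix k
        have "step_fun (DD n) s (R k) - (C (\<Phi>0 s (R k)) - C' (\<Phi>0' s (R k))) = G (R k)"
          by (simp add: SF G blinfun.diff_right)
        then show "(norm (step_fun (DD n) s (R k)))\<^sup>2
          \<le> (1 + c) * (norm (C (\<Phi>0 s (R k)) - C' (\<Phi>0' s (R k))))\<^sup>2 + (1 + 1 / c) * (norm (G (R k)))\<^sup>2"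
          using norm_square_perturbation[OF c] by metis
      qed
      also have "\<dots> = (1 + c) * ?W s + (1 + 1 / c) * (\<Sum>k\<in>Basis. (norm (G (R k)))\<^sup>2)"
        by (simp only: sum.distrib sum_distrib_left)
      also have "\<dots> \<le> (1 + c) * ?W s + (1 + 1 / c) * (\<kappa> * (\<Sum>b\<in>Basis.
        2 * (norm C)\<^sup>2 * (norm (?f s b - \<Phi>0 s b))\<^sup>2 + 2 * (norm C')\<^sup>2 * (norm (?f' s b - \<Phi>0' s b))\<^sup>2))"
        using c \<open>0 \<le> \<kappa>\<close> unfolding \<kappa>_def
        by (intro add_left_mono mult_left_mono order_trans[OF sum_Basis_norm_image_le] sum_mono)
          (auto simp: G norm_blinfun_diff_power2_le)
      finally show ?thesis .
    qed
    note * = this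
    have "(\<integral>\<^sup>+s. ennreal (\<Sum>k\<in>Basis. (norm (step_fun (DD n) s (R k)))\<^sup>2) \<partial>lborel)
      \<le> (\<integral>\<^sup>+s. ennreal (1 + c) * ennreal (?W s) + ennreal (1 + 1 / c) * (ennreal \<kappa> * (\<Sum>b\<in>Basis.
        ennreal (2 * (norm C)\<^sup>2) * ennreal ((norm (?f s b - \<Phi>0 s b))\<^sup>2)
        + ennreal (2 * (norm C')\<^sup>2) * ennreal ((norm (?f' s b - \<Phi>0' s b))\<^sup>2))) \<partial>lborel)"
    proof (intro nn_integral_mono)
      fix s
      have "ennreal (\<Sum>k\<in>Basis. (norm (step_fun (DD n) s (R k)))\<^sup>2)
          \<le> ennreal ((1 + c) * ?W s + (1 + 1 / c) * (\<kappa> * (\<Sum>b\<in>Basis.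
        2 * (norm C)\<^sup>2 * (norm (?f s b - \<Phi>0 s b))\<^sup>2 + 2 * (norm C')\<^sup>2 * (norm (?f' s b - \<Phi>0' s b))\<^sup>2)))"
        by (rule ennreal_leI) (rule *)
      also have "\<dots> = ennreal (1 + c) * ennreal (?W s) + ennreal (1 + 1 / c) * (ennreal \<kappa> * (\<Sum>b\<in>Basis.
        ennreal (2 * (norm C)\<^sup>2 * (norm (?f s b - \<Phi>0 s b))\<^sup>2 + 2 * (norm C')\<^sup>2 * (norm (?f' s b - \<Phi>0' s b))\<^sup>2)))"
        using c \<open>0 \<le> \<kappa>\<close> by (intro ennreal_affine_sum) (auto intro!: sum_nonneg)
      finally show "ennreal (\<Sum>k\<in>Basis. (norm (step_fun (DD n) s (R k)))\<^sup>2)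
          \<le> ennreal (1 + c) * ennreal (?W s) + ennreal (1 + 1 / c) * (ennreal \<kappa> * (\<Sum>b\<in>Basis.
        ennreal (2 * (norm C)\<^sup>2) * ennreal ((norm (?f s b - \<Phi>0 s b))\<^sup>2)
        + ennreal (2 * (norm C')\<^sup>2) * ennreal ((norm (?f' s b - \<Phi>0' s b))\<^sup>2)))"
        by (simp add: ennreal_mult)
    qed
    also have "\<dots> = ennreal (1 + c) * (\<integral>\<^sup>+s. ennreal (?W s) \<partial>lborel) + ennreal (1 + 1 / c) * \<delta> n"
      unfolding \<delta>_def by (simp add: nn_integral_add nn_integral_cmult nn_integral_sum)
    finally show "(\<integral>\<^sup>+\<omega>. ennreal ((norm (step_integral M (DD n) \<omega>))\<^sup>2) \<partial>P)
      \<le> ennreal (1 + c) * (\<integral>\<^sup>+s. ennreal (?W s) \<partial>lborel) + ennreal (1 + 1 / c) * \<delta> n"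
      by (simp add: step_isometry[OF M R cov DD])
  qed
  also have "(\<integral>\<^sup>+s. ennreal (?W s) \<partial>lborel)
    = (\<integral>\<^sup>+s. ennreal (indicator {0..t} s * (\<Sum>k\<in>Basis. (norm (C (\<Phi> s (R k)) - C' (\<Phi>' s (R k))))\<^sup>2)) \<partial>lborel)"
    by (intro nn_integral_cong) (simp add: \<Phi>0 indicator_def)
  finally show ?thesis .
qed


section \<open>Response to controls\<close>

lemma nn_integral_energy:
  fixes D :: "real \<Rightarrow> 'v::euclidean_space \<Rightarrow> 'h::real_normed_vector"
  assumes D: "\<And>b. L2_curve (\<lambda>s. D s b)"
  shows "(\<integral>\<^sup>+s. ennreal (indicator {0..} s * (\<Sum>b\<in>Basis. (norm (D s b))\<^sup>2)) \<partial>lborel) = ennreal (impulse_energy D)"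
proof -
  have int: "set_integrable lborel {0..} (\<lambda>s. (norm (D s b))\<^sup>2)" for b
    using D by (auto simp: L2_curve_def)
  have "set_integrable lborel {0..} (\<lambda>s. \<Sum>b\<in>Basis. (norm (D s b))\<^sup>2)"
    by (intro set_integrable_sum int)
  then have "(\<integral>\<^sup>+s. ennreal (indicator {0..} s * (\<Sum>b\<in>Basis. (norm (D s b))\<^sup>2)) \<partial>lborel)
      = ennreal (LINT s:{0..}|lborel. \<Sum>b\<in>Basis. (norm (D s b))\<^sup>2)"
    unfolding set_integrable_def set_lebesgue_integral_def
    by (subst nn_integral_eq_integral) (auto simp: sum_nonneg)
  also have "(LINT s:{0..}|lborel. \<Sum>b\<in>Basis. (norm (D s b))\<^sup>2) = impulse_energy D"
    unfolding impulse_energy_def by (intro set_integral_sum int)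
  finally show ?thesis .
qed

lemma impulse_energy_nonneg: "0 \<le> impulse_energy D"
  unfolding impulse_energy_def set_lebesgue_integral_def
  by (intro sum_nonneg Bochner_Integration.integral_nonneg) simp

text \<open>Convolution up to time \<open>t\<close> sees the impulse response backwards, and only on \<open>{0..t}\<close>.\<close>

lemma reflected_energy_le:
  fixes D :: "real \<Rightarrow> 'v::euclidean_space \<Rightarrow> 'h::real_normed_vector"
  assumes D: "\<And>b. L2_curve (\<lambda>s. D s b)"
  shows "(\<integral>\<^sup>+s. ennreal (indicator {0..t} s * (\<Sum>b\<in>Basis. (norm (D (t - s) b))\<^sup>2)) \<partial>lborel)
    \<le> ennreal (impulse_energy D)"
proof -
  let ?h = "\<lambda>s. ennreal (indicator {0..} s * (\<Sum>b\<in>Basis. (norm (D s b))\<^sup>2))"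
  have "continuous_on {0..} (\<lambda>s. \<Sum>b\<in>Basis. (norm (D s b))\<^sup>2)"
    using D by (intro continuous_intros) (auto simp: L2_curve_def)
  then have h: "?h \<in> borel_measurable borel"
    using borel_measurable_continuous_on_indicator[of "{0..}" "\<lambda>s. \<Sum>b\<in>Basis. (norm (D s b))\<^sup>2"] by simp
  have "(\<integral>\<^sup>+s. ennreal (indicator {0..t} s * (\<Sum>b\<in>Basis. (norm (D (t - s) b))\<^sup>2)) \<partial>lborel)
      \<le> (\<integral>\<^sup>+s. ?h (t + (- 1) * s) \<partial>lborel)"
    by (intro nn_integral_mono ennreal_leI) (auto simp: indicator_def sum_nonneg)
  also have "\<dots> = (\<integral>\<^sup>+s. ?h s \<partial>lborel)"
    using nn_integral_real_affine[OF h, of "- 1" t] by simp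
  also have "\<dots> = ennreal (impulse_energy D)" by (rule nn_integral_energy[OF D])
  finally show ?thesis .
qed

text \<open>Cauchy--Schwarz in time. The bound is stated for the integral of the norm, with values in
  \<open>[0, \<infinity>]\<close>, since it is also what proves that the convolution integral exists.\<close>

lemma convolution:
  fixes G :: "real \<Rightarrow> 'v::euclidean_space \<Rightarrow>\<^sub>L 'h::{real_normed_vector,second_countable_topology}"
  assumes G: "\<And>b. L2_curve (\<lambda>s. blinfun_apply (G s) b)"
    and v: "(\<lambda>s. indicator {0<..<\<tau>} s *\<^sub>R v s) \<in> borel_measurable borel" and "t \<le> \<tau>"
  shows convolution_measurable: "(\<lambda>s. indicator {0<..<t} s *\<^sub>R G (t - s) (v s)) \<in> borel_measurable borel"
    and convolution_bound: "(\<integral>\<^sup>+s. ennreal (norm (indicator {0<..<t} s *\<^sub>R G (t - s) (v s))) \<partial>lborel)\<^sup>2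
      \<le> ennreal (impulse_energy (\<lambda>s. blinfun_apply (G s)))
        * (\<integral>\<^sup>+s. ennreal ((norm (v s))\<^sup>2) * indicator {0<..<\<tau>} s \<partial>lborel)"
proof -
  have orbit: "(\<lambda>s. indicator {0..} (t - s) *\<^sub>R G (t - s) b) \<in> borel_measurable borel" for b
  proof -
    have "(\<lambda>s. indicator {0..} s *\<^sub>R G s b) \<in> borel_measurable borel"
      using L2_curve_measurable[OF G[of b]] by (simp add: set_borel_measurable_def)
    then show ?thesis by (rule measurable_compose[rotated]) simp
  qed
  have "indicator {0<..<t} s *\<^sub>R G (t - s) (v s) = (\<Sum>b\<in>Basis. (indicator {0<..<t} s * (b \<bullet> (indicator {0<..<\<tau>} s *\<^sub>R v s)))
      *\<^sub>R (indicator {0..} (t - s) *\<^sub>R G (t - s) b))" for s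
    using \<open>t \<le> \<tau>\<close> blinfun_apply_basis_expansion[of "G (t - s)" "v s"] by (auto simp: indicator_def)
  then show "(\<lambda>s. indicator {0<..<t} s *\<^sub>R G (t - s) (v s)) \<in> borel_measurable borel"
    by (simp only:) (intro borel_measurable_sum borel_measurable_scaleR borel_measurable_times
        borel_measurable_inner orbit v, auto)
  define g where "g s = indicator {0..t} s * sqrt (\<Sum>b\<in>Basis. (norm (G (t - s) b))\<^sup>2)" for s
  define w where "w s = norm (indicator {0<..<\<tau>} s *\<^sub>R v s)" for s
  have g: "g s = indicator {0..t} s * sqrt (\<Sum>b\<in>Basis. (norm (indicator {0..} (t - s) *\<^sub>R G (t - s) b))\<^sup>2)" for s
    by (simp add: g_def indicator_def)
  have "g \<in> borel_measurable borel" "w \<in> borel_measurable borel"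
    unfolding g[abs_def] w_def[abs_def]
    by (intro borel_measurable_times measurable_compose[OF _ borel_measurable_norm] measurable_compose[OF _ borel_measurable_sqrt]
        borel_measurable_sum borel_measurable_power borel_measurable_indicator orbit v atLeastAtMost_borel)+
  note [measurable] = this
  have "norm (indicator {0<..<t} s *\<^sub>R G (t - s) (v s)) \<le> g s * w s" for s
  proof (cases "s \<in> {0<..<t}")
    case True
    have "norm (G (t - s) (v s)) \<le> sqrt ((\<Sum>b\<in>Basis. (norm (G (t - s) b))\<^sup>2) * (norm (v s))\<^sup>2)"
      by (intro real_le_rsqrt norm_blinfun_apply_le_basis)
    then show ?thesis using True \<open>t \<le> \<tau>\<close> by (simp add: g_def w_def real_sqrt_mult)
  qed (auto simp: g_def w_def sum_nonneg)
  then have "(\<integral>\<^sup>+s. ennreal (norm (indicator {0<..<t} s *\<^sub>R G (t - s) (v s))) \<partial>lborel)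
      \<le> (\<integral>\<^sup>+s. ennreal (g s) * ennreal (w s) \<partial>lborel)"
    by (intro nn_integral_mono) (simp add: g_def w_def sum_nonneg flip: ennreal_mult)
  then have "(\<integral>\<^sup>+s. ennreal (norm (indicator {0<..<t} s *\<^sub>R G (t - s) (v s))) \<partial>lborel)\<^sup>2
      \<le> (\<integral>\<^sup>+s. ennreal (g s) * ennreal (w s) \<partial>lborel)\<^sup>2"
    by (rule power_mono) simp
  also have "\<dots> \<le> (\<integral>\<^sup>+s. (ennreal (g s))\<^sup>2 \<partial>lborel) * (\<integral>\<^sup>+s. (ennreal (w s))\<^sup>2 \<partial>lborel)"
    by (intro Cauchy_Schwarz_nn_integral) auto
  also have "(\<integral>\<^sup>+s. (ennreal (g s))\<^sup>2 \<partial>lborel)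
      = (\<integral>\<^sup>+s. ennreal (indicator {0..t} s * (\<Sum>b\<in>Basis. (norm (G (t - s) b))\<^sup>2)) \<partial>lborel)"
    by (intro nn_integral_cong) (simp add: g_def ennreal_power sum_nonneg power_mult_distrib indicator_def)
  also have "(\<integral>\<^sup>+s. (ennreal (w s))\<^sup>2 \<partial>lborel) = (\<integral>\<^sup>+s. ennreal ((norm (v s))\<^sup>2) * indicator {0<..<\<tau>} s \<partial>lborel)"
    by (intro nn_integral_cong) (simp add: w_def ennreal_power indicator_def)
  finally show "(\<integral>\<^sup>+s. ennreal (norm (indicator {0<..<t} s *\<^sub>R G (t - s) (v s))) \<partial>lborel)\<^sup>2
      \<le> ennreal (impulse_energy (\<lambda>s. blinfun_apply (G s)))
        * (\<integral>\<^sup>+s. ennreal ((norm (v s))\<^sup>2) * indicator {0<..<\<tau>} s \<partial>lborel)"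
    by (rule order_trans) (intro mult_right_mono reflected_energy_le[OF G], simp)
qed

lemma control_response:
  fixes G :: "real \<Rightarrow> 'v::euclidean_space \<Rightarrow>\<^sub>L 'h::{real_inner,banach,second_countable_topology}"
  assumes G: "\<And>b. L2_curve (\<lambda>s. blinfun_apply (G s) b)"
    and v: "(\<lambda>s. indicator {0<..<\<tau>} s *\<^sub>R v s) \<in> borel_measurable borel" and t: "t \<le> \<tau>"
    and e: "(\<integral>\<^sup>+s. ennreal ((norm (v s))\<^sup>2) * indicator {0<..<\<tau>} s \<partial>lborel) = ennreal e" and "0 \<le> e"
  shows control_response_integrable: "set_integrable lborel {0<..<t} (\<lambda>s. G (t - s) (v s))"
    and control_response_bound: "norm (LINT s:{0<..<t}|lborel. G (t - s) (v s))
      \<le> sqrt (impulse_energy (\<lambda>s. blinfun_apply (G s))) * sqrt e"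
proof -
  let ?a = "impulse_energy (\<lambda>s. blinfun_apply (G s))"
  let ?J = "\<integral>\<^sup>+s. ennreal (norm (indicator {0<..<t} s *\<^sub>R G (t - s) (v s))) \<partial>lborel"
  have J: "?J\<^sup>2 \<le> ennreal (?a * e)"
    using convolution_bound[OF G v t] e \<open>0 \<le> e\<close> by (simp add: ennreal_mult impulse_energy_nonneg)
  then have "?J\<^sup>2 < \<infinity>" by (rule le_less_trans) simp
  then have "?J < \<infinity>" by (simp add: power_less_top_ennreal)
  then show int: "set_integrable lborel {0<..<t} (\<lambda>s. G (t - s) (v s))"
    unfolding set_integrable_def using convolution_measurable[OF G v t] by (intro integrableI_bounded) auto
  have "ennreal (norm (LINT s:{0<..<t}|lborel. G (t - s) (v s))) \<le> ?J"
    using integral_norm_bound_ennreal[OF int[unfolded set_integrable_def]] by (simp add: set_lebesgue_integral_def)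
  then have "(ennreal (norm (LINT s:{0<..<t}|lborel. G (t - s) (v s))))\<^sup>2 \<le> ?J\<^sup>2" by (rule power_mono) simp
  then have "ennreal ((norm (LINT s:{0<..<t}|lborel. G (t - s) (v s)))\<^sup>2) \<le> ennreal (?a * e)"
    using J by (simp add: ennreal_power)
  then have "(norm (LINT s:{0<..<t}|lborel. G (t - s) (v s)))\<^sup>2 \<le> ?a * e"
    using \<open>0 \<le> e\<close> by (subst (asm) ennreal_le_iff) (simp_all add: impulse_energy_nonneg)
  then show "norm (LINT s:{0<..<t}|lborel. G (t - s) (v s)) \<le> sqrt ?a * sqrt e"
    unfolding real_sqrt_mult[symmetric] by (rule real_le_rsqrt)
qed

lemma ennreal_power2_le_imp_le:
  fixes x :: ennreal
  assumes "x\<^sup>2 \<le> ennreal (c\<^sup>2)" "0 \<le> c"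
  shows "x \<le> ennreal c"
proof (cases x)
  case (real r)
  then have "ennreal (r\<^sup>2) \<le> ennreal (c\<^sup>2)" using assms(1) by (simp add: ennreal_power)
  then have "r\<^sup>2 \<le> c\<^sup>2" by simp
  then have "r \<le> c" using assms(2) by (rule power2_le_imp_le)
  then show ?thesis using real by (simp add: ennreal_leI)
next
  case top
  then show ?thesis using assms(1) by (simp add: top_unique)
qed

text \<open>The triangle inequality in \<open>L\<^sup>2\<close>, for integrals with values in \<open>[0, \<infinity>]\<close>: the mixed term is at most
  \<open>a b\<close> by Cauchy--Schwarz.\<close>

lemma nn_integral_Minkowski:
  fixes f g :: "'w \<Rightarrow> real"
  assumes [measurable]: "f \<in> borel_measurable N" "g \<in> borel_measurable N"
    and nonneg: "\<And>x. 0 \<le> f x" "\<And>x. 0 \<le> g x" "0 \<le> a" "0 \<le> b"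
    and f: "(\<integral>\<^sup>+x. ennreal ((f x)\<^sup>2) \<partial>N) \<le> ennreal (a\<^sup>2)"
    and g: "(\<integral>\<^sup>+x. ennreal ((g x)\<^sup>2) \<partial>N) \<le> ennreal (b\<^sup>2)"
  shows "(\<integral>\<^sup>+x. ennreal ((f x + g x)\<^sup>2) \<partial>N) \<le> ennreal ((a + b)\<^sup>2)"
proof -
  let ?J = "\<integral>\<^sup>+x. ennreal (f x) * ennreal (g x) \<partial>N"
  have "?J\<^sup>2 \<le> (\<integral>\<^sup>+x. (ennreal (f x))\<^sup>2 \<partial>N) * (\<integral>\<^sup>+x. (ennreal (g x))\<^sup>2 \<partial>N)"
    by (intro Cauchy_Schwarz_nn_integral) auto
  also have "\<dots> \<le> ennreal (a\<^sup>2) * ennreal (b\<^sup>2)"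
    using f g nonneg by (intro mult_mono) (simp_all add: ennreal_power)
  also have "\<dots> = (ennreal (a * b))\<^sup>2" using nonneg by (simp add: ennreal_power power_mult_distrib flip: ennreal_mult)
  also have "\<dots> = ennreal ((a * b)\<^sup>2)" using nonneg by (simp add: ennreal_power)
  finally have J2: "?J\<^sup>2 \<le> ennreal ((a * b)\<^sup>2)" .
  have J: "?J \<le> ennreal (a * b)"
    using nonneg by (intro ennreal_power2_le_imp_le[OF J2]) simp
  have "(\<integral>\<^sup>+x. ennreal ((f x + g x)\<^sup>2) \<partial>N)
      = (\<integral>\<^sup>+x. ennreal ((f x)\<^sup>2) + (ennreal ((g x)\<^sup>2) + 2 * (ennreal (f x) * ennreal (g x))) \<partial>N)"
    using nonneg by (intro nn_integral_cong) (simp add: power2_sum ennreal_mult mult.assoc)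
  also have "\<dots> = (\<integral>\<^sup>+x. ennreal ((f x)\<^sup>2) \<partial>N) + ((\<integral>\<^sup>+x. ennreal ((g x)\<^sup>2) \<partial>N) + 2 * ?J)"
    by (simp add: nn_integral_add nn_integral_cmult)
  also have "\<dots> \<le> ennreal (a\<^sup>2) + (ennreal (b\<^sup>2) + 2 * ennreal (a * b))"
    by (intro add_mono mult_left_mono f g J) auto
  also have "\<dots> = ennreal ((a + b)\<^sup>2)"
    using nonneg by (simp add: power2_sum ennreal_mult mult.assoc)
  finally show ?thesis .
qed


lemma set_integral_blinfun_apply:
  fixes f :: "'s \<Rightarrow> 'a::{banach,second_countable_topology}" and F :: "'a \<Rightarrow>\<^sub>L 'b::{banach,second_countable_topology}"
  assumes "set_integrable N A f"
  shows "(LINT s:A|N. F (f s)) = F (LINT s:A|N. f s)"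
  using integral_bounded_linear[OF blinfun.bounded_linear_right assms[unfolded set_integrable_def], of F]
  by (simp add: set_lebesgue_integral_def blinfun.scaleR_right)

text \<open>Tonelli: \<open>e \<omega>\<close> is the energy of the path of the control at \<open>\<omega>\<close>, a measurable function with expectation
  \<open>\<parallel>u\<parallel>\<^sup>2\<close>. Only almost every path is square integrable, whence the exceptional null set.\<close>

lemma control_energy:
  fixes u :: "real \<Rightarrow> 'w \<Rightarrow> 'v::euclidean_space"
  assumes "prob_space P"
    and u: "(\<lambda>(\<omega>, t). u t \<omega>) \<in> borel_measurable (P \<Otimes>\<^sub>M restrict_space lborel {0<..<\<tau>})"
    and int: "integrable (P \<Otimes>\<^sub>M restrict_space lborel {0<..<\<tau>}) (\<lambda>(\<omega>, t). (norm (u t \<omega>))\<^sup>2)"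
  shows "\<exists>e. e \<in> borel_measurable P \<and> (\<forall>\<omega>. 0 \<le> e \<omega>) \<and>
    (\<integral>\<^sup>+\<omega>. ennreal (e \<omega>) \<partial>P) = ennreal ((L2_norm P \<tau> u)\<^sup>2) \<and>
    (AE \<omega> in P. (\<integral>\<^sup>+s. ennreal ((norm (u s \<omega>))\<^sup>2) * indicator {0<..<\<tau>} s \<partial>lborel) = ennreal (e \<omega>)) \<and>
    (\<forall>\<omega>\<in>space P. (\<lambda>s. indicator {0<..<\<tau>} s *\<^sub>R u s \<omega>) \<in> borel_measurable borel)"
proof -
  interpret prob_space P by fact
  let ?N = "restrict_space lborel {0<..<\<tau>}"
  interpret N: sigma_finite_measure ?N
    by (rule sigma_finite_measure_restrict_space) (auto intro: lborel.sigma_finite_measure_axioms)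
  interpret pair_sigma_finite P ?N ..
  define e where "e \<omega> = (LINT t|?N. (norm (u t \<omega>))\<^sup>2)" for \<omega>
  have e_int: "integrable P e" using integrable_fst'[OF int] by (simp add: e_def[abs_def])
  have e_nonneg: "0 \<le> e \<omega>" for \<omega> unfolding e_def by (intro Bochner_Integration.integral_nonneg) simp
  show ?thesis
  proof (intro exI conjI allI ballI)
    show "e \<in> borel_measurable P" using e_int by (rule borel_measurable_integrable)
    show "0 \<le> e \<omega>" for \<omega> by (rule e_nonneg)
    have "(LINT t:{0<..<\<tau>}|lborel. (norm (u t \<omega>))\<^sup>2) = e \<omega>" for \<omega>
      unfolding e_def set_lebesgue_integral_def by (subst integral_restrict_space) auto
    then have "(L2_norm P \<tau> u)\<^sup>2 = (LINT \<omega>|P. e \<omega>)"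
      unfolding L2_norm_def by (simp add: Bochner_Integration.integral_nonneg e_nonneg)
    then show "(\<integral>\<^sup>+\<omega>. ennreal (e \<omega>) \<partial>P) = ennreal ((L2_norm P \<tau> u)\<^sup>2)"
      using e_int e_nonneg by (simp add: nn_integral_eq_integral)
    show "AE \<omega> in P. (\<integral>\<^sup>+s. ennreal ((norm (u s \<omega>))\<^sup>2) * indicator {0<..<\<tau>} s \<partial>lborel) = ennreal (e \<omega>)"
      using AE_integrable_fst'[OF int]
    proof eventually_elim
      case (elim \<omega>)
      then have "integrable ?N (\<lambda>t. (norm (u t \<omega>))\<^sup>2)" by simp
      then have "(\<integral>\<^sup>+t. ennreal ((norm (u t \<omega>))\<^sup>2) \<partial>?N) = ennreal (e \<omega>)"
        by (simp add: nn_integral_eq_integral e_def)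
      then show ?case by (subst (asm) nn_integral_restrict_space) auto
    qed
    show "(\<lambda>s. indicator {0<..<\<tau>} s *\<^sub>R u s \<omega>) \<in> borel_measurable borel" if "\<omega> \<in> space P" for \<omega>
    proof -
      have "(\<lambda>t. u t \<omega>) \<in> borel_measurable ?N"
        using measurable_Pair2[OF u that] by simp
      then show ?thesis by (subst (asm) borel_measurable_restrict_space_iff) auto
    qed
  qed
qed

lemma L2_ad_diff:
  fixes u u' :: "real \<Rightarrow> 'w \<Rightarrow> 'v::euclidean_space"
  assumes "u \<in> L2_ad P \<F> \<tau>" "u' \<in> L2_ad P \<F> \<tau>"
  shows "(\<lambda>t \<omega>. u t \<omega> - u' t \<omega>) \<in> L2_ad P \<F> \<tau>"
proof -
  let ?M = "P \<Otimes>\<^sub>M restrict_space lborel {0<..<\<tau>}"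
  have u: "(\<lambda>(\<omega>, t). u t \<omega>) \<in> borel_measurable ?M" "integrable ?M (\<lambda>(\<omega>, t). (norm (u t \<omega>))\<^sup>2)"
    "\<forall>t\<in>{0<..<\<tau>}. u t \<in> borel_measurable (\<F> t)"
    and u': "(\<lambda>(\<omega>, t). u' t \<omega>) \<in> borel_measurable ?M" "integrable ?M (\<lambda>(\<omega>, t). (norm (u' t \<omega>))\<^sup>2)"
    "\<forall>t\<in>{0<..<\<tau>}. u' t \<in> borel_measurable (\<F> t)"
    using assms by (simp_all add: L2_ad_def)
  have meas: "(\<lambda>(\<omega>, t). u t \<omega> - u' t \<omega>) \<in> borel_measurable ?M"
    using borel_measurable_diff[OF u(1) u'(1)] by (simp add: case_prod_beta)
  have "integrable ?M (\<lambda>x. 2 * (case x of (\<omega>, t) \<Rightarrow> (norm (u t \<omega>))\<^sup>2) + 2 * (case x of (\<omega>, t) \<Rightarrow> (norm (u' t \<omega>))\<^sup>2))"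
    using u(2) u'(2) by (intro Bochner_Integration.integrable_add integrable_mult_right) auto
  moreover have "(\<lambda>(\<omega>, t). (norm (u t \<omega> - u' t \<omega>))\<^sup>2) \<in> borel_measurable ?M"
    using borel_measurable_power[OF measurable_compose[OF meas borel_measurable_norm], of 2] by (simp add: case_prod_beta)
  ultimately have "integrable ?M (\<lambda>(\<omega>, t). (norm (u t \<omega> - u' t \<omega>))\<^sup>2)"
    by (rule Bochner_Integration.integrable_bound) (auto simp: norm_diff_power2_le)
  with meas u(3) u'(3) show ?thesis by (simp add: L2_ad_def borel_measurable_diff)
qed

section \<open>The error bound\<close>

theorem theorem1:
  fixes P :: "'w measure"
    and M :: "real \<Rightarrow> 'w \<Rightarrow> real^'d"
    and A :: "('x::{real_inner,banach,second_countable_topology} \<times> 'x) set"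
    and T :: "real \<Rightarrow> ('x \<Rightarrow>\<^sub>L 'x)"
    and B :: "(real^'m) \<Rightarrow>\<^sub>L 'x" and K :: "(real^'d) \<Rightarrow>\<^sub>L 'x"
    and C :: "'x \<Rightarrow>\<^sub>L 'h::{real_inner,banach,second_countable_topology}"
    and A' :: "('y::{real_inner,banach,second_countable_topology} \<times> 'y) set"
    and T' :: "real \<Rightarrow> ('y \<Rightarrow>\<^sub>L 'y)"
    and B' :: "(real^'m) \<Rightarrow>\<^sub>L 'y" and K' :: "(real^'d) \<Rightarrow>\<^sub>L 'y"
    and C' :: "'y \<Rightarrow>\<^sub>L 'h"
    and u u' :: "real \<Rightarrow> 'w \<Rightarrow> real^'m"
    and Y Y' :: "real \<Rightarrow> 'w \<Rightarrow> 'h"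
    and \<tau> :: real
  assumes "square_integrable_mean_zero_levy_process P M"
    and "ou_system A T B K C" and "exponentially_stable T"
    and "ou_system A' T' B' K' C'" and "exponentially_stable T'"
    and "0 < \<tau>"
    and "u \<in> L2_ad P (induced_filtration P M) \<tau>"
    and "u' \<in> L2_ad P (induced_filtration P M) \<tau>"
    and "ou_output P M \<tau> T B K C u (\<lambda>_. 0) Y"
    and "ou_output P M \<tau> T' B' K' C' u' (\<lambda>_. 0) Y'"
  shows "(\<forall>t\<in>{0..\<tau>}. integrable P (\<lambda>\<omega>. (norm (Y t \<omega> - Y' t \<omega>))\<^sup>2)) \<and>
    bdd_above ((\<lambda>t. sqrt (LINT \<omega>|P. (norm (Y t \<omega> - Y' t \<omega>))\<^sup>2)) ` {0..\<tau>}) \<and>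
    (SUP t\<in>{0..\<tau>}. sqrt (LINT \<omega>|P. (norm (Y t \<omega> - Y' t \<omega>))\<^sup>2))
      \<le> sqrt 2 * max 1 (L2_norm P \<tau> u) *
          sqrt (op_trace ((C o\<^sub>L ou_gramian P M T B K T B K o\<^sub>L adj C)
                  - 2 *\<^sub>R (C o\<^sub>L ou_gramian P M T B K T' B' K' o\<^sub>L adj C')
                  + (C' o\<^sub>L ou_gramian P M T' B' K' T' B' K' o\<^sub>L adj C')))
        + sqrt (op_trace (C' o\<^sub>L gramian T' B' T' B' o\<^sub>L adj C'))
            * L2_norm P \<tau> (\<lambda>t \<omega>. u t \<omega> - u' t \<omega>)"
proof -
  interpret M: square_integrable_mean_zero_levy_process P M by fact
  have T: "c0_semigroup T" "exponentially_stable T" and T': "c0_semigroup T'" "exponentially_stable T'"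
    using assms(2-5) by (auto simp: ou_system_def)
  obtain Z where Z: "mild_solution P M \<tau> T B K u (\<lambda>_. 0) Z" "\<And>t \<omega>. t \<in> {0..\<tau>} \<Longrightarrow> \<omega> \<in> space P \<Longrightarrow> Y t \<omega> = C (Z t \<omega>)"
    using assms(9) unfolding ou_output_def by blast
  obtain Z' where Z': "mild_solution P M \<tau> T' B' K' u' (\<lambda>_. 0) Z'" "\<And>t \<omega>. t \<in> {0..\<tau>} \<Longrightarrow> \<omega> \<in> space P \<Longrightarrow> Y' t \<omega> = C' (Z' t \<omega>)"
    using assms(10) unfolding ou_output_def by blast
  have u: "(\<lambda>(\<omega>, t). u t \<omega>) \<in> borel_measurable (P \<Otimes>\<^sub>M restrict_space lborel {0<..<\<tau>})"
      "integrable (P \<Otimes>\<^sub>M restrict_space lborel {0<..<\<tau>}) (\<lambda>(\<omega>, t). (norm (u t \<omega>))\<^sup>2)"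
    and u': "(\<lambda>(\<omega>, t). u' t \<omega>) \<in> borel_measurable (P \<Otimes>\<^sub>M restrict_space lborel {0<..<\<tau>})"
      "integrable (P \<Otimes>\<^sub>M restrict_space lborel {0<..<\<tau>}) (\<lambda>(\<omega>, t). (norm (u' t \<omega>))\<^sup>2)"
    and du: "(\<lambda>(\<omega>, t). u t \<omega> - u' t \<omega>) \<in> borel_measurable (P \<Otimes>\<^sub>M restrict_space lborel {0<..<\<tau>})"
      "integrable (P \<Otimes>\<^sub>M restrict_space lborel {0<..<\<tau>}) (\<lambda>(\<omega>, t). (norm (u t \<omega> - u' t \<omega>))\<^sup>2)"
    using assms(7,8) L2_ad_diff[OF assms(7,8)] by (simp_all add: L2_ad_def)
  obtain e where e: "e \<in> borel_measurable P" "\<And>\<omega>. 0 \<le> e \<omega>"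
    "(\<integral>\<^sup>+\<omega>. ennreal (e \<omega>) \<partial>P) = ennreal ((L2_norm P \<tau> u)\<^sup>2)"
    "AE \<omega> in P. (\<integral>\<^sup>+s. ennreal ((norm (u s \<omega>))\<^sup>2) * indicator {0<..<\<tau>} s \<partial>lborel) = ennreal (e \<omega>)"
    "\<And>\<omega>. \<omega> \<in> space P \<Longrightarrow> (\<lambda>s. indicator {0<..<\<tau>} s *\<^sub>R u s \<omega>) \<in> borel_measurable borel"
    using control_energy[OF M.prob_space_axioms u] by (elim exE conjE) (rule that; simp)
  obtain e' where "e' \<in> borel_measurable P" and e': "\<And>\<omega>. 0 \<le> e' \<omega>"
    and "(\<integral>\<^sup>+\<omega>. ennreal (e' \<omega>) \<partial>P) = ennreal ((L2_norm P \<tau> u')\<^sup>2)"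
    and e'_AE: "AE \<omega> in P. (\<integral>\<^sup>+s. ennreal ((norm (u' s \<omega>))\<^sup>2) * indicator {0<..<\<tau>} s \<partial>lborel) = ennreal (e' \<omega>)"
    and e'_measurable: "\<And>\<omega>. \<omega> \<in> space P \<Longrightarrow> (\<lambda>s. indicator {0<..<\<tau>} s *\<^sub>R u' s \<omega>) \<in> borel_measurable borel"
    using control_energy[OF M.prob_space_axioms u'] by (elim exE conjE) (rule that; simp)
  obtain d where d: "d \<in> borel_measurable P" "\<And>\<omega>. 0 \<le> d \<omega>"
    "(\<integral>\<^sup>+\<omega>. ennreal (d \<omega>) \<partial>P) = ennreal ((L2_norm P \<tau> (\<lambda>t \<omega>. u t \<omega> - u' t \<omega>))\<^sup>2)"
    "AE \<omega> in P. (\<integral>\<^sup>+s. ennreal ((norm (u s \<omega> - u' s \<omega>))\<^sup>2) * indicator {0<..<\<tau>} s \<partial>lborel) = ennreal (d \<omega>)"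
    "\<And>\<omega>. \<omega> \<in> space P \<Longrightarrow> (\<lambda>s. indicator {0<..<\<tau>} s *\<^sub>R (u s \<omega> - u' s \<omega>)) \<in> borel_measurable borel"
    using control_energy[OF M.prob_space_axioms du] by (elim exE conjE) (rule that; simp)

  define R where "R = psd_sqrt (covariance P M)"
  have noise: "noise_operator P M L v = L (R *v v)" for L :: "(real^'d) \<Rightarrow>\<^sub>L 'z::real_normed_vector" and v
    by (simp add: noise_operator_def R_def bounded_linear_Blinfun_apply matrix_vector_mul_bounded_linear)
  define a1 where "a1 = impulse_energy (\<lambda>s v. C (T s (B v)) - C' (T' s (B' v)))"
  define a2 where "a2 = impulse_energy (\<lambda>s v. C (T s (noise_operator P M K v)) - C' (T' s (noise_operator P M K' v)))"
  define a3 where "a3 = impulse_energy (\<lambda>s v. C' (T' s (B' v)))"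
  have nonneg: "0 \<le> a1" "0 \<le> a2" "0 \<le> a3" by (simp_all add: a1_def a2_def a3_def impulse_energy_nonneg)
  have trace: "op_trace ((C o\<^sub>L ou_gramian P M T B K T B K o\<^sub>L adj C)
                  - 2 *\<^sub>R (C o\<^sub>L ou_gramian P M T B K T' B' K' o\<^sub>L adj C')
                  + (C' o\<^sub>L ou_gramian P M T' B' K' T' B' K' o\<^sub>L adj C')) = a1 + a2"
    unfolding ou_gramian_def a1_def a2_def by (rule op_trace_error[OF T T'])
  have trace': "op_trace (C' o\<^sub>L gramian T' B' T' B' o\<^sub>L adj C') = a3"
    unfolding a3_def by (rule op_trace_output_gramian[OF T'])
  let ?U = "L2_norm P \<tau> u" and ?V = "L2_norm P \<tau> (\<lambda>t \<omega>. u t \<omega> - u' t \<omega>)"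
  have norms: "0 \<le> ?U" "0 \<le> ?V"
    by (simp_all add: L2_norm_def set_lebesgue_integral_def Bochner_Integration.integral_nonneg)
  define \<beta> where "\<beta> = sqrt a2 + (sqrt a1 * ?U + sqrt a3 * ?V)"
  have "0 \<le> \<beta>" using nonneg norms by (simp add: \<beta>_def)

  have bound: "integrable P (\<lambda>\<omega>. (norm (Y t \<omega> - Y' t \<omega>))\<^sup>2)
      \<and> sqrt (LINT \<omega>|P. (norm (Y t \<omega> - Y' t \<omega>))\<^sup>2) \<le> \<beta>" if t: "t \<in> {0..\<tau>}" for t
  proof -
    obtain I where I: "has_stochastic_integral P M t (\<lambda>s. T (t - s) o\<^sub>L K) I"
      "AE \<omega> in P. Z t \<omega> = T t 0 + I \<omega> + (LINT s:{0<..<t}|lborel. T (t - s) (B (u s \<omega>)))"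
      using Z(1) t unfolding mild_solution_def by blast
    obtain I' where I': "has_stochastic_integral P M t (\<lambda>s. T' (t - s) o\<^sub>L K') I'"
      "AE \<omega> in P. Z' t \<omega> = T' t 0 + I' \<omega> + (LINT s:{0<..<t}|lborel. T' (t - s) (B' (u' s \<omega>)))"
      using Z'(1) t unfolding mild_solution_def by blast
    have meas_Z: "Z t \<in> borel_measurable P" "Z' t \<in> borel_measurable P"
      using Z(1) Z'(1) t unfolding mild_solution_def by blast+
    have meas_I: "I \<in> borel_measurable P" "I' \<in> borel_measurable P"
      using I(1) I'(1) by (auto simp: has_stochastic_integral_def)
    have meas_Y: "(\<lambda>\<omega>. norm (Y t \<omega> - Y' t \<omega>)) \<in> borel_measurable P"
    proof -
      have "(\<lambda>\<omega>. norm (C (Z t \<omega>) - C' (Z' t \<omega>))) \<in> borel_measurable P"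
        using meas_Z by measurable
      then show ?thesis by (rule iffD1[OF measurable_cong, rotated]) (simp add: Z(2)[OF t] Z'(2)[OF t])
    qed
    define N where "N \<omega> = norm (C (I \<omega>) - C' (I' \<omega>))" for \<omega>
    have N_nonneg: "0 \<le> N \<omega>" for \<omega> by (simp add: N_def)
    have meas_N: "N \<in> borel_measurable P"
      unfolding N_def using meas_I by measurable

    have "(\<integral>\<^sup>+\<omega>. ennreal ((N \<omega>)\<^sup>2) \<partial>P)
      \<le> (\<integral>\<^sup>+s. ennreal (indicator {0..t} s * (\<Sum>k\<in>Basis.
          (norm (C ((T (t - s) o\<^sub>L K) (R *v k)) - C' ((T' (t - s) o\<^sub>L K') (R *v k))))\<^sup>2)) \<partial>lborel)"
      unfolding N_def R_def
      by (rule ito_inequality[OF assms(1) noise_root_inner[OF assms(1)] I(1) I'(1)])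
    also have "\<dots> \<le> ennreal a2"
      unfolding a2_def
      using reflected_energy_le[of "\<lambda>s v. C (T s (noise_operator P M K v)) - C' (T' s (noise_operator P M K' v))" t]
      by (simp add: noise L2_curve_diff L2_curve_blinfun L2_curve_orbit T T')
    finally have N2: "(\<integral>\<^sup>+\<omega>. ennreal ((N \<omega>)\<^sup>2) \<partial>P) \<le> ennreal ((sqrt a2)\<^sup>2)" using nonneg by simp

    \<comment> \<open>the decomposition of the error into noise, model error and control error, path by path\<close>
    have path: "AE \<omega> in P. norm (Y t \<omega> - Y' t \<omega>) \<le> N \<omega> + (sqrt a1 * sqrt (e \<omega>) + sqrt a3 * sqrt (d \<omega>))"
      using I(2) I'(2) e(4) e'_AE d(4) AE_space
    proof eventually_elim
      case (elim \<omega>)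
      let ?G = "\<lambda>s. C o\<^sub>L T s o\<^sub>L B" and ?G' = "\<lambda>s. C' o\<^sub>L T' s o\<^sub>L B'"
      have curves: "L2_curve (\<lambda>s. blinfun_apply (T s o\<^sub>L B) b)" "L2_curve (\<lambda>s. blinfun_apply (T' s o\<^sub>L B') b)"
        "L2_curve (\<lambda>s. blinfun_apply (?G s) b)" "L2_curve (\<lambda>s. blinfun_apply (?G' s) b)"
        "L2_curve (\<lambda>s. blinfun_apply (?G s - ?G' s) b)" for b
        by (simp_all add: blinfun.diff_left L2_curve_diff L2_curve_blinfun L2_curve_orbit T T')
      have t': "t \<le> \<tau>" using t by simp
      note u_path = e(5)[OF elim(6)] t' elim(3) e(2)
      note u'_path = e'_measurable[OF elim(6)] t' elim(4) e'
      note du_path = d(5)[OF elim(6)] t' elim(5) d(2)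
      have "(LINT s:{0<..<t}|lborel. ?G (t - s) (u s \<omega>)) = C (LINT s:{0<..<t}|lborel. T (t - s) (B (u s \<omega>)))"
        using set_integral_blinfun_apply[OF control_response_integrable[OF curves(1) u_path], of C] by simp
      moreover have "(LINT s:{0<..<t}|lborel. ?G' (t - s) (u' s \<omega>)) = C' (LINT s:{0<..<t}|lborel. T' (t - s) (B' (u' s \<omega>)))"
        using set_integral_blinfun_apply[OF control_response_integrable[OF curves(2) u'_path], of C'] by simp
      moreover have "(LINT s:{0<..<t}|lborel. ?G (t - s) (u s \<omega>)) - (LINT s:{0<..<t}|lborel. ?G' (t - s) (u' s \<omega>))
          = (LINT s:{0<..<t}|lborel. (?G (t - s) - ?G' (t - s)) (u s \<omega>))
            + (LINT s:{0<..<t}|lborel. ?G' (t - s) (u s \<omega> - u' s \<omega>))"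
        unfolding blinfun.diff_left blinfun.diff_right
        using control_response_integrable[OF curves(3) u_path] control_response_integrable[OF curves(4) u_path]
          control_response_integrable[OF curves(4) u'_path]
        by (simp only: set_integral_diff(2)) simp
      ultimately have "Y t \<omega> - Y' t \<omega> = (C (I \<omega>) - C' (I' \<omega>))
          + ((LINT s:{0<..<t}|lborel. (?G (t - s) - ?G' (t - s)) (u s \<omega>))
            + (LINT s:{0<..<t}|lborel. ?G' (t - s) (u s \<omega> - u' s \<omega>)))"
        using elim(1,2,6) t by (simp add: Z(2)[OF t] Z'(2)[OF t] blinfun.add_right algebra_simps)
      then have "norm (Y t \<omega> - Y' t \<omega>) \<le> N \<omega>
          + (norm (LINT s:{0<..<t}|lborel. (?G (t - s) - ?G' (t - s)) (u s \<omega>))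
            + norm (LINT s:{0<..<t}|lborel. ?G' (t - s) (u s \<omega> - u' s \<omega>)))"
        unfolding N_def by (simp only:) (intro norm_triangle_mono norm_triangle_ineq order_refl)
      also have "\<dots> \<le> N \<omega> + (sqrt a1 * sqrt (e \<omega>) + sqrt a3 * sqrt (d \<omega>))"
        using control_response_bound[OF curves(5) u_path] control_response_bound[OF curves(4) du_path]
        by (simp add: a1_def a3_def impulse_energy_def blinfun.diff_left)
      finally show ?case .
    qed

    have e2: "(\<integral>\<^sup>+\<omega>. ennreal ((sqrt a1 * sqrt (e \<omega>))\<^sup>2) \<partial>P) \<le> ennreal ((sqrt a1 * ?U)\<^sup>2)"
      using e nonneg by (simp add: power_mult_distrib ennreal_mult nn_integral_cmult)
    have d2: "(\<integral>\<^sup>+\<omega>. ennreal ((sqrt a3 * sqrt (d \<omega>))\<^sup>2) \<partial>P) \<le> ennreal ((sqrt a3 * ?V)\<^sup>2)"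
      using d nonneg by (simp add: power_mult_distrib ennreal_mult nn_integral_cmult)
    have "(\<integral>\<^sup>+\<omega>. ennreal ((norm (Y t \<omega> - Y' t \<omega>))\<^sup>2) \<partial>P)
        \<le> (\<integral>\<^sup>+\<omega>. ennreal ((N \<omega> + (sqrt a1 * sqrt (e \<omega>) + sqrt a3 * sqrt (d \<omega>)))\<^sup>2) \<partial>P)"
      using path by (intro nn_integral_mono_AE) (auto elim!: eventually_mono intro!: ennreal_leI power_mono)
    also have "\<dots> \<le> ennreal (\<beta>\<^sup>2)"
      unfolding \<beta>_def using nonneg norms e(1,2) d(1,2) meas_N
      by (intro nn_integral_Minkowski N2 e2 d2) (auto simp: N_nonneg)
    finally have sq: "(\<integral>\<^sup>+\<omega>. ennreal ((norm (Y t \<omega> - Y' t \<omega>))\<^sup>2) \<partial>P) \<le> ennreal (\<beta>\<^sup>2)" .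
    have int: "integrable P (\<lambda>\<omega>. (norm (Y t \<omega> - Y' t \<omega>))\<^sup>2)"
      using meas_Y le_less_trans[OF sq] by (intro integrableI_nonneg) auto
    then have "ennreal (LINT \<omega>|P. (norm (Y t \<omega> - Y' t \<omega>))\<^sup>2) \<le> ennreal (\<beta>\<^sup>2)"
      using sq by (simp add: nn_integral_eq_integral)
    then have "(LINT \<omega>|P. (norm (Y t \<omega> - Y' t \<omega>))\<^sup>2) \<le> \<beta>\<^sup>2" by (subst (asm) ennreal_le_iff) simp_all
    then have "sqrt (LINT \<omega>|P. (norm (Y t \<omega> - Y' t \<omega>))\<^sup>2) \<le> \<beta>"
      using \<open>0 \<le> \<beta>\<close> by (rule real_le_lsqrt[rotated -1])
    with int show ?thesis by simp
  qed

  \<comment> \<open>the factor \<open>2\<^sup>1\<^sup>/\<^sup>2\<close> is the price for merging two square roots into one trace\<close>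
  let ?m = "max 1 ?U"
  have "sqrt a2 + sqrt a1 * ?U \<le> sqrt a2 * ?m + sqrt a1 * ?m"
    using mult_left_mono[of 1 ?m "sqrt a2"] mult_left_mono[of ?U ?m "sqrt a1"] nonneg by simp
  also have "\<dots> = ?m * (sqrt a1 + sqrt a2)" by (simp add: algebra_simps)
  also have "\<dots> \<le> ?m * (sqrt 2 * sqrt (a1 + a2))"
  proof (rule mult_left_mono)
    have "(sqrt a1 + sqrt a2)\<^sup>2 \<le> 2 * (a1 + a2)"
      using sum_squares_bound[of "sqrt a1" "sqrt a2"] nonneg by (simp add: power2_sum)
    then show "sqrt a1 + sqrt a2 \<le> sqrt 2 * sqrt (a1 + a2)"
      unfolding real_sqrt_mult[symmetric] by (rule real_le_rsqrt)
  qed simp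
  finally have "\<beta> \<le> sqrt 2 * ?m * sqrt (a1 + a2) + sqrt a3 * ?V" by (simp add: \<beta>_def mult_ac)
  moreover have "(SUP t\<in>{0..\<tau>}. sqrt (LINT \<omega>|P. (norm (Y t \<omega> - Y' t \<omega>))\<^sup>2)) \<le> \<beta>"
    using bound \<open>0 < \<tau>\<close> by (intro cSUP_least) auto
  moreover have "bdd_above ((\<lambda>t. sqrt (LINT \<omega>|P. (norm (Y t \<omega> - Y' t \<omega>))\<^sup>2)) ` {0..\<tau>})"
    using bound by (intro bdd_aboveI[of _ \<beta>]) auto
  ultimately show ?thesis using bound unfolding trace trace' by auto
qed

end
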